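(* Let $2<n<\omega$ and let $\mathcal T$ be any signature between $\mathsf{Df}_n$ and $\mathsf{PEA}_n$. Then the class of strongly representable atom structures of type $\mathcal T$ is not elementary.
   Context: $\mathsf{Df}_n$ has the Boolean operations and cylindrifiers $c_i$ ($i<n$); $\mathsf{PEA}_n$ has in addition the diagonal constants $d_{ij}$, replacements $s^i_j$ and transpositions $s_{ij}$ ($i,j<n$). A signature between them contains the $\mathsf{Df}_n$ operations together with some of the families $(d_{ij})$, $(s^i_j)$, $(s_{ij})$; e.g. $\mathsf{Df}$ ($c_i$), $\mathsf{Sc}$ ($c_i,s^i_j$), $\mathsf{CA}$ ($c_i,d_{ij}$), $\mathsf{QA}=\mathsf{PA}$ ($c_i,s^i_j,s_{ij}$), $\mathsf{PEA}$ (all). An algebra of type $\mathcal T$ is representable if it is isomorphic to a subalgebra of a direct product of set algebras of the same type, where in a set algebra with unit ${}^nU$ (or $U_0\times\dots\times U_{n-1}$ for $\mathsf{Df}_n$): $c_iX=\{s:\exists t\in X,\ t_j=s_j\ \forall j\neq i\}$, $d_{ij}=\{s:s_i=s_j\}$, $s^i_jX=\{s:s\circ[i|j]\in X\}$, $s_{ij}X=\{s:s\circ[i,j]\in X\}$, with $[i|j]$ the map sending $i$ to $j$ and fixing the rest, $[i,j]$ the transposition. An atom structure of type $\mathcal T$ is a relational structure $\mathcal S$ with a binary relation for each of the unary operators $c_i$, $s^i_j$, $s_{ij}$ in $\mathcal T$ and a unary relation for each $d_{ij}$ in $\mathcal T$; the atom structure $\mathrm{At}\mathfrak A$ of an atomic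 algebra $\mathfrak A$ has the atoms as universe, with $R_\Omega(a,b)\iff\Omega(b)\ge a$ and $R_{d_{ij}}(a)\iff a\le d_{ij}$. $\mathcal S$ is strongly representable if every atomic $n$-dimensional algebra $\mathfrak A$ of type $\mathcal T$ with $\mathrm{At}\mathfrak A=\mathcal S$ is representable; equivalently, the complex algebra $\mathfrak{Cm}\mathcal S$ is representable. *)

theory Defs
  imports Main "HOL-Library.FuncSet" "HOL-Combinatorics.Transposition"
begin

section \<open>Signatures between Df and PEA\<close>

datatype uop = Cyl nat | Repl nat nat | Transp nat nat

record signature =
  has_diag :: bool
  has_repl :: bool
  has_transp :: bool

definition uops :: "signature \<Rightarrow> nat \<Rightarrow> uop set" where
  "uops T n = {Cyl i | i. i < n}
     \<union> (if has_repl T then {Repl i j | i j. i < n \<and> j < n} else {})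
     \<union> (if has_transp T then {Transp i j | i j. i < n \<and> j < n} else {})"

definition diags :: "signature \<Rightarrow> nat \<Rightarrow> (nat \<times> nat) set" where
  "diags T n = (if has_diag T then {..<n} \<times> {..<n} else {})"

section \<open>Algebras\<close>

text \<open>One record type serves all signatures: an algebra of type \<open>T\<close> is an \<open>alg\<close> in which only
  the operators in \<open>uops T n\<close> and the constants in \<open>diags T n\<close> are ever looked at.\<close>

record 'b alg =
  Carr :: "'b set"
  Join :: "'b \<Rightarrow> 'b \<Rightarrow> 'b"
  Meet :: "'b \<Rightarrow> 'b \<Rightarrow> 'b"
  Compl :: "'b \<Rightarrow> 'b"
  Zero :: 'b
  One :: 'b
  Oper :: "uop \<Rightarrow> 'b \<Rightarrow> 'b"
  Diag :: "nat \<Rightarrow> nat \<Rightarrow> 'b"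

definition boolean :: "'b alg \<Rightarrow> bool" where
  "boolean A \<longleftrightarrow>
     Zero A \<in> Carr A \<and> One A \<in> Carr A
   \<and> (\<forall>a\<in>Carr A. Compl A a \<in> Carr A \<and> Join A a (Zero A) = a \<and> Meet A a (One A) = a
        \<and> Join A a (Compl A a) = One A \<and> Meet A a (Compl A a) = Zero A)
   \<and> (\<forall>a\<in>Carr A. \<forall>b\<in>Carr A. Join A a b \<in> Carr A \<and> Meet A a b \<in> Carr A
        \<and> Join A a b = Join A b a \<and> Meet A a b = Meet A b a)
   \<and> (\<forall>a\<in>Carr A. \<forall>b\<in>Carr A. \<forall>c\<in>Carr A.
        Join A (Join A a b) c = Join A a (Join A b c)
      \<and> Meet A (Meet A a b) c = Meet A a (Meet A b c)
      \<and> Meet A a (Join A b c) = Join A (Meet A a b) (Meet A a c)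
      \<and> Join A a (Meet A b c) = Meet A (Join A a b) (Join A a c))"

definition ale :: "'b alg \<Rightarrow> 'b \<Rightarrow> 'b \<Rightarrow> bool" where
  "ale A a b \<longleftrightarrow> Meet A a b = a"

definition is_lub :: "'b alg \<Rightarrow> 'b set \<Rightarrow> 'b \<Rightarrow> bool" where
  "is_lub A X x \<longleftrightarrow> x \<in> Carr A \<and> (\<forall>y\<in>X. ale A y x) \<and> (\<forall>z\<in>Carr A. (\<forall>y\<in>X. ale A y z) \<longrightarrow> ale A x z)"

text \<open>Algebras of type \<open>T\<close> are Boolean algebras with completely additive operators
  (\<open>X = {}\<close> makes them normal, finite \<open>X\<close> additive). Only under complete additivity does an atom
  structure determine the operators of an atomic algebra, so that strong representability
  of \<open>S\<close> is equivalent to representability of its complex algebra; see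
  \<open>strongly_representable_iff_Cm\<close> below.\<close>

definition algebra_of_type :: "signature \<Rightarrow> nat \<Rightarrow> 'b alg \<Rightarrow> bool" where
  "algebra_of_type T n A \<longleftrightarrow> boolean A
   \<and> (\<forall>f\<in>uops T n. (\<forall>a\<in>Carr A. Oper A f a \<in> Carr A)
        \<and> (\<forall>X\<subseteq>Carr A. \<forall>x. is_lub A X x \<longrightarrow> is_lub A (Oper A f ` X) (Oper A f x)))
   \<and> (\<forall>(i,j)\<in>diags T n. Diag A i j \<in> Carr A)"

definition atoms :: "'b alg \<Rightarrow> 'b set" where
  "atoms A = {a \<in> Carr A. a \<noteq> Zero A \<and> (\<forall>b\<in>Carr A. ale A b a \<longrightarrow> b = Zero A \<or> b = a)}"

definition atomic :: "'b alg \<Rightarrow> bool" where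
  "atomic A \<longleftrightarrow> (\<forall>b\<in>Carr A. b \<noteq> Zero A \<longrightarrow> (\<exists>a\<in>atoms A. ale A a b))"

definition alg_hom :: "signature \<Rightarrow> nat \<Rightarrow> 'b alg \<Rightarrow> 'c alg \<Rightarrow> ('b \<Rightarrow> 'c) \<Rightarrow> bool" where
  "alg_hom T n A B h \<longleftrightarrow>
     (\<forall>a\<in>Carr A. h a \<in> Carr B)
   \<and> (\<forall>a\<in>Carr A. \<forall>b\<in>Carr A. h (Join A a b) = Join B (h a) (h b) \<and> h (Meet A a b) = Meet B (h a) (h b))
   \<and> (\<forall>a\<in>Carr A. h (Compl A a) = Compl B (h a))
   \<and> h (Zero A) = Zero B \<and> h (One A) = One B
   \<and> (\<forall>f\<in>uops T n. \<forall>a\<in>Carr A. h (Oper A f a) = Oper B f (h a))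
   \<and> (\<forall>(i,j)\<in>diags T n. h (Diag A i j) = Diag B i j)"

definition alg_embedding :: "signature \<Rightarrow> nat \<Rightarrow> 'b alg \<Rightarrow> 'c alg \<Rightarrow> ('b \<Rightarrow> 'c) \<Rightarrow> bool" where
  "alg_embedding T n A B h \<longleftrightarrow> alg_hom T n A B h \<and> inj_on h (Carr A)"

definition prod_alg :: "'i set \<Rightarrow> ('i \<Rightarrow> 'b alg) \<Rightarrow> ('i \<Rightarrow> 'b) alg" where
  "prod_alg I B = \<lparr>
     Carr = (\<Pi>\<^sub>E k\<in>I. Carr (B k)),
     Join = (\<lambda>x y. \<lambda>k\<in>I. Join (B k) (x k) (y k)),
     Meet = (\<lambda>x y. \<lambda>k\<in>I. Meet (B k) (x k) (y k)),
     Compl = (\<lambda>x. \<lambda>k\<in>I. Compl (B k) (x k)),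
     Zero = (\<lambda>k\<in>I. Zero (B k)),
     One = (\<lambda>k\<in>I. One (B k)),
     Oper = (\<lambda>f x. \<lambda>k\<in>I. Oper (B k) f (x k)),
     Diag = (\<lambda>i j. \<lambda>k\<in>I. Diag (B k) i j)\<rparr>"

section \<open>Set algebras and representability\<close>

definition tuples :: "nat \<Rightarrow> (nat \<Rightarrow> 'u set) \<Rightarrow> (nat \<Rightarrow> 'u) set" where
  "tuples n U = (\<Pi>\<^sub>E i\<in>{..<n}. U i)"

fun set_op :: "nat \<Rightarrow> (nat \<Rightarrow> 'u) set \<Rightarrow> uop \<Rightarrow> (nat \<Rightarrow> 'u) set \<Rightarrow> (nat \<Rightarrow> 'u) set" where
  "set_op n V (Cyl i) X = {s \<in> V. \<exists>t\<in>X. \<forall>j<n. j \<noteq> i \<longrightarrow> t j = s j}"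
| "set_op n V (Repl i j) X = {s \<in> V. s \<circ> id(i := j) \<in> X}"
| "set_op n V (Transp i j) X = {s \<in> V. s \<circ> transpose i j \<in> X}"

definition set_alg :: "nat \<Rightarrow> (nat \<Rightarrow> 'u set) \<Rightarrow> (nat \<Rightarrow> 'u) set alg" where
  "set_alg n U = \<lparr>
     Carr = Pow (tuples n U), Join = (\<union>), Meet = (\<inter>), Compl = (\<lambda>X. tuples n U - X),
     Zero = {}, One = tuples n U, Oper = set_op n (tuples n U),
     Diag = (\<lambda>i j. {s \<in> tuples n U. s i = s j})\<rparr>"

text \<open>Only the type \<open>Df\<close> admits units \<open>U\<^sub>0 \<times> \<dots> \<times> U\<^sub>n\<^sub>-\<^sub>1\<close> that are not of the form \<open>\<^sup>nU\<close>.\<close>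

definition admissible_bases :: "signature \<Rightarrow> nat \<Rightarrow> (nat \<Rightarrow> 'u set) \<Rightarrow> bool" where
  "admissible_bases T n U \<longleftrightarrow>
     (has_diag T \<or> has_repl T \<or> has_transp T \<longrightarrow> (\<forall>i<n. \<forall>j<n. U i = U j))"

text \<open>The types of the index set and of the bases are fixed only because HOL cannot quantify
  over types. Nothing is lost: \<open>representableI\<close> below shows that an embedding into a product of
  set algebras with an arbitrary index type and an arbitrary base type suffices.\<close>

definition representable :: "signature \<Rightarrow> nat \<Rightarrow> 'b alg \<Rightarrow> bool" where
  "representable T n A \<longleftrightarrow>
     (\<exists>(I :: ('b \<times> 'b) set) (U :: 'b \<times> 'b \<Rightarrow> nat \<Rightarrow> (nat + 'b) list set) h.
        (\<forall>k\<in>I. admissible_bases T n (U k))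
      \<and> alg_embedding T n A (prod_alg I (\<lambda>k. set_alg n (U k))) h)"

section \<open>Atom structures\<close>

record 'a atstr =
  Uni :: "'a set"
  Rel :: "uop \<Rightarrow> 'a \<Rightarrow> 'a \<Rightarrow> bool"
  DRel :: "nat \<Rightarrow> nat \<Rightarrow> 'a \<Rightarrow> bool"

definition At :: "'b alg \<Rightarrow> 'b atstr" where
  "At A = \<lparr>Uni = atoms A, Rel = (\<lambda>f a b. ale A a (Oper A f b)), DRel = (\<lambda>i j a. ale A a (Diag A i j))\<rparr>"

definition Cm :: "'a atstr \<Rightarrow> 'a set alg" where
  "Cm S = \<lparr>
     Carr = Pow (Uni S), Join = (\<union>), Meet = (\<inter>), Compl = (\<lambda>X. Uni S - X),
     Zero = {}, One = Uni S,
     Oper = (\<lambda>f X. {a \<in> Uni S. \<exists>b\<in>X. Rel S f a b}),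
     Diag = (\<lambda>i j. {a \<in> Uni S. DRel S i j a})\<rparr>"

definition atstr_iso :: "signature \<Rightarrow> nat \<Rightarrow> 'a atstr \<Rightarrow> 'b atstr \<Rightarrow> ('a \<Rightarrow> 'b) \<Rightarrow> bool" where
  "atstr_iso T n S S' g \<longleftrightarrow> bij_betw g (Uni S) (Uni S')
   \<and> (\<forall>f\<in>uops T n. \<forall>a\<in>Uni S. \<forall>b\<in>Uni S. Rel S f a b \<longleftrightarrow> Rel S' f (g a) (g b))
   \<and> (\<forall>(i,j)\<in>diags T n. \<forall>a\<in>Uni S. DRel S i j a \<longleftrightarrow> DRel S' i j (g a))"

text \<open>Up to isomorphism, every atomic algebra with atom structure \<open>S\<close> has its elements in
  \<open>'a set\<close>: an element is determined by the set of atoms below it.\<close>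

definition strongly_representable :: "signature \<Rightarrow> nat \<Rightarrow> 'a atstr \<Rightarrow> bool" where
  "strongly_representable T n S \<longleftrightarrow>
     (\<forall>A :: 'a set alg. algebra_of_type T n A \<and> atomic A \<and> (\<exists>g. atstr_iso T n S (At A) g)
        \<longrightarrow> representable T n A)"

section \<open>First-order logic over atom structures\<close>

datatype fm =
    Eq nat nat
  | RelF uop nat nat
  | DiagF nat nat nat
  | Neg fm
  | Conj fm fm
  | All nat fm

fun sat :: "'a atstr \<Rightarrow> (nat \<Rightarrow> 'a) \<Rightarrow> fm \<Rightarrow> bool" where
  "sat S v (Eq x y) \<longleftrightarrow> v x = v y"
| "sat S v (RelF f x y) \<longleftrightarrow> Rel S f (v x) (v y)"
| "sat S v (DiagF i j x) \<longleftrightarrow> DRel S i j (v x)"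
| "sat S v (Neg p) \<longleftrightarrow> \<not> sat S v p"
| "sat S v (Conj p q) \<longleftrightarrow> sat S v p \<and> sat S v q"
| "sat S v (All x p) \<longleftrightarrow> (\<forall>a\<in>Uni S. sat S (v(x := a)) p)"

fun fv :: "fm \<Rightarrow> nat set" where
  "fv (Eq x y) = {x, y}"
| "fv (RelF f x y) = {x, y}"
| "fv (DiagF i j x) = {x}"
| "fv (Neg p) = fv p"
| "fv (Conj p q) = fv p \<union> fv q"
| "fv (All x p) = fv p - {x}"

fun in_language :: "signature \<Rightarrow> nat \<Rightarrow> fm \<Rightarrow> bool" where
  "in_language T n (Eq x y) \<longleftrightarrow> True"
| "in_language T n (RelF f x y) \<longleftrightarrow> f \<in> uops T n"
| "in_language T n (DiagF i j x) \<longleftrightarrow> (i, j) \<in> diags T n"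
| "in_language T n (Neg p) \<longleftrightarrow> in_language T n p"
| "in_language T n (Conj p q) \<longleftrightarrow> in_language T n p \<and> in_language T n q"
| "in_language T n (All x p) \<longleftrightarrow> in_language T n p"

definition sentence :: "signature \<Rightarrow> nat \<Rightarrow> fm \<Rightarrow> bool" where
  "sentence T n p \<longleftrightarrow> in_language T n p \<and> fv p = {}"

definition models :: "'a atstr \<Rightarrow> fm set \<Rightarrow> bool" where
  "models S \<Sigma> \<longleftrightarrow> (\<forall>p\<in>\<Sigma>. \<forall>v. sat S v p)"

text \<open>\<open>K\<close> is the class of models of a first-order theory in the language of type \<open>T\<close>, among the
  structures whose (nonempty) universe is a subset of the type \<open>'a\<close>. A theory axiomatising a class
  of structures of all sizes axiomatises its restriction to every \<open>'a\<close>. So a class is not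
  elementary as soon as this fails for one \<open>'a\<close>; how large \<open>'a\<close> has to be depends on the class,
  and the continuum accommodates ultraproducts of sequences of countable structures.\<close>

definition elementary :: "signature \<Rightarrow> nat \<Rightarrow> ('a atstr \<Rightarrow> bool) \<Rightarrow> bool" where
  "elementary T n K \<longleftrightarrow>
     (\<exists>\<Sigma>. (\<forall>p\<in>\<Sigma>. sentence T n p) \<and> (\<forall>S. Uni S \<noteq> {} \<longrightarrow> (K S \<longleftrightarrow> models S \<Sigma>)))"

section \<open>Adequacy of the types in the definition of representability\<close>

datatype 'b wit = Coord nat | Wit 'b nat "'b wit list"

fun wcode :: "'b wit \<Rightarrow> (nat + 'b) list" where
  "wcode (Coord i) = [Inl 0, Inl i]"
| "wcode (Wit b i ts) = Inl 1 # Inl i # Inr b # Inl (length ts) # concat (map wcode ts)"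

lemma concat_wcode_inj:
  "(\<And>t t' r r'. t \<in> set ts \<Longrightarrow> wcode t @ r = wcode t' @ r' \<Longrightarrow> t = t' \<and> r = r') \<Longrightarrow>
   length ts = length ts' \<Longrightarrow> concat (map wcode ts) @ r = concat (map wcode ts') @ r' \<Longrightarrow>
   ts = ts' \<and> r = r'"
proof (induction ts arbitrary: ts')
  case Nil
  then show ?case by simp
next
  case (Cons t ts)
  then obtain u us where ts': "ts' = u # us" by (cases ts') auto
  have "wcode t @ (concat (map wcode ts) @ r) = wcode u @ (concat (map wcode us) @ r')"
    using Cons.prems(3) ts' by simp
  then have 1: "t = u \<and> concat (map wcode ts) @ r = concat (map wcode us) @ r'"
    by (rule Cons.prems(1)[rotated]) simp
  have len: "length ts = length us" using Cons.prems(2) ts' by simp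
  have "ts = us \<and> r = r'"
  proof (rule Cons.IH[OF _ len])
    fix t t' r r' assume "t \<in> set ts" "wcode t @ r = wcode t' @ r'"
    then show "t = t' \<and> r = r'" by (intro Cons.prems(1)) simp
  qed (use 1 in simp)
  then show ?case using 1 ts' by simp
qed

lemma wcode_inj: "wcode t @ r = wcode t' @ r' \<Longrightarrow> t = t' \<and> r = r'"
proof (induction t arbitrary: t' r r')
  case (Coord i)
  then show ?case by (cases t') auto
next
  case (Wit b i ts)
  from Wit.prems obtain ts' where t': "t' = Wit b i ts'" and len: "length ts = length ts'"
    and eq: "concat (map wcode ts) @ r = concat (map wcode ts') @ r'"
    by (cases t') auto
  have "ts = ts' \<and> r = r'"
    by (rule concat_wcode_inj[OF _ len eq]) (rule Wit.IH)
  then show ?case using t' by simp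
qed

lemma inj_wcode: "inj wcode"
  by (rule injI) (metis wcode_inj append_Nil2)

fun wval :: "(nat \<Rightarrow> 'u) \<Rightarrow> ('b \<Rightarrow> nat \<Rightarrow> 'u list \<Rightarrow> 'u) \<Rightarrow> 'b wit \<Rightarrow> 'u" where
  "wval t w (Coord i) = t i"
| "wval t w (Wit b i ts) = w b i (map (wval t w) ts)"

lemma small_closed_set:
  fixes t :: "nat \<Rightarrow> 'u" and w :: "'b \<Rightarrow> nat \<Rightarrow> 'u list \<Rightarrow> 'u"
  obtains C :: "(nat + 'b) list set" and d
  where "inj_on d C" "\<And>i. t i \<in> d ` C" "\<And>b i us. set us \<subseteq> d ` C \<Longrightarrow> w b i us \<in> d ` C"
proof -
  define R where "R = range (wval t w)"
  define g where "g = (\<lambda>u. wcode (SOME x. wval t w x = u))"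
  have g: "inj_on g R"
  proof (rule inj_on_inverseI[where g = "\<lambda>c. wval t w (inv wcode c)"])
    fix u assume "u \<in> R"
    then have "\<exists>x. wval t w x = u" by (auto simp: R_def)
    from someI_ex[OF this] show "wval t w (inv wcode (g u)) = u"
      unfolding g_def inv_f_f[OF inj_wcode] .
  qed
  define d where "d = inv_into R g"
  have im: "d ` (g ` R) = R"
    unfolding d_def by (rule inv_into_image_cancel[OF g order_refl])
  have inj: "inj_on d (g ` R)"
    unfolding d_def by (rule inj_on_inv_into) simp
  show ?thesis
  proof
    show "inj_on d (g ` R)" by (rule inj)
    show "t i \<in> d ` (g ` R)" for i
      unfolding im unfolding R_def by (rule range_eqI[of _ _ "Coord i"]) simp
    show "w b i us \<in> d ` (g ` R)" if "set us \<subseteq> d ` (g ` R)" for b i us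
    proof -
      have "us \<in> lists (wval t w ` UNIV)" using that unfolding im unfolding R_def by (auto simp: lists_eq_set)
      then obtain ts where "us = map (wval t w) ts"
        unfolding lists_image by (rule imageE)
      then show ?thesis unfolding im unfolding R_def by (intro range_eqI[of _ _ "Wit b i ts"]) simp
    qed
  qed
qed

lemma small_rep:
  fixes A :: "'b alg" and H :: "'b \<Rightarrow> (nat \<Rightarrow> 'u) set"
  assumes H: "alg_hom T n A (set_alg n U) H" and adm: "admissible_bases T n U"
    and closed: "\<And>f a. f \<in> uops T n \<Longrightarrow> a \<in> Carr A \<Longrightarrow> Oper A f a \<in> Carr A"
    and ab: "a \<in> Carr A" "b \<in> Carr A" "H a \<noteq> H b"
  shows "\<exists>(V :: nat \<Rightarrow> (nat + 'b) list set) H'. admissible_bases T n V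
           \<and> alg_hom T n A (set_alg n V) H' \<and> H' a \<noteq> H' b"
proof -
  have sub: "H x \<subseteq> tuples n U" if "x \<in> Carr A" for x
    using H that by (auto simp: alg_hom_def set_alg_def)
  obtain t where t: "t \<in> H a \<longleftrightarrow> t \<notin> H b" using ab(3) by blast
  then have tU: "t \<in> tuples n U" using sub ab(1,2) by blast
  define w where "w = (\<lambda>(x::'b) i us. SOME u. (\<lambda>j\<in>{..<n}. (us ! j))(i := u) \<in> H x)"
  obtain C :: "(nat + 'b) list set" and d where d: "inj_on d C" "\<And>i. t i \<in> d ` C"
    and dw: "\<And>x i us. set us \<subseteq> d ` C \<Longrightarrow> w x i us \<in> d ` C"
    by (rule small_closed_set[of t w]) blast
  define V where "V = (\<lambda>i. {x \<in> C. d x \<in> U i})"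
  define e where "e = (\<lambda>s. \<lambda>j\<in>{..<n}. d (s j))"
  define H' where "H' = (\<lambda>x. {s \<in> tuples n V. e s \<in> H x})"
  have eU: "e s \<in> tuples n U" if "s \<in> tuples n V" for s
    using that by (auto simp: e_def tuples_def V_def PiE_def Pi_def)
  have "admissible_bases T n V"
    using adm unfolding admissible_bases_def V_def by blast
  moreover have "alg_hom T n A (set_alg n V) H'"
  proof -
    have cyl: "H' (Oper A (Cyl i) x) = set_op n (tuples n V) (Cyl i) (H' x)"
      if f: "Cyl i \<in> uops T n" and x: "x \<in> Carr A" for i x
    proof -
      have i: "i < n" using f by (auto simp: uops_def split: if_splits)
      have Hc: "H (Oper A (Cyl i) x) = set_op n (tuples n U) (Cyl i) (H x)"
        using H f x by (auto simp: alg_hom_def set_alg_def)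
      show ?thesis
      proof (intro subset_antisym subsetI)
        fix s assume s: "s \<in> H' (Oper A (Cyl i) x)"
        then have sV: "s \<in> tuples n V" and "e s \<in> set_op n (tuples n U) (Cyl i) (H x)"
          by (auto simp: H'_def Hc)
        then obtain r where r: "r \<in> H x" "\<forall>j<n. j \<noteq> i \<longrightarrow> r j = e s j" by auto
        have "r \<in> tuples n U" using r(1) sub[OF x] by auto
        define us where "us = map (e s) [0..<n]"
        have "(\<lambda>j\<in>{..<n}. (us ! j))(i := r i) = r"
          using r(2) \<open>r \<in> tuples n U\<close> i by (auto simp: us_def fun_eq_iff tuples_def PiE_def extensional_def)
        then have w: "(\<lambda>j\<in>{..<n}. (us ! j))(i := w x i us) \<in> H x"
          using someI[of "\<lambda>u. (\<lambda>j\<in>{..<n}. (us ! j))(i := u) \<in> H x" "r i"] r(1)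
          by (simp add: w_def del: fun_upd_apply)
        have "set us \<subseteq> d ` C" using sV by (auto simp: us_def e_def tuples_def V_def PiE_def Pi_def)
        then obtain c where c: "c \<in> C" "d c = w x i us" using dw by (metis imageE)
        have "(\<lambda>j\<in>{..<n}. (us ! j))(i := w x i us) \<in> tuples n U" using w sub[OF x] by auto
        then have "w x i us \<in> U i"
          using i unfolding tuples_def by (metis PiE_mem fun_upd_same lessThan_iff)
        then have "s(i := c) \<in> tuples n V"
          using sV c i by (auto simp: tuples_def V_def PiE_def Pi_def extensional_def)
        moreover have "e (s(i := c)) = (\<lambda>j\<in>{..<n}. (us ! j))(i := w x i us)"
          using c i by (auto simp: e_def us_def fun_eq_iff)
        ultimately have "s(i := c) \<in> H' x" using w by (simp add: H'_def)
        then have "\<exists>r\<in>H' x. \<forall>j<n. j \<noteq> i \<longrightarrow> r j = s j"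
          by (rule bexI[rotated]) simp
        then show "s \<in> set_op n (tuples n V) (Cyl i) (H' x)" using sV by simp
      next
        fix s assume "s \<in> set_op n (tuples n V) (Cyl i) (H' x)"
        then obtain r where r: "s \<in> tuples n V" "r \<in> H' x" "\<forall>j<n. j \<noteq> i \<longrightarrow> r j = s j" by auto
        then have "e r \<in> H x" "\<forall>j<n. j \<noteq> i \<longrightarrow> e r j = e s j" by (auto simp: H'_def e_def)
        then show "s \<in> H' (Oper A (Cyl i) x)" using r(1) eU by (auto simp: H'_def Hc)
      qed
    qed
    have subst: "s \<circ> p \<in> tuples n V" "e (s \<circ> p) = e s \<circ> p"
      if "s \<in> tuples n V" and "\<forall>i<n. \<forall>j<n. V i = V j" and "\<forall>i<n. p i < n" "\<forall>i\<ge>n. p i = i" for s p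
    proof -
      show "s \<circ> p \<in> tuples n V"
        unfolding tuples_def
      proof (rule PiE_I)
        fix j assume j: "j \<in> {..<n}"
        then have "s (p j) \<in> V (p j)" using that(1,3) unfolding tuples_def by auto
        moreover have "V (p j) = V j" using that j by blast
        ultimately show "(s \<circ> p) j \<in> V j" by simp
      next
        fix j assume "j \<notin> {..<n}"
        then show "(s \<circ> p) j = undefined" using that(1,4) unfolding tuples_def by auto
      qed
      show "e (s \<circ> p) = e s \<circ> p"
      proof
        fix j show "e (s \<circ> p) j = (e s \<circ> p) j"
          using that(3,4) by (cases "j < n") (auto simp: e_def)
      qed
    qed
    have repl: "H' (Oper A (Repl i j) x) = set_op n (tuples n V) (Repl i j) (H' x)"
      if f: "Repl i j \<in> uops T n" and x: "x \<in> Carr A" for i j x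
    proof -
      have ij: "i < n" "j < n" and T: "has_repl T" using f by (auto simp: uops_def split: if_splits)
      have Hc: "H (Oper A (Repl i j) x) = set_op n (tuples n U) (Repl i j) (H x)"
        using H f x by (auto simp: alg_hom_def set_alg_def)
      have V: "\<forall>i<n. \<forall>j<n. V i = V j"
        using T adm unfolding admissible_bases_def V_def by blast
      have "s \<circ> id(i := j) \<in> tuples n V \<and> e (s \<circ> id(i := j)) = e s \<circ> id(i := j)" if "s \<in> tuples n V" for s
        using subst[OF that V, of "id(i := j)"] ij by simp
      then show ?thesis using eU by (auto simp: H'_def Hc simp del: fun_upd_apply)
    qed
    have transp: "H' (Oper A (Transp i j) x) = set_op n (tuples n V) (Transp i j) (H' x)"
      if f: "Transp i j \<in> uops T n" and x: "x \<in> Carr A" for i j x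
    proof -
      have ij: "i < n" "j < n" and T: "has_transp T" using f by (auto simp: uops_def split: if_splits)
      have Hc: "H (Oper A (Transp i j) x) = set_op n (tuples n U) (Transp i j) (H x)"
        using H f x by (auto simp: alg_hom_def set_alg_def)
      have V: "\<forall>i<n. \<forall>j<n. V i = V j"
        using T adm unfolding admissible_bases_def V_def by blast
      have "s \<circ> transpose i j \<in> tuples n V \<and> e (s \<circ> transpose i j) = e s \<circ> transpose i j" if "s \<in> tuples n V" for s
        using subst[OF that V, of "transpose i j"] ij by (simp add: transpose_def)
      then show ?thesis using eU by (auto simp: H'_def Hc)
    qed
    have diag: "H' (Diag A i j) = {s \<in> tuples n V. s i = s j}" if ij: "(i, j) \<in> diags T n" for i j
    proof -
      have ijn: "i < n" "j < n" using ij by (auto simp: diags_def split: if_splits)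
      have Hd: "H (Diag A i j) = {s \<in> tuples n U. s i = s j}"
        using H ij by (auto simp: alg_hom_def set_alg_def)
      have "e s i = e s j \<longleftrightarrow> s i = s j" if s: "s \<in> tuples n V" for s
      proof -
        have "s i \<in> C" "s j \<in> C" using s ijn by (auto simp: tuples_def V_def PiE_def Pi_def)
        then show ?thesis using d(1) ijn by (auto simp: e_def inj_on_def)
      qed
      then show ?thesis using eU by (auto simp: H'_def Hd)
    qed
    have ops: "H' (Oper A f x) = set_op n (tuples n V) f (H' x)"
      if "f \<in> uops T n" "x \<in> Carr A" for f x
      using that cyl repl transp by (cases f) blast+
    have "H (Zero A) = {}" "H (One A) = tuples n U"
      "\<And>x y. x \<in> Carr A \<Longrightarrow> y \<in> Carr A \<Longrightarrow> H (Join A x y) = H x \<union> H y \<and> H (Meet A x y) = H x \<inter> H y"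
      "\<And>x. x \<in> Carr A \<Longrightarrow> H (Compl A x) = tuples n U - H x"
      using H by (auto simp: alg_hom_def set_alg_def)
    then have "H' (Zero A) = {}" "H' (One A) = tuples n V"
      "\<And>x y. x \<in> Carr A \<Longrightarrow> y \<in> Carr A \<Longrightarrow> H' (Join A x y) = H' x \<union> H' y \<and> H' (Meet A x y) = H' x \<inter> H' y"
      "\<And>x. x \<in> Carr A \<Longrightarrow> H' (Compl A x) = tuples n V - H' x"
      "\<And>x. H' x \<subseteq> tuples n V"
      using eU by (auto simp: H'_def)
    then show ?thesis
      unfolding alg_hom_def using ops diag
      by (simp add: set_alg_def split_beta)
  qed
  moreover have "H' a \<noteq> H' b"
  proof -
    define s where "s = (\<lambda>j\<in>{..<n}. SOME c. c \<in> C \<and> d c = t j)"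
    have sC: "s j \<in> C \<and> d (s j) = t j" if "j < n" for j
    proof -
      have "\<exists>c. c \<in> C \<and> d c = t j" using d(2)[of j] by (metis imageE)
      from someI_ex[OF this] show ?thesis using that unfolding s_def by simp
    qed
    have "s \<in> tuples n V" using sC tU by (auto simp: tuples_def V_def s_def PiE_def Pi_def)
    moreover have "e s = t"
      using sC tU by (auto simp: e_def fun_eq_iff tuples_def PiE_def extensional_def)
    ultimately show ?thesis using t by (auto simp: H'_def)
  qed
  ultimately show ?thesis by blast
qed

lemma alg_hom_prod_iff:
  assumes "\<forall>a\<in>Carr A. h a \<in> extensional I" "h (Zero A) \<in> extensional I" "h (One A) \<in> extensional I"
    "\<forall>a\<in>Carr A. Compl A a \<in> Carr A" "\<forall>a\<in>Carr A. \<forall>b\<in>Carr A. Join A a b \<in> Carr A \<and> Meet A a b \<in> Carr A"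
    "\<forall>f\<in>uops T n. \<forall>a\<in>Carr A. Oper A f a \<in> Carr A" "\<forall>(i,j)\<in>diags T n. Diag A i j \<in> Carr A"
  shows "alg_hom T n A (prod_alg I B) h \<longleftrightarrow> (\<forall>k\<in>I. alg_hom T n A (B k) (\<lambda>a. h a k))"
proof -
  have ext: "x = (\<lambda>k\<in>I. y k) \<longleftrightarrow> (\<forall>k\<in>I. x k = y k)" if "x \<in> extensional I"
    for x and y
    using that by (fastforce simp: fun_eq_iff extensional_def)
  note e = ext[OF assms(1)[rule_format]]
  have 1: "(\<forall>a\<in>Carr A. h a \<in> (\<Pi>\<^sub>E k\<in>I. Carr (B k))) \<longleftrightarrow> (\<forall>k\<in>I. \<forall>a\<in>Carr A. h a k \<in> Carr (B k))"
    using assms(1) by (auto simp: PiE_iff)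
  have 2: "(\<forall>a\<in>Carr A. \<forall>b\<in>Carr A.
       h (Join A a b) = (\<lambda>k\<in>I. Join (B k) (h a k) (h b k)) \<and> h (Meet A a b) = (\<lambda>k\<in>I. Meet (B k) (h a k) (h b k)))
     \<longleftrightarrow> (\<forall>k\<in>I. \<forall>a\<in>Carr A. \<forall>b\<in>Carr A.
       h (Join A a b) k = Join (B k) (h a k) (h b k) \<and> h (Meet A a b) k = Meet (B k) (h a k) (h b k))"
    using e assms(5) by simp blast
  have 3: "(\<forall>a\<in>Carr A. h (Compl A a) = (\<lambda>k\<in>I. Compl (B k) (h a k)))
     \<longleftrightarrow> (\<forall>k\<in>I. \<forall>a\<in>Carr A. h (Compl A a) k = Compl (B k) (h a k))"
    using e assms(4) by simp blast
  have 4: "(\<forall>f\<in>uops T n. \<forall>a\<in>Carr A. h (Oper A f a) = (\<lambda>k\<in>I. Oper (B k) f (h a k)))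
     \<longleftrightarrow> (\<forall>k\<in>I. \<forall>f\<in>uops T n. \<forall>a\<in>Carr A. h (Oper A f a) k = Oper (B k) f (h a k))"
    using e assms(6) by simp blast
  have 5: "(\<forall>(i,j)\<in>diags T n. h (Diag A i j) = (\<lambda>k\<in>I. Diag (B k) i j))
     \<longleftrightarrow> (\<forall>k\<in>I. \<forall>(i,j)\<in>diags T n. h (Diag A i j) k = Diag (B k) i j)"
    using e assms(7) by (auto simp: split_beta)
  show ?thesis
    unfolding alg_hom_def prod_alg_def alg.simps 1 2 3 4 5 ext[OF assms(2)] ext[OF assms(3)] by blast
qed

text \<open>The types chosen in the definition of representability are large enough
  (downward Loewenheim--Skolem).\<close>

theorem representableI:
  fixes A :: "'b alg" and U :: "'i \<Rightarrow> nat \<Rightarrow> 'u set"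
  assumes A: "algebra_of_type T n A"
    and adm: "\<And>k. k \<in> I \<Longrightarrow> admissible_bases T n (U k)"
    and emb: "alg_embedding T n A (prod_alg I (\<lambda>k. set_alg n (U k))) h"
  shows "representable T n A"
proof -
  have cl: "\<forall>a\<in>Carr A. Compl A a \<in> Carr A" "\<forall>a\<in>Carr A. \<forall>b\<in>Carr A. Join A a b \<in> Carr A \<and> Meet A a b \<in> Carr A"
    "\<forall>f\<in>uops T n. \<forall>a\<in>Carr A. Oper A f a \<in> Carr A" "\<forall>(i,j)\<in>diags T n. Diag A i j \<in> Carr A"
    and zo: "Zero A \<in> Carr A" "One A \<in> Carr A"
    using A by (auto simp: algebra_of_type_def boolean_def)
  have h: "alg_hom T n A (prod_alg I (\<lambda>k. set_alg n (U k))) h" "inj_on h (Carr A)"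
    using emb by (auto simp: alg_embedding_def)
  have hext: "\<forall>a\<in>Carr A. h a \<in> extensional I"
    using h(1) by (auto simp: alg_hom_def prod_alg_def PiE_def)
  have hk: "alg_hom T n A (set_alg n (U k)) (\<lambda>a. h a k)" if "k \<in> I" for k
    using h(1) that alg_hom_prod_iff[of A h I T n "\<lambda>k. set_alg n (U k)", OF hext _ _ cl] hext zo by simp
  define J where "J = {(a, b). a \<in> Carr A \<and> b \<in> Carr A \<and> a \<noteq> b}"
  have "\<exists>(V :: nat \<Rightarrow> (nat + 'b) list set) H'. admissible_bases T n V
           \<and> alg_hom T n A (set_alg n V) H' \<and> H' (fst p) \<noteq> H' (snd p)" if p: "p \<in> J" for p
  proof -
    obtain a b where ab: "p = (a, b)" "a \<in> Carr A" "b \<in> Carr A" "a \<noteq> b"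
      using p by (auto simp: J_def)
    then have "h a \<noteq> h b" using h(2) by (auto simp: inj_on_def)
    then obtain k where k: "k \<in> I" "h a k \<noteq> h b k"
      using hext ab(2,3) by (metis extensionalityI)
    show ?thesis
      using small_rep[OF hk[OF k(1)] adm[OF k(1)] _ ab(2,3) k(2)] cl(3) ab(1) by auto
  qed
  then obtain V :: "'b \<times> 'b \<Rightarrow> nat \<Rightarrow> (nat + 'b) list set" and H' where
    V: "\<And>p. p \<in> J \<Longrightarrow> admissible_bases T n (V p) \<and> alg_hom T n A (set_alg n (V p)) (H' p)
         \<and> H' p (fst p) \<noteq> H' p (snd p)"
    by metis
  define g where "g = (\<lambda>a. \<lambda>p\<in>J. H' p a)"
  have gp: "alg_hom T n A (set_alg n (V p)) (\<lambda>a. g a p)" if "p \<in> J" for p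
    using V[OF that] that by (simp add: g_def)
  have "alg_hom T n A (prod_alg J (\<lambda>p. set_alg n (V p))) g"
    using gp by (subst alg_hom_prod_iff[OF _ _ _ cl]) (auto simp: g_def)
  moreover have "inj_on g (Carr A)"
  proof (rule inj_onI, rule ccontr)
    fix a b assume *: "a \<in> Carr A" "b \<in> Carr A" "g a = g b" "a \<noteq> b"
    then have p: "(a, b) \<in> J" by (simp add: J_def)
    from *(3) have "g a (a, b) = g b (a, b)" by simp
    then show False using V[OF p] p by (simp add: g_def)
  qed
  ultimately show ?thesis
    unfolding representable_def alg_embedding_def using V by blast
qed

section \<open>Strong representability and complex algebras\<close>

context
  fixes A :: "'b alg"
  assumes B: "boolean A"
begin

lemma bcl: "Zero A \<in> Carr A" "One A \<in> Carr A" "a \<in> Carr A \<Longrightarrow> Compl A a \<in> Carr A"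
    "a \<in> Carr A \<Longrightarrow> b \<in> Carr A \<Longrightarrow> Join A a b \<in> Carr A"
    "a \<in> Carr A \<Longrightarrow> b \<in> Carr A \<Longrightarrow> Meet A a b \<in> Carr A"
  using B by (auto simp: boolean_def)

lemma bunit: "a \<in> Carr A \<Longrightarrow> Join A a (Zero A) = a" "a \<in> Carr A \<Longrightarrow> Meet A a (One A) = a"
    "a \<in> Carr A \<Longrightarrow> Join A a (Compl A a) = One A" "a \<in> Carr A \<Longrightarrow> Meet A a (Compl A a) = Zero A"
  using B by (auto simp: boolean_def)

lemma bcomm: "a \<in> Carr A \<Longrightarrow> b \<in> Carr A \<Longrightarrow> Join A a b = Join A b a"
    "a \<in> Carr A \<Longrightarrow> b \<in> Carr A \<Longrightarrow> Meet A a b = Meet A b a"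
  using B unfolding boolean_def by blast+

lemma bassoc: "a \<in> Carr A \<Longrightarrow> b \<in> Carr A \<Longrightarrow> c \<in> Carr A \<Longrightarrow> Meet A (Meet A a b) c = Meet A a (Meet A b c)"
  using B unfolding boolean_def by blast

lemma bdistrib: "a \<in> Carr A \<Longrightarrow> b \<in> Carr A \<Longrightarrow> c \<in> Carr A \<Longrightarrow> Meet A a (Join A b c) = Join A (Meet A a b) (Meet A a c)"
    "a \<in> Carr A \<Longrightarrow> b \<in> Carr A \<Longrightarrow> c \<in> Carr A \<Longrightarrow> Join A a (Meet A b c) = Meet A (Join A a b) (Join A a c)"
  using B unfolding boolean_def by blast+

lemma bidem:
  assumes a: "a \<in> Carr A"
  shows "Meet A a a = a"
proof -
  note c = bcl(3)[OF a]
  have "Meet A a (Join A a (Compl A a)) = Join A (Meet A a a) (Meet A a (Compl A a))"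
    by (rule bdistrib(1)[OF a a c])
  then show ?thesis using bunit a bcl by simp
qed

lemma bzero:
  assumes a: "a \<in> Carr A"
  shows "Meet A a (Zero A) = Zero A"
proof -
  note c = bcl(3)[OF a]
  have "Meet A (Meet A a a) (Compl A a) = Meet A a (Meet A a (Compl A a))"
    by (rule bassoc[OF a a c])
  then show ?thesis using bidem[OF a] bunit(4)[OF a] by simp
qed

lemma bone:
  assumes a: "a \<in> Carr A"
  shows "Join A a (One A) = One A"
proof -
  note c = bcl(3)[OF a]
  have "Join A a (Meet A (Compl A a) (One A)) = Meet A (Join A a (Compl A a)) (Join A a (One A))"
    by (rule bdistrib(2)[OF a c bcl(2)])
  then have "One A = Meet A (One A) (Join A a (One A))" using bunit a c by simp
  then show ?thesis using bcomm(2)[OF bcl(2) bcl(4)[OF a bcl(2)]] bunit(2)[OF bcl(4)[OF a bcl(2)]] by simp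
qed

lemma babsorb:
  assumes a: "a \<in> Carr A" and b: "b \<in> Carr A"
  shows "Meet A a (Join A a b) = a"
proof -
  have "Join A a (Meet A (Zero A) b) = Meet A (Join A a (Zero A)) (Join A a b)"
    by (rule bdistrib(2)[OF a bcl(1) b])
  moreover have "Meet A (Zero A) b = Zero A" using bcomm(2)[OF bcl(1) b] bzero[OF b] by simp
  ultimately show ?thesis using bunit(1)[OF a] by simp
qed

lemma ale_trans:
  assumes "a \<in> Carr A" "b \<in> Carr A" "c \<in> Carr A" "ale A a b" "ale A b c"
  shows "ale A a c"
  using bassoc[OF assms(1-3)] assms(4,5) unfolding ale_def by simp

lemma ale_antisym: "a \<in> Carr A \<Longrightarrow> b \<in> Carr A \<Longrightarrow> ale A a b \<Longrightarrow> ale A b a \<Longrightarrow> a = b"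
  unfolding ale_def using bcomm(2)[of a b] by simp

lemma ale_meet:
  assumes a: "a \<in> Carr A" and b: "b \<in> Carr A"
  shows "ale A (Meet A a b) a" "ale A (Meet A a b) b"
proof -
  have 1: "ale A (Meet A a b) b" if "a \<in> Carr A" "b \<in> Carr A" for a b
    unfolding ale_def using bassoc[OF that that(2)] bidem[OF that(2)] by simp
  show "ale A (Meet A a b) a" using 1[OF b a] bcomm(2)[OF a b] by simp
  show "ale A (Meet A a b) b" by (rule 1[OF a b])
qed

lemma ale_meet_iff:
  assumes x: "x \<in> Carr A" and ab: "a \<in> Carr A" "b \<in> Carr A"
  shows "ale A x (Meet A a b) \<longleftrightarrow> ale A x a \<and> ale A x b"
proof
  assume "ale A x (Meet A a b)"
  then show "ale A x a \<and> ale A x b"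
    using ale_trans[OF x bcl(5)[OF ab]] ale_meet[OF ab] ab by blast
next
  assume "ale A x a \<and> ale A x b"
  then show "ale A x (Meet A a b)"
    using bassoc[OF x ab] unfolding ale_def by simp
qed

lemma ale_iff_disjoint: "a \<in> Carr A \<Longrightarrow> b \<in> Carr A \<Longrightarrow> ale A a b \<longleftrightarrow> Meet A a (Compl A b) = Zero A"
proof -
  assume ab: "a \<in> Carr A" "b \<in> Carr A"
  have c: "Compl A b \<in> Carr A" using ab bcl(3) by simp
  have "Meet A a (Join A b (Compl A b)) = Join A (Meet A a b) (Meet A a (Compl A b))"
    by (rule bdistrib(1)[OF ab c])
  then have *: "a = Join A (Meet A a b) (Meet A a (Compl A b))"
    using bunit(3)[OF ab(2)] bunit(2)[OF ab(1)] by simp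
  show ?thesis
  proof
    assume "ale A a b"
    then show "Meet A a (Compl A b) = Zero A"
      unfolding ale_def using bassoc[OF ab c] bunit(4)[OF ab(2)] bzero[OF ab(1)] by simp
  next
    assume "Meet A a (Compl A b) = Zero A"
    then show "ale A a b" unfolding ale_def using * bunit(1)[OF bcl(5)[OF ab]] by simp
  qed
qed

lemma bcompl_compl: "a \<in> Carr A \<Longrightarrow> Compl A (Compl A a) = a"
proof -
  assume a: "a \<in> Carr A"
  let ?n = "Compl A a" let ?c = "Compl A ?n"
  have c: "?n \<in> Carr A" "?c \<in> Carr A" using a bcl(3) by auto
  have "Meet A ?c ?n = Zero A" using bunit(4)[OF c(1)] bcomm(2)[OF c] by simp
  then have 1: "ale A ?c a" using ale_iff_disjoint[OF c(2) a] by simp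
  have "Meet A a (Join A ?n ?c) = Join A (Meet A a ?n) (Meet A a ?c)"
    using bdistrib(1)[OF a c] .
  moreover have "Meet A a (Join A ?n ?c) = a" using bunit(3)[OF c(1)] bunit(2)[OF a] by simp
  moreover have "Join A (Meet A a ?n) (Meet A a ?c) = Meet A a ?c"
    using bunit(4)[OF a] bcomm(1)[OF bcl(1) bcl(5)[OF a c(2)]] bunit(1)[OF bcl(5)[OF a c(2)]] by simp
  ultimately have "ale A a ?c" by (simp add: ale_def)
  then show "?c = a" using 1 ale_antisym a c by blast
qed

lemma atomsD: "x \<in> atoms A \<Longrightarrow> x \<in> Carr A \<and> x \<noteq> Zero A"
  by (simp add: atoms_def)

lemma atom_meet:
  assumes "x \<in> atoms A" "a \<in> Carr A"
  shows "ale A x a \<or> Meet A x a = Zero A"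
proof -
  have x: "x \<in> Carr A" using assms(1) by (simp add: atoms_def)
  have "ale A (Meet A x a) x" by (rule ale_meet(1)[OF x assms(2)])
  then have "Meet A x a = Zero A \<or> Meet A x a = x"
    using assms(1) bcl(5)[OF x assms(2)] unfolding atoms_def by blast
  then show ?thesis unfolding ale_def by blast
qed

lemma atom_compl:
  assumes "x \<in> atoms A" "a \<in> Carr A"
  shows "ale A x (Compl A a) \<longleftrightarrow> \<not> ale A x a"
proof -
  have x: "x \<in> Carr A" "x \<noteq> Zero A" using assms(1) by (auto simp: atoms_def)
  have "ale A x a \<longleftrightarrow> Meet A x (Compl A a) = Zero A"
    by (rule ale_iff_disjoint[OF x(1) assms(2)])
  moreover have "ale A x (Compl A a) \<or> Meet A x (Compl A a) = Zero A"
    by (rule atom_meet[OF assms(1) bcl(3)[OF assms(2)]])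
  ultimately show ?thesis using x(2) unfolding ale_def by metis
qed

lemma atom_join:
  assumes *: "x \<in> atoms A" "a \<in> Carr A" "b \<in> Carr A"
  shows "ale A x (Join A a b) \<longleftrightarrow> ale A x a \<or> ale A x b"
proof -
  have x: "x \<in> Carr A" "x \<noteq> Zero A" using *(1) atomsD by auto
  have j: "Join A a b \<in> Carr A" using * bcl(4) by simp
  have 1: "ale A a (Join A a b)" "ale A b (Join A a b)"
    using babsorb[OF *(2,3)] babsorb[OF *(3,2)] bcomm(1)[OF *(2,3)] by (simp_all add: ale_def)
  show ?thesis
  proof
    assume "ale A x (Join A a b)"
    then have eq: "x = Join A (Meet A x a) (Meet A x b)"
      using bdistrib(1)[OF x(1) *(2,3)] by (simp add: ale_def)
    show "ale A x a \<or> ale A x b"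
    proof (rule ccontr)
      assume "\<not> ?thesis"
      then have "Meet A x a = Zero A" "Meet A x b = Zero A" using atom_meet * by blast+
      then show False using eq bunit(1)[OF bcl(1)] x(2) by simp
    qed
  next
    assume "ale A x a \<or> ale A x b"
    then show "ale A x (Join A a b)" using 1 ale_trans[OF x(1) _ j] * by blast
  qed
qed

lemma ale_by_atoms:
  assumes "atomic A" "a \<in> Carr A" "b \<in> Carr A" "\<And>x. x \<in> atoms A \<Longrightarrow> ale A x a \<Longrightarrow> ale A x b"
  shows "ale A a b"
proof (rule ccontr)
  assume "\<not> ale A a b"
  then have "Meet A a (Compl A b) \<noteq> Zero A" using assms ale_iff_disjoint by blast
  then obtain x where "x \<in> atoms A" "ale A x (Meet A a (Compl A b))"
    using assms bcl unfolding atomic_def by meson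
  then show False using assms atom_compl ale_meet_iff atomsD bcl(3) by meson
qed

lemma lub_atoms:
  assumes "atomic A" "a \<in> Carr A"
  shows "is_lub A {x \<in> atoms A. ale A x a} a"
  unfolding is_lub_def using assms ale_by_atoms by blast

end

lemma Cm_boolean: "boolean (Cm S)"
  unfolding boolean_def Cm_def by auto

lemma Cm_lub: "X \<subseteq> Carr (Cm S) \<Longrightarrow> is_lub (Cm S) X x \<longleftrightarrow> x = \<Union>X"
proof -
  assume X: "X \<subseteq> Carr (Cm S)"
  have *: "is_lub (Cm S) X (\<Union>X)" using X unfolding is_lub_def ale_def Cm_def by auto
  show ?thesis
  proof
    assume x: "is_lub (Cm S) X x"
    then have "ale (Cm S) x (\<Union>X)" "ale (Cm S) (\<Union>X) x" using * unfolding is_lub_def by blast+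
    then show "x = \<Union>X" unfolding ale_def Cm_def by auto
  qed (use * in simp)
qed

lemma Cm_algebra: "algebra_of_type T n (Cm S)"
proof -
  have "is_lub (Cm S) (Oper (Cm S) f ` X) (Oper (Cm S) f x)"
    if X: "X \<subseteq> Carr (Cm S)" and x: "is_lub (Cm S) X x" for f X x
  proof -
    have "Oper (Cm S) f ` X \<subseteq> Carr (Cm S)" by (auto simp: Cm_def)
    moreover have "Oper (Cm S) f x = \<Union>(Oper (Cm S) f ` X)"
      using x unfolding Cm_lub[OF X] by (auto simp: Cm_def)
    ultimately show ?thesis by (simp add: Cm_lub)
  qed
  moreover have "Oper (Cm S) f a \<in> Carr (Cm S)" "Diag (Cm S) i j \<in> Carr (Cm S)" for f a i j
    by (auto simp: Cm_def)
  ultimately show ?thesis unfolding algebra_of_type_def using Cm_boolean by blast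
qed

lemma Cm_simps: "Carr (Cm S) = Pow (Uni S)" "Zero (Cm S) = {}" "ale (Cm S) X Y \<longleftrightarrow> X \<subseteq> Y"
  by (simp_all add: Cm_def ale_def Int_absorb2 inf.order_iff eq_commute)

lemma Cm_atoms: "atoms (Cm S) = (\<lambda>a. {a}) ` Uni S"
proof (intro subset_antisym subsetI)
  fix x assume x: "x \<in> atoms (Cm S)"
  then have 1: "x \<subseteq> Uni S" "x \<noteq> {}" "\<And>b. b \<subseteq> Uni S \<Longrightarrow> b \<subseteq> x \<Longrightarrow> b = {} \<or> b = x"
    unfolding atoms_def Cm_simps by blast+
  then obtain a where a: "a \<in> x" by blast
  then have "{a} = x" using 1(1) 1(3)[of "{a}"] by blast
  then show "x \<in> (\<lambda>a. {a}) ` Uni S" using 1(1) by blast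
next
  fix x assume "x \<in> (\<lambda>a. {a}) ` Uni S"
  then show "x \<in> atoms (Cm S)" unfolding atoms_def Cm_simps by blast
qed

lemma Cm_atomic: "atomic (Cm S)"
  unfolding atomic_def Cm_atoms Cm_simps by blast

lemma At_Cm: "atstr_iso T n S (At (Cm S)) (\<lambda>a. {a})"
  unfolding atstr_iso_def At_def atstr.simps Cm_atoms Cm_simps
  by (auto simp: bij_betw_def Cm_def)

lemma alg_hom_comp: "alg_hom T n A B g \<Longrightarrow> alg_hom T n B C h \<Longrightarrow> alg_hom T n A C (h \<circ> g)"
  unfolding alg_hom_def by (auto simp: split_beta)

lemma alg_embedding_comp: "alg_embedding T n A B g \<Longrightarrow> alg_embedding T n B C h \<Longrightarrow> alg_embedding T n A C (h \<circ> g)"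
  unfolding alg_embedding_def
proof (elim conjE, intro conjI)
  assume g: "alg_hom T n A B g" "inj_on g (Carr A)" and h: "alg_hom T n B C h" "inj_on h (Carr B)"
  show "alg_hom T n A C (h \<circ> g)" by (rule alg_hom_comp[OF g(1) h(1)])
  have "g ` Carr A \<subseteq> Carr B" using g(1) by (auto simp: alg_hom_def)
  then show "inj_on (h \<circ> g) (Carr A)" using g(2) h(2) by (auto intro: comp_inj_on inj_on_subset)
qed

lemma alg_embedding_Cm:
  fixes A :: "'b alg"
  assumes A: "algebra_of_type T n A" "atomic A" and g: "atstr_iso T n S (At A) g"
  shows "alg_embedding T n A (Cm S) (\<lambda>a. {x \<in> Uni S. ale A (g x) a})"
proof -
  let ?h = "\<lambda>a. {x \<in> Uni S. ale A (g x) a}"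
  have B: "boolean A" using A by (simp add: algebra_of_type_def)
  have bij: "bij_betw g (Uni S) (atoms A)" using g by (simp add: atstr_iso_def At_def)
  have ga: "g x \<in> atoms A" if "x \<in> Uni S" for x using bij that by (auto simp: bij_betw_def)
  note gc = atomsD[OF B ga]
  have ops: "?h (Oper A f a) = {x \<in> Uni S. \<exists>y\<in>?h a. Rel S f x y}"
    if f: "f \<in> uops T n" and a: "a \<in> Carr A" for f a
  proof -
    have cl: "\<And>b. b \<in> Carr A \<Longrightarrow> Oper A f b \<in> Carr A"
      and add: "\<And>X x. X \<subseteq> Carr A \<Longrightarrow> is_lub A X x \<Longrightarrow> is_lub A (Oper A f ` X) (Oper A f x)"
      using A(1) f unfolding algebra_of_type_def by blast+
    have lub: "is_lub A (Oper A f ` {y \<in> atoms A. ale A y a}) (Oper A f a)"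
      by (rule add) (auto simp: lub_atoms[OF B A(2) a] atomsD[OF B])
    have "ale A (g x) (Oper A f a) \<longleftrightarrow> (\<exists>y\<in>atoms A. ale A y a \<and> ale A (g x) (Oper A f y))"
      if x: "x \<in> Uni S" for x
    proof
      assume l: "ale A (g x) (Oper A f a)"
      show "\<exists>y\<in>atoms A. ale A y a \<and> ale A (g x) (Oper A f y)"
      proof (rule ccontr)
        assume no: "\<not> ?thesis"
        have "ale A z (Compl A (g x))" if zm: "z \<in> Oper A f ` {y \<in> atoms A. ale A y a}" for z
        proof -
          obtain y where y: "z = Oper A f y" "y \<in> atoms A" "ale A y a" using zm by blast
          then have z: "z \<in> Carr A" "\<not> ale A (g x) z" using cl atomsD[OF B] no by auto
          then have "Meet A (g x) z = Zero A" using atom_meet[OF B ga[OF x]] by blast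
          then show ?thesis using z gc[OF x]
            ale_iff_disjoint[OF B z(1) bcl(3)[OF B], of "g x"] bcomm(2)[OF B z(1), of "g x"]
              bcompl_compl[OF B, of "g x"] by simp
        qed
        then have "ale A (Oper A f a) (Compl A (g x))"
          using lub bcl(3)[OF B] gc[OF x] unfolding is_lub_def by blast
        then have "ale A (g x) (Compl A (g x))"
          using ale_trans[OF B] l gc[OF x] cl[OF a] bcl(3)[OF B] by blast
        then show False
          using atom_compl[OF B ga[OF x]] gc[OF x] bidem[OF B] unfolding ale_def by blast
      qed
    next
      assume "\<exists>y\<in>atoms A. ale A y a \<and> ale A (g x) (Oper A f y)"
      then obtain y where y: "y \<in> atoms A" "ale A y a" "ale A (g x) (Oper A f y)" by blast
      then have "ale A (Oper A f y) (Oper A f a)" using lub unfolding is_lub_def by blast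
      then show "ale A (g x) (Oper A f a)"
        using ale_trans[OF B] gc[OF x] cl a y atomsD[OF B y(1)] by blast
    qed
    moreover have "(\<exists>y\<in>atoms A. ale A y a \<and> ale A (g x) (Oper A f y)) \<longleftrightarrow> (\<exists>y\<in>?h a. Rel S f x y)"
      if x: "x \<in> Uni S" for x
    proof -
      have "atoms A = g ` Uni S" using bij by (simp add: bij_betw_def)
      moreover have "Rel S f x y \<longleftrightarrow> ale A (g x) (Oper A f (g y))" if "y \<in> Uni S" for y
        using g f x that by (simp add: atstr_iso_def At_def)
      ultimately show ?thesis by auto
    qed
    ultimately show ?thesis by blast
  qed
  have diag: "?h (Diag A i j) = {x \<in> Uni S. DRel S i j x}" if "(i, j) \<in> diags T n" for i j
    using g that by (auto simp: atstr_iso_def At_def)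
  have "\<not> ale A (g x) (Zero A)" if "x \<in> Uni S" for x
    using gc[OF that] bzero[OF B, of "g x"] unfolding ale_def by auto
  then have "?h (Zero A) = {}" by blast
  moreover have "?h (One A) = Uni S"
    using gc B by (auto simp: ale_def bunit)
  moreover have "?h (Compl A a) = Uni S - ?h a" if "a \<in> Carr A" for a
    using atom_compl[OF B ga that] by blast
  moreover have "?h (Join A a b) = ?h a \<union> ?h b" if "a \<in> Carr A" "b \<in> Carr A" for a b
    using atom_join[OF B ga that] by blast
  moreover have "?h (Meet A a b) = ?h a \<inter> ?h b" if "a \<in> Carr A" "b \<in> Carr A" for a b
    using ale_meet_iff[OF B _ that] gc by blast
  ultimately have "alg_hom T n A (Cm S) ?h"
    unfolding alg_hom_def using ops diag by (simp add: Cm_def split_beta)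
  moreover have "inj_on ?h (Carr A)"
  proof (rule inj_onI)
    fix a b assume ab: "a \<in> Carr A" "b \<in> Carr A" "?h a = ?h b"
    have "ale A x a \<longleftrightarrow> ale A x b" if x: "x \<in> atoms A" for x
    proof -
      obtain y where "y \<in> Uni S" "x = g y" using bij x by (auto simp: bij_betw_def)
      then show ?thesis using ab(3) by blast
    qed
    then have "ale A a b" "ale A b a"
      by (auto intro: ale_by_atoms[OF B A(2) ab(1,2)] ale_by_atoms[OF B A(2) ab(2,1)])
    then show "a = b" by (rule ale_antisym[OF B ab(1,2)])
  qed
  ultimately show ?thesis by (simp add: alg_embedding_def)
qed

theorem strongly_representable_iff_Cm:
  "strongly_representable T n S \<longleftrightarrow> representable T n (Cm S)"
proof
  assume sr: "strongly_representable T n S"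
  have "algebra_of_type T n (Cm S) \<and> atomic (Cm S) \<and> (\<exists>g. atstr_iso T n S (At (Cm S)) g)"
    by (intro conjI exI[of _ "\<lambda>a. {a}"] Cm_algebra Cm_atomic At_Cm)
  then show "representable T n (Cm S)"
    by (rule sr[unfolded strongly_representable_def, rule_format])
next
  assume "representable T n (Cm S)"
  then obtain I :: "('a set \<times> 'a set) set" and U :: "'a set \<times> 'a set \<Rightarrow> nat \<Rightarrow> (nat + 'a set) list set" and h
    where adm: "\<forall>k\<in>I. admissible_bases T n (U k)"
      and h: "alg_embedding T n (Cm S) (prod_alg I (\<lambda>k. set_alg n (U k))) h"
    unfolding representable_def by (elim exE conjE)
  show "strongly_representable T n S"
    unfolding strongly_representable_def
  proof (intro allI impI, elim conjE exE)
    fix A :: "'a set alg" and g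
    assume "algebra_of_type T n A" "atomic A" "atstr_iso T n S (At A) g"
    note e = alg_embedding_comp[OF alg_embedding_Cm[OF this] h]
    show "representable T n A"
      unfolding representable_def by (intro exI conjI) (rule adm, rule e)
  qed
qed

end

(* The representability of Cm S reduces to colouring a graph. Label every (n-1)-subset of a set by a
   vertex of a graph G, subject to one condition: among the n facets of an n-subset two must carry
   adjacent labels. The isomorphism types of labelled n-tuples form an atom structure eta G.

   If G is infinite and has a finite proper colouring, then Cm (eta G) is not even Df-representable:
   in a representation, colouring (n-1)-sets of points by the colour of their label and applying
   Ramsey's theorem gives n points all of whose facets have the same colour. Since diagonals are not
   interpreted as equality in a Df-representation, points are transported between the coordinates
   along the diagonal elements.

   If G has infinite chromatic number, some ultrafilter on its vertices contains no independent set.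
   Taking n disjoint copies of G with all edges between different copies, one can freely build a set
   whose (n-1)-subsets are labelled by ultrafilters and in which every type that could be realised by
   a new point is realised: facets whose label is not prescribed receive such an ultrafilter on a
   suitable copy. This yields a representation of Cm (eta G) with all the operations of PEA.

   The shift graph on increasing (k+1)-sequences of numbers has infinite chromatic number by Ramsey's
   theorem, but it has no short odd cycles, so an ultraproduct of these graphs for k = 0, 1, 2, ...
   is bipartite. Since eta commutes with ultraproducts, Los's theorem finishes the proof. Shift
   graphs here take the place of the Erdos graphs in the proof of Hirsch and Hodkinson. *)

theory Submission
  imports Defs "HOL-Library.Ramsey" "HOL-Library.Countable"
begin

section \<open>Ultrafilters\<close>

text \<open>A homomorphism from \<open>Cm (eta G)\<close> into a set algebra respects only finite
  joins, so it assigns to each tuple an ultrafilter of sets of types rather than a type. Both halves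
  turn on this. A finite colouring splits the labels into finitely many classes, and the
  homomorphism has to choose one of them. Conversely, when ultrafilters serve as labels, the
  obstacle is coherence: the ultrafilter of an n-set must project to the labels that its facets
  already have, and must contain the adjacency condition. In an n-set that is not prescribed by its
  latest point, any two facets containing that point include one whose label is free. So it is
  enough that the free label of a point is linked to itself and to the labels that the point
  prescribes. There are at most n - 1 of these, which is the reason for n copies: one copy avoids
  them all. Joining the copies costs colours, and the limit palette has 2n of them. The negative
  half works with cylindrifiers alone and the positive half with all operations, so one sequence of
  graphs serves every signature.\<close>

definition ultra :: "'a filter \<Rightarrow> bool" where
  "ultra F \<longleftrightarrow> F \<noteq> bot \<and> (\<forall>P. eventually P F \<or> eventually (\<lambda>x. \<not> P x) F)"

lemma ultra_not_iff: "ultra F \<Longrightarrow> eventually (\<lambda>x. \<not> P x) F \<longleftrightarrow> \<not> eventually P F"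
  unfolding ultra_def using not_eventually_impI[of P F "\<lambda>_. False"] by auto

lemma ultra_disj_iff:
  assumes "ultra F"
  shows "eventually (\<lambda>x. P x \<or> Q x) F \<longleftrightarrow> eventually P F \<or> eventually Q F"
proof -
  have "eventually (\<lambda>x. P x \<or> Q x) F \<longleftrightarrow> \<not> eventually (\<lambda>x. \<not> P x \<and> \<not> Q x) F"
    using ultra_not_iff[OF assms, of "\<lambda>x. P x \<or> Q x"] by simp
  then show ?thesis by (simp add: eventually_conj_iff ultra_not_iff[OF assms])
qed

lemma ultra_bex_iff:
  assumes "ultra F" "finite I"
  shows "eventually (\<lambda>x. \<exists>i\<in>I. P i x) F \<longleftrightarrow> (\<exists>i\<in>I. eventually (P i) F)"
  using assms(2)
proof (induction I)
  case empty
  then show ?case using assms(1) by (simp add: ultra_def)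
next
  case (insert i I)
  then show ?case by (simp add: ultra_disj_iff[OF assms(1)])
qed

text \<open>Zorn's lemma on the proper filters below \<open>F\<close>, ordered by refinement. A
  chain is directed, so what holds eventually for its infimum already holds for a member; hence the
  infimum is still proper.\<close>

lemma ultra_ex:
  assumes "F \<noteq> bot"
  shows "\<exists>G. ultra G \<and> G \<le> F"
proof -
  let ?P = "\<lambda>G H. H \<le> G"
  have "\<exists>M\<in>{G. G \<noteq> bot \<and> G \<le> F}. \<forall>G\<in>{G. G \<noteq> bot \<and> G \<le> F}. G \<le> M \<longrightarrow> G = M"
  proof (rule predicate_Zorn[of _ ?P])
    show "partial_order_on {G. G \<noteq> bot \<and> G \<le> F} (relation_of ?P {G. G \<noteq> bot \<and> G \<le> F})"
      by (auto simp: partial_order_on_def preorder_on_def refl_on_def trans_def antisym_def relation_of_def)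
    fix C assume C: "C \<in> Chains (relation_of ?P {G. G \<noteq> bot \<and> G \<le> F})"
    show "\<exists>u\<in>{G. G \<noteq> bot \<and> G \<le> F}. \<forall>a\<in>C. u \<le> a"
    proof (cases "C = {}")
      case True
      then show ?thesis using assms by auto
    next
      case False
      have 1: "G \<noteq> bot" "G \<le> F" if "G \<in> C" for G
        using C that unfolding Chains_def relation_of_def by blast+
      have 2: "G \<le> H \<or> H \<le> G" if "G \<in> C" "H \<in> C" for G H
        using C that unfolding Chains_def relation_of_def by blast
      have "\<exists>x\<in>C. x \<le> inf G H" if "G \<in> C" "H \<in> C" for G H
        using 2[OF that] that by (auto intro: bexI[of _ G] bexI[of _ H])
      then have "eventually (\<lambda>_. False) (Inf C) \<longleftrightarrow> (\<exists>b\<in>C. eventually (\<lambda>_. False) b)"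
        by (rule eventually_Inf_base[OF False])
      then have "Inf C \<noteq> bot" using 1(1) by (simp add: trivial_limit_def)
      moreover have "Inf C \<le> F" using 1(2) False by (meson Inf_lower2 ex_in_conv)
      ultimately show ?thesis by (auto intro: Inf_lower)
    qed
  qed
  then obtain M where M: "M \<noteq> bot" "M \<le> F"
    and min: "\<And>G. G \<noteq> bot \<Longrightarrow> G \<le> F \<Longrightarrow> G \<le> M \<Longrightarrow> G = M" by blast
  have "eventually P M \<or> eventually (\<lambda>x. \<not> P x) M" for P
  proof (rule disjCI)
    let ?G = "inf M (principal {x. P x})"
    assume "\<not> eventually (\<lambda>x. \<not> P x) M"
    then have "?G \<noteq> bot" by (simp add: trivial_limit_def eventually_inf_principal)
    then have "?G = M" by (rule min) (use M in \<open>auto intro: le_infI1\<close>)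
    moreover have "eventually P ?G" by (simp add: eventually_inf_principal)
    ultimately show "eventually P M" by simp
  qed
  then show ?thesis using M unfolding ultra_def by blast
qed

text \<open>Turns a one-sided comparison of projections into an equality.\<close>

lemma ultra_minimal:
  assumes "ultra F" "G \<noteq> bot" "G \<le> F"
  shows "G = F"
proof (rule antisym[OF assms(3)], rule filter_leI)
  fix P assume G: "eventually P G"
  show "eventually P F"
  proof (rule ccontr)
    assume "\<not> eventually P F"
    then have "eventually (\<lambda>x. \<not> P x) G"
      using ultra_not_iff[OF assms(1)] filter_leD[OF assms(3)] by blast
    with G have "eventually (\<lambda>_. False) G" by eventually_elim simp
    then show False using assms(2) by (simp add: trivial_limit_def)
  qed
qed

lemma ultra_filtermap: "ultra F \<Longrightarrow> ultra (filtermap f F)"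
  unfolding ultra_def by (simp add: filtermap_bot_iff eventually_filtermap)

section \<open>Labelled tuples and their types\<close>

definition ker :: "nat \<Rightarrow> (nat \<Rightarrow> 'u) \<Rightarrow> (nat \<times> nat) set" where
  "ker n t = {(i, j). i < n \<and> j < n \<and> t i = t j}"

definition facet :: "nat \<Rightarrow> (nat \<Rightarrow> 'u) \<Rightarrow> nat \<Rightarrow> 'u set" where
  "facet n t i = t ` ({..<n} - {i})"

definition nondeg :: "nat \<Rightarrow> (nat \<Rightarrow> 'u) \<Rightarrow> nat \<Rightarrow> bool" where
  "nondeg n t i \<longleftrightarrow> i < n \<and> inj_on t ({..<n} - {i})"

type_synonym 'v tuple_type = "(nat \<times> nat) set \<times> (nat \<Rightarrow> 'v option)"

text \<open>A facet with repeated entries has fewer than n - 1 points and gets no label. Where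
  \<open>None\<close> occurs is determined by the kernel.\<close>

definition tp :: "nat \<Rightarrow> ('u set \<Rightarrow> 'v) \<Rightarrow> (nat \<Rightarrow> 'u) \<Rightarrow> 'v tuple_type" where
  "tp n L t = (ker n t, \<lambda>i. if nondeg n t i then Some (L (facet n t i)) else None)"

definition linked_facets :: "nat \<Rightarrow> ('v \<Rightarrow> 'v \<Rightarrow> bool) \<Rightarrow> ('u set \<Rightarrow> 'v) \<Rightarrow> (nat \<Rightarrow> 'u) \<Rightarrow> bool" where
  "linked_facets n adj L t \<longleftrightarrow>
     (inj_on t {..<n} \<longrightarrow> (\<exists>i<n. \<exists>j<n. adj (L (facet n t i)) (L (facet n t j))))"

text \<open>Tuples of naturals represent all types, because only the at most n entries of a tuple
  matter; see \<open>tp_rename\<close>.\<close>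

definition typs :: "nat \<Rightarrow> 'v set \<Rightarrow> ('v \<Rightarrow> 'v \<Rightarrow> bool) \<Rightarrow> 'v tuple_type set" where
  "typs n V adj = {tp n L t | L (t :: nat \<Rightarrow> nat). range L \<subseteq> V \<and> linked_facets n adj L t}"

text \<open>What survives when coordinate i is forgotten: the equalities off i and the label of the
  facet omitting entry i. Equality of faces is the relation of \<open>Cyl i\<close>.\<close>

definition face :: "nat \<Rightarrow> 'v tuple_type \<Rightarrow> (nat \<times> nat) set \<times> 'v option" where
  "face i a = ({(j, k) \<in> fst a. j \<noteq> i \<and> k \<noteq> i}, snd a i)"

definition subst :: "nat \<Rightarrow> (nat \<Rightarrow> nat) \<Rightarrow> 'v tuple_type \<Rightarrow> 'v tuple_type \<Rightarrow> bool" where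
  "subst n p a b \<longleftrightarrow> (\<exists>L (t :: nat \<Rightarrow> nat). a = tp n L t \<and> b = tp n L (t \<circ> p))"

definition eta :: "nat \<Rightarrow> 'v set \<Rightarrow> ('v \<Rightarrow> 'v \<Rightarrow> bool) \<Rightarrow> 'v tuple_type atstr" where
  "eta n V adj = \<lparr>
     Uni = typs n V adj,
     Rel = (\<lambda>f a b. case f of
              Cyl i \<Rightarrow> face i a = face i b
            | Repl i j \<Rightarrow> subst n (id(i := j)) a b
            | Transp i j \<Rightarrow> subst n (transpose i j) a b),
     DRel = (\<lambda>i j a. (i, j) \<in> fst a)\<rparr>"

lemma ker_eq_iff: "ker n t = ker n t' \<longleftrightarrow> (\<forall>i<n. \<forall>j<n. t i = t j \<longleftrightarrow> t' i = t' j)"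
  unfolding ker_def by blast

lemma inj_on_ker:
  assumes "ker n t = ker n t'" "A \<subseteq> {..<n}"
  shows "inj_on t A \<longleftrightarrow> inj_on t' A"
  using assms unfolding ker_eq_iff inj_on_def by (meson lessThan_iff subset_iff)

lemma nondeg_ker: "ker n t = ker n t' \<Longrightarrow> nondeg n t i \<longleftrightarrow> nondeg n t' i"
  unfolding nondeg_def using inj_on_ker[of n t t' "{..<n} - {i}"] by auto

lemma tp_eq_iff:
  "tp n L t = tp n L' t' \<longleftrightarrow> ker n t = ker n t'
     \<and> (\<forall>i<n. nondeg n t i \<longrightarrow> L (facet n t i) = L' (facet n t' i))"
proof (cases "ker n t = ker n t'")
  case True
  then show ?thesis unfolding tp_def using nondeg_ker[OF True]
    by (auto simp: fun_eq_iff nondeg_def)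
qed (simp add: tp_def)

lemma facet_cong: "(\<And>j. j < n \<Longrightarrow> j \<noteq> i \<Longrightarrow> s j = t j) \<Longrightarrow> facet n s i = facet n t i"
  unfolding facet_def by (intro image_cong) auto

lemma nondeg_cong: "(\<And>j. j < n \<Longrightarrow> j \<noteq> i \<Longrightarrow> s j = t j) \<Longrightarrow> nondeg n s i \<longleftrightarrow> nondeg n t i"
  unfolding nondeg_def by (intro conj_cong refl inj_on_cong) auto

text \<open>The entries of \<open>t\<close> are copied to naturals along an injection and
  \<open>L\<close> is transported along it, so tuples of arbitrary points have types of the kind
  defined with naturals.\<close>

lemma tp_rename:
  fixes t :: "nat \<Rightarrow> 'u"
  obtains L' and t' :: "nat \<Rightarrow> nat" where "ker n t' = ker n t"
    "\<And>A. A \<subseteq> {..<n} \<Longrightarrow> L' (t' ` A) = L (t ` A)" "range L' \<subseteq> range L"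
proof -
  obtain f :: "'u \<Rightarrow> nat" where f: "inj_on f (t ` {..<n})"
    using finite_imp_inj_to_nat_seg[of "t ` {..<n}"] by auto
  define L' where "L' F = L {u \<in> t ` {..<n}. f u \<in> F}" for F
  show ?thesis
  proof
    show "ker n (f \<circ> t) = ker n t"
      using f by (auto simp: ker_eq_iff inj_on_def)
    have "{u \<in> t ` {..<n}. f u \<in> (f \<circ> t) ` A} = t ` A" if "A \<subseteq> {..<n}" for A
      using f that by (auto simp: inj_on_def)
    then show "L' ((f \<circ> t) ` A) = L (t ` A)" if "A \<subseteq> {..<n}" for A
      using that by (simp add: L'_def)
    show "range L' \<subseteq> range L" unfolding L'_def by blast
  qed
qed

lemma tp_typs:
  assumes "range L \<subseteq> V" "linked_facets n adj L t"
  shows "tp n L t \<in> typs n V adj"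
proof -
  obtain L' and t' :: "nat \<Rightarrow> nat" where k: "ker n t' = ker n t"
    and A: "\<And>A. A \<subseteq> {..<n} \<Longrightarrow> L' (t' ` A) = L (t ` A)" and r: "range L' \<subseteq> range L"
    by (rule tp_rename[of n t L]) blast
  have f: "L' (facet n t' i) = L (facet n t i)" for i
    unfolding facet_def by (rule A) blast
  have "tp n L t = tp n L' t'" using k f by (simp add: tp_eq_iff)
  moreover have "linked_facets n adj L' t'"
    using assms(2) inj_on_ker[OF k, of "{..<n}"] by (simp add: linked_facets_def f)
  ultimately show ?thesis unfolding typs_def using assms(1) r by blast
qed

text \<open>\<open>p\<close> is injective on the n - 1 indices other than i, so the image of these
  omits exactly one index m below n, and facet i of \<open>t \<circ> p\<close> is facet m of
  \<open>t\<close>.\<close>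

lemma facet_comp:
  assumes p: "p ` {..<n} \<subseteq> {..<n}" and nd: "nondeg n (t \<circ> p) i"
  obtains m where "nondeg n t m" "m < n" "facet n (t \<circ> p) i = facet n t m"
     "p ` ({..<n} - {i}) = {..<n} - {m}"
proof -
  let ?A = "{..<n} - {i}"
  have i: "i < n" and inj: "inj_on (t \<circ> p) ?A" using nd by (auto simp: nondeg_def)
  have pA: "p ` ?A \<subseteq> {..<n}" using p by blast
  have "card (p ` ?A) = n - 1"
    using card_image[OF inj_on_imageI2[OF inj]] i by simp
  then have "card ({..<n} - p ` ?A) = 1"
    using pA i by (simp add: card_Diff_subset finite_subset[OF pA])
  then obtain m where "{..<n} - p ` ?A = {m}" by (auto simp: card_1_singleton_iff)
  then have m: "m < n" "p ` ?A = {..<n} - {m}" using pA by blast+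
  have "inj_on t ({..<n} - {m})" using inj_on_imageI[OF inj] m(2) by simp
  moreover have "facet n (t \<circ> p) i = facet n t m"
    unfolding facet_def image_comp[symmetric] m(2) ..
  ultimately show thesis using that m by (simp add: nondeg_def)
qed

lemma ker_comp:
  assumes "ker n t = ker n t'" "p ` {..<n} \<subseteq> {..<n}"
  shows "ker n (t \<circ> p) = ker n (t' \<circ> p)"
  unfolding ker_eq_iff using assms(1)[unfolded ker_eq_iff] assms(2) by auto

text \<open>Makes substitution well defined on types: every labelled facet of
  \<open>t \<circ> p\<close> is already a labelled facet of \<open>t\<close>.\<close>

lemma tp_comp:
  assumes eq: "tp n L t = tp n L' t'" and p: "p ` {..<n} \<subseteq> {..<n}"
  shows "tp n L (t \<circ> p) = tp n L' (t' \<circ> p)"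
  unfolding tp_eq_iff
proof (intro conjI allI impI)
  have k: "ker n t = ker n t'"
    and L: "\<And>i. i < n \<Longrightarrow> nondeg n t i \<Longrightarrow> L (facet n t i) = L' (facet n t' i)"
    using eq unfolding tp_eq_iff by blast+
  show k': "ker n (t \<circ> p) = ker n (t' \<circ> p)" by (rule ker_comp[OF k p])
  fix i assume nd: "nondeg n (t \<circ> p) i"
  obtain m where m: "nondeg n t m" "m < n" "facet n (t \<circ> p) i = facet n t m"
    "p ` ({..<n} - {i}) = {..<n} - {m}"
    by (rule facet_comp[OF p nd])
  have "facet n (t' \<circ> p) i = facet n t' m"
    unfolding facet_def image_comp[symmetric] m(4) ..
  then show "L (facet n (t \<circ> p) i) = L' (facet n (t' \<circ> p) i)"
    using L[OF m(2,1)] m(3) by simp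
qed

lemma subst_tp_iff:
  fixes t :: "nat \<Rightarrow> 'u"
  assumes p: "p ` {..<n} \<subseteq> {..<n}"
  shows "subst n p (tp n L t) b \<longleftrightarrow> b = tp n L (t \<circ> p)"
proof
  assume "subst n p (tp n L t) b"
  then show "b = tp n L (t \<circ> p)" unfolding subst_def using tp_comp[OF _ p] by metis
next
  assume b: "b = tp n L (t \<circ> p)"
  obtain L' and t' :: "nat \<Rightarrow> nat" where k: "ker n t' = ker n t"
    and A: "\<And>A. A \<subseteq> {..<n} \<Longrightarrow> L' (t' ` A) = L (t ` A)"
    by (rule tp_rename[of n t L]) blast
  have "L' (facet n t' i) = L (facet n t i)" for i
    unfolding facet_def by (rule A) blast
  then have "tp n L t = tp n L' t'" using k by (simp add: tp_eq_iff)
  then show "subst n p (tp n L t) b"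
    unfolding subst_def b using tp_comp[OF _ p] by metis
qed

lemma face_tp_eq_iff:
  assumes "i < n"
  shows "face i (tp n L t) = face i (tp n L' t') \<longleftrightarrow>
     (\<forall>j<n. \<forall>k<n. j \<noteq> i \<longrightarrow> k \<noteq> i \<longrightarrow> (t j = t k \<longleftrightarrow> t' j = t' k))
     \<and> (nondeg n t i \<longrightarrow> L (facet n t i) = L' (facet n t' i))"
proof (cases "\<forall>j<n. \<forall>k<n. j \<noteq> i \<longrightarrow> k \<noteq> i \<longrightarrow> (t j = t k \<longleftrightarrow> t' j = t' k)")
  case True
  then have "inj_on t ({..<n} - {i}) \<longleftrightarrow> inj_on t' ({..<n} - {i})"
    unfolding inj_on_def by (metis DiffE insertI1 lessThan_iff)
  then have "nondeg n t i \<longleftrightarrow> nondeg n t' i" by (simp add: nondeg_def)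
  moreover have "{(j, k) \<in> ker n t. j \<noteq> i \<and> k \<noteq> i} = {(j, k) \<in> ker n t'. j \<noteq> i \<and> k \<noteq> i}"
    using True by (auto simp: ker_def)
  ultimately show ?thesis using True by (simp add: face_def tp_def)
next
  case False
  then have "{(j, k) \<in> ker n t. j \<noteq> i \<and> k \<noteq> i} \<noteq> {(j, k) \<in> ker n t'. j \<noteq> i \<and> k \<noteq> i}"
    unfolding ker_def set_eq_iff by fastforce
  then show ?thesis using False by (auto simp: face_def tp_def)
qed

lemma uops_maps:
  assumes "i < n" "j < n"
  shows "id(i := j) ` {..<n} \<subseteq> {..<n}" "transpose i j ` {..<n} \<subseteq> {..<n}"
  using assms by (auto simp: transpose_def)

section \<open>Finitely colourable graphs\<close>

text \<open>One coordinate of a representation, seen through Boolean operations and cylindrifiers.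
  The bases may differ from coordinate to coordinate and \<open>H\<close> may fail to be injective,
  so this covers every signature.\<close>

locale df_hom =
  fixes n :: nat and V :: "'v set" and adj :: "'v \<Rightarrow> 'v \<Rightarrow> bool"
    and U :: "nat \<Rightarrow> 'u set" and H :: "'v tuple_type set \<Rightarrow> (nat \<Rightarrow> 'u) set"
  assumes n: "2 < n"
    and H_un: "X \<subseteq> typs n V adj \<Longrightarrow> Y \<subseteq> typs n V adj \<Longrightarrow> H (X \<union> Y) = H X \<union> H Y"
    and H_int: "X \<subseteq> typs n V adj \<Longrightarrow> Y \<subseteq> typs n V adj \<Longrightarrow> H (X \<inter> Y) = H X \<inter> H Y"
    and H_empty: "H {} = {}"
    and H_all: "H (typs n V adj) = tuples n U"
    and H_cyl: "i < n \<Longrightarrow> X \<subseteq> typs n V adj \<Longrightarrow>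
      H {a \<in> typs n V adj. \<exists>b\<in>X. face i a = face i b} = set_op n (tuples n U) (Cyl i) (H X)"
begin

abbreviation "S \<equiv> typs n V adj"

lemma H_mono: "X \<subseteq> Y \<Longrightarrow> Y \<subseteq> S \<Longrightarrow> H X \<subseteq> H Y"
  using H_un[of X Y] by (auto simp: sup_absorb2)

lemma H_sub: "X \<subseteq> S \<Longrightarrow> H X \<subseteq> tuples n U"
  using H_mono[of X S] H_all by simp

lemma H_Union: "finite \<X> \<Longrightarrow> (\<And>X. X \<in> \<X> \<Longrightarrow> X \<subseteq> S) \<Longrightarrow> H (\<Union>\<X>) = (\<Union>X\<in>\<X>. H X)"
proof (induction \<X> rule: finite_induct)
  case empty
  then show ?case by (simp add: H_empty)
next
  case (insert X \<X>)
  have "H (X \<union> \<Union>\<X>) = H X \<union> H (\<Union>\<X>)"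
    by (rule H_un) (use insert.prems in auto)
  then show ?case using insert by simp
qed

lemma H_Inter:
  assumes "finite J" "J \<noteq> {}" "\<And>i. i \<in> J \<Longrightarrow> X i \<subseteq> S" "\<And>i. i \<in> J \<Longrightarrow> s \<in> H (X i)"
  shows "s \<in> H (\<Inter>i\<in>J. X i)"
  using assms
proof (induction J rule: finite_ne_induct)
  case (insert i J)
  then obtain j where "j \<in> J" by blast
  then have "(\<Inter>i\<in>J. X i) \<subseteq> S" using insert.prems(1)[of j] by blast
  then have "H (X i \<inter> (\<Inter>i\<in>J. X i)) = H (X i) \<inter> H (\<Inter>i\<in>J. X i)"
    using insert.prems(1) by (intro H_int) auto
  then show ?case using insert by simp
qed simp

text \<open>The elements with \<open>c_i X = X\<close>; membership of a tuple in \<open>H X\<close>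
  does not depend on its coordinate i.\<close>

definition indep :: "nat \<Rightarrow> 'v tuple_type set \<Rightarrow> bool" where
  "indep i X \<longleftrightarrow> X \<subseteq> S \<and> (\<forall>a\<in>S. \<forall>b\<in>X. face i a = face i b \<longrightarrow> a \<in> X)"

lemma indep_H:
  assumes "indep i X" "i < n" "s \<in> H X" "t \<in> tuples n U" "\<And>j. j < n \<Longrightarrow> j \<noteq> i \<Longrightarrow> s j = t j"
  shows "t \<in> H X"
proof -
  have "{a \<in> S. \<exists>b\<in>X. face i a = face i b} = X"
    using assms(1) unfolding indep_def by blast
  then have "H X = set_op n (tuples n U) (Cyl i) (H X)"
    using H_cyl[OF assms(2), of X] assms(1) unfolding indep_def by simp
  moreover have "t \<in> set_op n (tuples n U) (Cyl i) (H X)"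
    using assms(3-5) by auto
  ultimately show ?thesis by blast
qed

lemma tuplesI: "(\<And>i. i < n \<Longrightarrow> f i \<in> U i) \<Longrightarrow> (\<lambda>i\<in>{..<n}. f i) \<in> tuples n U"
  by (auto simp: tuples_def)

lemma tuplesD: "s \<in> tuples n U \<Longrightarrow> i < n \<Longrightarrow> s i \<in> U i"
  by (auto simp: tuples_def)

text \<open>The coordinates outside \<open>J\<close> are replaced one after another:
  \<open>r m\<close> has the entries of \<open>t\<close> below m and those of \<open>s\<close> from
  m on.\<close>

lemma indep_H_on:
  assumes X: "\<And>i. i < n \<Longrightarrow> i \<notin> J \<Longrightarrow> indep i X" and s: "s \<in> H X" and t: "t \<in> tuples n U"
    and J: "\<And>j. j < n \<Longrightarrow> j \<in> J \<Longrightarrow> s j = t j" and sub: "X \<subseteq> S"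
  shows "t \<in> H X"
proof -
  define r where "r m = (\<lambda>i\<in>{..<n}. if i < m then t i else s i)" for m
  have sU: "s \<in> tuples n U" using s H_sub[OF sub] by blast
  have rU: "r m \<in> tuples n U" for m
    unfolding r_def by (rule tuplesI) (use tuplesD[OF sU] tuplesD[OF t] in auto)
  have "r m \<in> H X" if "m \<le> n" for m
    using that
  proof (induction m)
    case 0
    have "r 0 = s" using sU by (auto simp: r_def tuples_def PiE_def extensional_def fun_eq_iff)
    then show ?case using s by simp
  next
    case (Suc m)
    show ?case
    proof (cases "m \<in> J")
      case True
      then have "r (Suc m) = r m" using J[of m] Suc.prems by (auto simp: r_def fun_eq_iff less_Suc_eq)
      then show ?thesis using Suc by simp
    next
      case False
      show ?thesis
        by (rule indep_H[OF X[of m] _ Suc.IH rU]) (use False Suc.prems in \<open>auto simp: r_def\<close>)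
    qed
  qed
  moreover have "r n = t" using t by (auto simp: r_def tuples_def PiE_def extensional_def fun_eq_iff)
  ultimately show ?thesis by force
qed

text \<open>A set of types, hence an element of the complex algebra even when the signature lacks
  diagonals. Its image under \<open>H\<close> need not be equality of two coordinates.\<close>

definition D :: "nat \<Rightarrow> nat \<Rightarrow> 'v tuple_type set" where
  "D i j = {a \<in> S. (i, j) \<in> fst a}"

definition labelled :: "nat \<Rightarrow> 'v set \<Rightarrow> 'v tuple_type set" where
  "labelled i C = {a \<in> S. \<exists>v\<in>C. snd a i = Some v}"

lemma S_cases:
  assumes "a \<in> S"
  obtains L and t :: "nat \<Rightarrow> nat" where "a = tp n L t" "range L \<subseteq> V" "linked_facets n adj L t"
  using assms unfolding typs_def by blast

lemma indep_labelled: "indep i (labelled i C)"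
  unfolding indep_def labelled_def face_def by auto

lemma indep_D:
  assumes "k \<noteq> i" "k \<noteq> j"
  shows "indep k (D i j)"
proof -
  have "(i, j) \<in> fst a" if "face k a = face k b" "(i, j) \<in> fst b" for a b :: "'v tuple_type"
  proof -
    have "(i, j) \<in> fst (face k b)" using that(2) assms by (simp add: face_def)
    then have "(i, j) \<in> fst (face k a)" by (simp only: that(1))
    then show ?thesis by (simp add: face_def)
  qed
  then show ?thesis unfolding indep_def D_def by blast
qed

lemma D_sub: "D i j \<subseteq> S" and labelled_sub: "labelled i C \<subseteq> S"
  unfolding D_def labelled_def by blast+

lemma D_H:
  assumes "s \<in> H (D i j)" "t \<in> tuples n U" "s i = t i" "s j = t j"
  shows "t \<in> H (D i j)"
  by (rule indep_H_on[OF _ assms(1,2) _ D_sub, of "{i, j}"]) (use assms indep_D in auto)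

lemma D_comm: "D i j = D j i"
proof -
  have "(i, j) \<in> fst a \<longleftrightarrow> (j, i) \<in> fst a" if "a \<in> S" for a
    using that by (auto elim!: S_cases simp: tp_def ker_def)
  then show ?thesis unfolding D_def by blast
qed

lemma D_trans: "D i j \<inter> D j k \<subseteq> D i k"
proof
  fix a assume a: "a \<in> D i j \<inter> D j k"
  then have "a \<in> S" by (simp add: D_def)
  then obtain L and t :: "nat \<Rightarrow> nat" where "a = tp n L t" by (rule S_cases)
  with a show "a \<in> D i k" by (auto simp: D_def tp_def ker_def)
qed

text \<open>If entries i and j agree, omitting either leaves the same facet.\<close>

lemma D_labelled:
  assumes ij: "i < n" "j < n"
  shows "D i j \<inter> labelled i C \<subseteq> labelled j C"
proof
  fix a assume a: "a \<in> D i j \<inter> labelled i C"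
  then have aS: "a \<in> S" by (simp add: D_def)
  then obtain L and t :: "nat \<Rightarrow> nat" where at: "a = tp n L t" by (rule S_cases)
  have t: "t i = t j" using a by (simp add: at D_def tp_def ker_def)
  have f: "facet n t i = facet n t j" if "i \<noteq> j"
    unfolding facet_def using t ij that by (auto simp: image_iff) (metis DiffI lessThan_iff singletonD)+
  have "nondeg n t i \<longleftrightarrow> nondeg n t j" if "i \<noteq> j"
    unfolding nondeg_def inj_on_def using t ij by (metis Diff_iff insertCI insertE empty_iff lessThan_iff)
  then show "a \<in> labelled j C" using a f by (cases "i = j") (auto simp: at labelled_def tp_def)
qed

lemma labelled_disjoint: "C \<inter> C' = {} \<Longrightarrow> labelled i C \<inter> labelled i C' = {}"
  unfolding labelled_def by auto

section \<open>Transport of points between coordinates\<close>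

definition E :: "nat \<Rightarrow> nat \<Rightarrow> 'u \<Rightarrow> 'u \<Rightarrow> bool" where
  "E i j u v \<longleftrightarrow> (\<exists>s\<in>H (D i j). s i = u \<and> s j = v)"

lemma E_iff: "s \<in> tuples n U \<Longrightarrow> E i j (s i) (s j) \<longleftrightarrow> s \<in> H (D i j)"
  unfolding E_def using D_H by metis

lemma E_comm: "E i j u v \<longleftrightarrow> E j i v u"
  unfolding E_def using D_comm[of i j] by auto

text \<open>Overwriting coordinate k of a witness for (i, j) produces one tuple in both diagonal
  elements; k differs from i and j, so the first witness is not disturbed.\<close>

lemma E_trans:
  assumes "i < n" "j < n" "k < n" "i \<noteq> k" "j \<noteq> k" "i \<noteq> j" "E i j u v" "E j k v w"
  shows "E i k u w"
proof -
  obtain s t where s: "s \<in> H (D i j)" "s i = u" "s j = v" and t: "t \<in> H (D j k)" "t j = v" "t k = w"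
    using assms unfolding E_def by blast
  have sU: "s \<in> tuples n U" "t \<in> tuples n U" using s t H_sub[OF D_sub] by blast+
  define r where "r = s(k := w)"
  have r: "r \<in> tuples n U"
    using sU tuplesD[OF sU(2) assms(3)] assms(3) t(3)
    by (auto simp: r_def tuples_def PiE_def extensional_def Pi_def)
  have "r \<in> H (D i j)" by (rule D_H[OF s(1) r]) (use assms s in \<open>auto simp: r_def\<close>)
  moreover have "r \<in> H (D j k)" by (rule D_H[OF t(1) r]) (use assms s t in \<open>auto simp: r_def\<close>)
  ultimately have "r \<in> H (D i j \<inter> D j k)" by (simp add: H_int[OF D_sub D_sub])
  then have "r \<in> H (D i k)" using H_mono[OF D_trans D_sub] by blast
  then show ?thesis unfolding E_def using s assms(4) by (intro bexI[of _ r]) (auto simp: r_def)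
qed

text \<open>Replacing entry i of a tuple by entry 0 keeps its face i and makes it non-injective, so
  the adjacency condition holds vacuously. Hence \<open>c_i (D 0 i)\<close> is the unit.\<close>

lemma E_total:
  assumes "i < n" "i \<noteq> 0" and s: "s \<in> tuples n U"
  shows "\<exists>v\<in>U i. E 0 i (s 0) v"
proof -
  have "\<exists>b\<in>D 0 i. face i a = face i b" if aS: "a \<in> S" for a
  proof -
    obtain L and t :: "nat \<Rightarrow> nat" where a: "a = tp n L t" "range L \<subseteq> V" "linked_facets n adj L t"
      using aS by (rule S_cases)
    let ?t = "t(i := t 0)"
    have "\<not> inj_on ?t {..<n}"
      using assms(1,2) by (auto simp: inj_on_def dest!: bspec[of _ _ i] bspec[of _ _ 0])
    then have "tp n L ?t \<in> S" by (intro tp_typs a(2)) (simp add: linked_facets_def)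
    then have "tp n L ?t \<in> D 0 i" using assms(1,2) by (simp add: D_def tp_def ker_def)
    moreover have "face i a = face i (tp n L ?t)"
      unfolding a(1) face_tp_eq_iff[OF assms(1)] using facet_cong[of n i t ?t] by auto
    ultimately show ?thesis by blast
  qed
  then have "{a \<in> S. \<exists>b\<in>D 0 i. face i a = face i b} = S" by blast
  then have "s \<in> set_op n (tuples n U) (Cyl i) (H (D 0 i))"
    using H_cyl[OF assms(1) D_sub, of 0 i] H_all s by simp
  then obtain t where t: "t \<in> H (D 0 i)" "\<forall>j<n. j \<noteq> i \<longrightarrow> t j = s j" by auto
  then have "t \<in> tuples n U" using H_sub[OF D_sub] by blast
  then show ?thesis using t assms(1,2) tuplesD unfolding E_def by (metis less_nat_zero_code neq0_conv)
qed

text \<open>A new point at position 0 leaves facet 0 untouched and frees all other labels: facet 1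
  gets \<open>x\<close> and the rest a neighbour of \<open>x\<close>. As \<open>2 < n\<close>, facet
  2 is among the rest and supplies the adjacent pair.\<close>

lemma label_ext:
  assumes noiso: "\<And>x. x \<in> V \<Longrightarrow> \<exists>y\<in>V. adj x y" and x: "x \<in> V" and a: "a \<in> labelled 0 V"
  shows "\<exists>b\<in>labelled 1 {x}. face 0 a = face 0 b"
proof -
  obtain L and t :: "nat \<Rightarrow> nat" where at: "a = tp n L t" "range L \<subseteq> V" "linked_facets n adj L t"
    using a labelled_sub S_cases by blast
  have nd: "nondeg n t 0" using a by (auto simp: at labelled_def tp_def split: if_splits)
  obtain y where y: "y \<in> V" "adj x y" using noiso[OF x] by blast
  obtain u where u: "u \<notin> t ` {..<n}" using ex_new_if_finite[OF infinite_UNIV_nat] by blast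
  define t' where "t' = t(0 := u)"
  have inj: "inj_on t' {..<n}"
    using nd u unfolding nondeg_def inj_on_def t'_def by auto
  have in_f: "t' i \<notin> facet n t' j \<longleftrightarrow> i = j" if "i < n" "j < n" for i j
    unfolding facet_def using that inj by (auto simp: inj_on_def)
  have ne: "facet n t' i \<noteq> facet n t' j" if "i < n" "j < n" "i \<noteq> j" for i j
    using in_f[of i i] in_f[of i j] that by auto
  define L' where "L' F = (if F = facet n t' 0 then L F else if F = facet n t' 1 then x else y)" for F
  have L': "L' (facet n t' 1) = x" "L' (facet n t' 2) = y" "L' (facet n t' 0) = L (facet n t' 0)"
    using n ne by (simp_all add: L'_def)
  have ra: "range L' \<subseteq> V" using at(2) x y by (auto simp: L'_def)
  have "linked_facets n adj L' t'"
    unfolding linked_facets_def using L' y(2) n by (metis Suc_lessD One_nat_def numeral_2_eq_2)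
  then have "tp n L' t' \<in> S" by (rule tp_typs[OF ra])
  moreover have "snd (tp n L' t') 1 = Some x"
    using L' inj n by (simp add: tp_def nondeg_def inj_on_diff)
  moreover have "face 0 a = face 0 (tp n L' t')"
    using n L'(3) facet_cong[of n 0 t t'] by (auto simp: at face_tp_eq_iff t'_def)
  ultimately show ?thesis unfolding labelled_def by blast
qed

text \<open>Supplies points that the diagonal relations tell apart. The entries of \<open>s\<close>
  off 0 are kept, and \<open>x\<close> is the label of facet 1 once the new point
  \<open>r x 0\<close> stands at 0; \<open>E_total\<close> then gives this point a copy in every
  coordinate.\<close>

lemma separated_points:
  assumes noiso: "\<And>x. x \<in> V \<Longrightarrow> \<exists>y\<in>V. adj x y" and s: "s \<in> H (labelled 0 V)"
  obtains Q where "\<And>x i. x \<in> V \<Longrightarrow> i < n \<Longrightarrow> Q x i \<in> U i"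
    "\<And>x i j. x \<in> V \<Longrightarrow> i < n \<Longrightarrow> j < n \<Longrightarrow> i \<noteq> j \<Longrightarrow> E i j (Q x i) (Q x j)"
    "\<And>x y i j. x \<in> V \<Longrightarrow> y \<in> V \<Longrightarrow> x \<noteq> y \<Longrightarrow> i < n \<Longrightarrow> j < n \<Longrightarrow> i \<noteq> j \<Longrightarrow> \<not> E i j (Q x i) (Q y j)"
proof -
  have sU: "s \<in> tuples n U" using s H_sub[OF labelled_sub] by blast
  have "\<exists>t. t \<in> H (labelled 1 {x}) \<and> (\<forall>j<n. j \<noteq> 0 \<longrightarrow> t j = s j)" if "x \<in> V" for x
  proof -
    have "labelled 0 V \<subseteq> {a \<in> S. \<exists>b\<in>labelled 1 {x}. face 0 a = face 0 b}"
      using label_ext[OF noiso that] labelled_sub by blast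
    then have "s \<in> H {a \<in> S. \<exists>b\<in>labelled 1 {x}. face 0 a = face 0 b}"
      using s H_mono[of "labelled 0 V"] by blast
    then show ?thesis using H_cyl[OF _ labelled_sub] n by auto
  qed
  then obtain r where r: "\<And>x. x \<in> V \<Longrightarrow> r x \<in> H (labelled 1 {x})"
    "\<And>x j. x \<in> V \<Longrightarrow> j < n \<Longrightarrow> j \<noteq> 0 \<Longrightarrow> r x j = s j" by metis
  have rU: "r x \<in> tuples n U" if "x \<in> V" for x using r(1)[OF that] H_sub[OF labelled_sub] by blast
  have "\<exists>v. v \<in> U i \<and> (if i = 0 then v = r x 0 else E 0 i (r x 0) v)" if "x \<in> V" "i < n" for x i
    using E_total[OF that(2) _ rU[OF that(1)]] tuplesD[OF rU[OF that(1)] that(2)] by (cases "i = 0") auto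
  then obtain Q where Q: "\<And>x i. x \<in> V \<Longrightarrow> i < n \<Longrightarrow> Q x i \<in> U i"
    "\<And>x i. x \<in> V \<Longrightarrow> i < n \<Longrightarrow> if i = 0 then Q x i = r x 0 else E 0 i (r x 0) (Q x i)" by metis
  have Q0: "Q x 0 = r x 0" if "x \<in> V" for x using Q(2)[OF that, of 0] n by simp
  have QE0: "E 0 i (Q x 0) (Q x i)" if "x \<in> V" "i < n" "i \<noteq> 0" for x i
    using Q(2)[OF that(1,2)] that(3) Q0[OF that(1)] by simp
  have QE: "E i j (Q x i) (Q x j)" if "x \<in> V" "i < n" "j < n" "i \<noteq> j" for x i j
  proof (cases "i = 0 \<or> j = 0")
    case True
    then show ?thesis using QE0[OF that(1)] that E_comm by metis
  next
    case False
    then have "E i 0 (Q x i) (Q x 0)" "E 0 j (Q x 0) (Q x j)"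
      using QE0[OF that(1)] that by (auto simp: E_comm[of i 0])
    then show ?thesis using E_trans[of i 0 j] False that n by auto
  qed
  \<comment> \<open>A copy of \<open>r x 0\<close> at position 1 identifies facets 0 and 1, so the
    label \<open>x\<close> moves from facet 1 to facet 0.\<close>
  have mark: "s' \<in> H (labelled 0 {x})"
    if x: "x \<in> V" "E 0 1 (r x 0) v" and s': "s' = s(0 := r x 0, 1 := v)" "v \<in> U 1" for x v s'
  proof -
    have s'U: "s' \<in> tuples n U"
      using sU s' n tuplesD[OF rU[OF x(1)], of 0] by (auto simp: tuples_def PiE_def extensional_def Pi_def)
    have "s' \<in> H (labelled 1 {x})"
      by (rule indep_H[OF indep_labelled _ r(1)[OF x(1)] s'U]) (use n r(2)[OF x(1)] s' in auto)
    moreover have "s' \<in> H (D 1 0)" unfolding D_comm[of 1 0] E_iff[OF s'U, symmetric] using x(2) s' by simp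
    ultimately have "s' \<in> H (D 1 0 \<inter> labelled 1 {x})" by (simp add: H_int[OF D_sub labelled_sub])
    then show ?thesis using H_mono[OF D_labelled labelled_sub, of 1 0 "{x}"] n by auto
  qed
  \<comment> \<open>If the copy of point \<open>y\<close> at 1 matched point \<open>x\<close> as
    well, facet 0 of one tuple would carry both labels: facet 0 does not see the entry at 0, so
    \<open>r y 0\<close> may be exchanged for \<open>r x 0\<close>.\<close>
  have sep: "\<not> E 0 1 (Q x 0) (Q y 1)" if xy: "x \<in> V" "y \<in> V" "x \<noteq> y" for x y
  proof
    assume "E 0 1 (Q x 0) (Q y 1)"
    then have 1: "s(0 := r x 0, 1 := Q y 1) \<in> H (labelled 0 {x})"
      using mark[OF xy(1)] Q0[OF xy(1)] Q(1)[OF xy(2)] n by simp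
    have 2: "s(0 := r y 0, 1 := Q y 1) \<in> H (labelled 0 {y})"
      using mark[OF xy(2)] QE0[OF xy(2)] Q0[OF xy(2)] Q(1)[OF xy(2)] n by simp
    have "s(0 := r x 0, 1 := Q y 1) \<in> H (labelled 0 {y})"
      by (rule indep_H[OF indep_labelled _ 2]) (use n 1 H_sub[OF labelled_sub] in auto)
    with 1 have "s(0 := r x 0, 1 := Q y 1) \<in> H (labelled 0 {x} \<inter> labelled 0 {y})"
      by (simp add: H_int[OF labelled_sub labelled_sub])
    then show False using labelled_disjoint[of "{x}" "{y}"] xy(3) H_empty by simp
  qed
  \<comment> \<open>A relation between \<open>x\<close> and \<open>y\<close> spreads to a third
    coordinate through the copies of \<open>y\<close> or of \<open>x\<close>, so excluding the pair
    (0, 1) excludes all pairs.\<close>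
  have move_r: "E i l (Q x i) (Q y l)"
    if "E i j (Q x i) (Q y j)" "x \<in> V" "y \<in> V" "i < n" "j < n" "l < n" "i \<noteq> j" "l \<noteq> i" "l \<noteq> j" for x y i j l
    by (rule E_trans[OF _ _ _ _ _ _ that(1) QE]) (use that in auto)
  have move_l: "E l j (Q x l) (Q y j)"
    if "E i j (Q x i) (Q y j)" "x \<in> V" "y \<in> V" "i < n" "j < n" "l < n" "i \<noteq> j" "l \<noteq> i" "l \<noteq> j" for x y i j l
    by (rule E_trans[OF _ _ _ _ _ _ QE that(1)]) (use that in auto)
  have "\<not> E i j (Q x i) (Q y j)"
    if xy: "x \<in> V" "y \<in> V" "x \<noteq> y" and ij: "i < n" "j < n" "i \<noteq> j" for x y i j
  proof
    assume E: "E i j (Q x i) (Q y j)"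
    note mr = move_r[OF _ xy(1,2)] and ml = move_l[OF _ xy(1,2)]
    have n3: "0 < n" "1 < n" "2 < n" using n by auto
    have no: "\<not> E 0 1 (Q x 0) (Q y 1)" by (rule sep[OF xy])
    have no2: "\<not> E k 1 (Q x k) (Q y 1)" if "k < n" "k \<noteq> 1" for k
      using ml[of k 1 0] no that n3 by (cases "k = 0") auto
    have no3: "\<not> E k l (Q x k) (Q y l)" if "k < n" "l < n" "k \<noteq> 1" "l \<noteq> k" for k l
      using mr[of k l 1] no2[of k] that n3 by (cases "l = 1") auto
    show False
    proof (cases "i = 1")
      case True
      define k where "k = (if j = 0 then 2 else 0 :: nat)"
      have k: "k < n" "k \<noteq> 1" "k \<noteq> j" using n3 True ij by (auto simp: k_def)
      then show False using ml[OF E, of k] no3[of k j] ij True by auto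
    qed (use no3 E ij in blast)
  qed
  then show thesis using that Q(1) QE by blast
qed

text \<open>Finiteness of the colouring is what lets \<open>H\<close>, which respects only finite
  unions, assign a colour to each (n-1)-set of separated points. The conclusion names an annihilated
  element because \<open>H\<close> need not be injective.\<close>

lemma no_finite_colouring:
  fixes col :: "'v \<Rightarrow> nat"
  assumes inf: "infinite V" and noiso: "\<And>x. x \<in> V \<Longrightarrow> \<exists>y\<in>V. adj x y"
    and col: "\<And>x. x \<in> V \<Longrightarrow> col x < N"
    and proper: "\<And>x y. x \<in> V \<Longrightarrow> y \<in> V \<Longrightarrow> adj x y \<Longrightarrow> col x \<noteq> col y"
  shows "H (labelled 0 V) = {}"
proof (rule ccontr)
  assume "H (labelled 0 V) \<noteq> {}"
  then obtain s0 where s0: "s0 \<in> H (labelled 0 V)" by blast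
  obtain R where RU: "\<And>x i. x \<in> V \<Longrightarrow> i < n \<Longrightarrow> R x i \<in> U i"
    and RE: "\<And>x i j. x \<in> V \<Longrightarrow> i < n \<Longrightarrow> j < n \<Longrightarrow> i \<noteq> j \<Longrightarrow> E i j (R x i) (R x j)"
    and RN: "\<And>x y i j. x \<in> V \<Longrightarrow> y \<in> V \<Longrightarrow> x \<noteq> y \<Longrightarrow> i < n \<Longrightarrow> j < n \<Longrightarrow> i \<noteq> j \<Longrightarrow> \<not> E i j (R x i) (R y j)"
    by (rule separated_points[OF noiso s0]) blast+
  obtain e :: "nat \<Rightarrow> 'v" where e: "inj e" "range e \<subseteq> V"
    using infinite_countable_subset[OF inf] by blast
  define Q where "Q x = R (e x)" for x
  have QU: "Q x i \<in> U i" if "i < n" for x i using RU that e unfolding Q_def by blast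
  have QE: "E i j (Q x i) (Q x j)" if "i < n" "j < n" "i \<noteq> j" for x i j
    using RE that e unfolding Q_def by blast
  have QN: "\<not> E i j (Q x i) (Q y j)" if "x \<noteq> y" "i < n" "j < n" "i \<noteq> j" for x y i j
    using RN[of "e x" "e y"] that e injD[OF e(1)] unfolding Q_def by blast
  define X where "X i c = labelled i {x \<in> V. col x = c}" for i c
  \<comment> \<open>\<open>\<sigma> z m\<close> has the point \<open>z m\<close> at both positions \<open>m\<close> and \<open>m + 1\<close>, so it compares the arrangements of
    \<open>z 0, \<dots>, z (n - 2)\<close> that leave position \<open>m + 1\<close> or position \<open>m\<close> free.\<close>
  define \<sigma> where "\<sigma> z m = (\<lambda>k\<in>{..<n}. Q (z (if k \<le> m then k else k - 1)) k)" for z :: "nat \<Rightarrow> nat" and m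
  have \<sigma>U: "\<sigma> z m \<in> tuples n U" for z m unfolding \<sigma>_def by (rule tuplesI) (rule QU)
  note Xind = indep_labelled[of _ "{x \<in> V. col x = _}", folded X_def]
  have XS: "X i c \<subseteq> S" for i c unfolding X_def by (rule labelled_sub)
  \<comment> \<open>Positions m and m + 1 hold copies of one point, so the facets omitting them have
    the same colour.\<close>
  have swap: "\<sigma> z m \<in> H (X m c) \<longleftrightarrow> \<sigma> z m \<in> H (X (Suc m) c)" if m: "Suc m < n" for z m c
  proof -
    have "E m (Suc m) (\<sigma> z m m) (\<sigma> z m (Suc m))" using QE m by (simp add: \<sigma>_def)
    then have D1: "\<sigma> z m \<in> H (D m (Suc m))" "\<sigma> z m \<in> H (D (Suc m) m)"
      using E_iff[OF \<sigma>U] D_comm by auto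
    show ?thesis
    proof
      assume "\<sigma> z m \<in> H (X m c)"
      then have "\<sigma> z m \<in> H (D m (Suc m) \<inter> X m c)" using D1 by (simp add: H_int[OF D_sub XS])
      then show "\<sigma> z m \<in> H (X (Suc m) c)"
        using H_mono[OF D_labelled labelled_sub, of m "Suc m"] m unfolding X_def by auto
    next
      assume "\<sigma> z m \<in> H (X (Suc m) c)"
      then have "\<sigma> z m \<in> H (D (Suc m) m \<inter> X (Suc m) c)" using D1 by (simp add: H_int[OF D_sub XS])
      then show "\<sigma> z m \<in> H (X m c)"
        using H_mono[OF D_labelled labelled_sub, of "Suc m" m] m unfolding X_def by auto
    qed
  qed
  \<comment> \<open>The two tuples differ only at position m + 1, which facet m + 1 omits.\<close>
  have shift: "\<sigma> z m \<in> H (X (Suc m) c) \<longleftrightarrow> \<sigma> z (Suc m) \<in> H (X (Suc m) c)" if m: "Suc m < n" for z m c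
    using indep_H[OF Xind m _ \<sigma>U, of "\<sigma> z m" c z "Suc m"] indep_H[OF Xind m _ \<sigma>U, of "\<sigma> z (Suc m)" c z m]
    by (auto simp: \<sigma>_def)
  have slide: "\<sigma> z m \<in> H (X m c) \<longleftrightarrow> \<sigma> z (n - 2) \<in> H (X (n - 1) c)" if "m \<le> n - 2" for z m c
    using that
  proof (induction m rule: inc_induct)
    case base
    have "Suc (n - 2) = n - 1" using n by simp
    then show ?case using swap[of "n - 2" z c] n by simp
  next
    case (step m)
    then have m: "Suc m < n" by simp
    show ?case using step.IH swap[OF m] shift[OF m] by blast
  qed
  \<comment> \<open>A type either repeats one of its first n - 1 entries or has a coloured last
    facet. This is a finite cover of the unit, and separation of the points excludes the
    repetitions.\<close>
  have coloured: "\<exists>c<N. \<sigma> z (n - 2) \<in> H (X (n - 1) c)" if z: "inj_on z {..<n - 1}" for z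
  proof -
    let ?P = "{(j, k). j < k \<and> k < n - 1}"
    let ?\<X> = "(\<lambda>(j, k). D j k) ` ?P \<union> X (n - 1) ` {..<N}"
    have fin: "finite ?P" by (rule finite_subset[of _ "{..<n} \<times> {..<n}"]) auto
    have "S \<subseteq> \<Union>?\<X>"
    proof
      fix a assume aS: "a \<in> S"
      then obtain L and t :: "nat \<Rightarrow> nat" where a: "a = tp n L t" "range L \<subseteq> V" by (rule S_cases)
      show "a \<in> \<Union>?\<X>"
      proof (cases "nondeg n t (n - 1)")
        case True
        then have "a \<in> X (n - 1) (col (L (facet n t (n - 1))))"
          using aS a(2) by (auto simp: X_def labelled_def a(1) tp_def)
        moreover have "col (L (facet n t (n - 1))) < N" using col a(2) by blast
        ultimately show ?thesis by blast
      next
        case False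
        have "{..<n} - {n - 1} = {..<n - 1}" by auto
        with False obtain j k where jk: "j < n - 1" "k < n - 1" "j \<noteq> k" "t j = t k"
          using n by (auto simp: nondeg_def inj_on_def)
        then have "a \<in> D j k \<and> a \<in> D k j" using aS by (auto simp: D_def a(1) tp_def ker_def)
        then show ?thesis using jk by (cases "j < k") (auto intro!: bexI[of _ "(j, k)"] bexI[of _ "(k, j)"])
      qed
    qed
    moreover have sub: "Y \<subseteq> S" if "Y \<in> ?\<X>" for Y using that D_sub XS by blast
    ultimately have "S = \<Union>?\<X>" by blast
    then have "\<sigma> z (n - 2) \<in> H (\<Union>?\<X>)" using H_all \<sigma>U by auto
    moreover have "H (\<Union>?\<X>) = (\<Union>Y\<in>?\<X>. H Y)"
      by (rule H_Union) (use fin sub in auto)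
    ultimately obtain Y where Y: "Y \<in> ?\<X>" "\<sigma> z (n - 2) \<in> H Y" by auto
    have "\<sigma> z (n - 2) \<notin> H (D j k)" if jk: "j < k" "k < n - 1" for j k
    proof -
      have "z j \<noteq> z k" using z jk by (auto simp: inj_on_def)
      then have "\<not> E j k (\<sigma> z (n - 2) j) (\<sigma> z (n - 2) k)" using QN jk by (auto simp: \<sigma>_def)
      then show ?thesis using E_iff[OF \<sigma>U] by blast
    qed
    then have "Y \<notin> (\<lambda>(j, k). D j k) ` ?P" using Y(2) by auto
    then show ?thesis using Y by auto
  qed
  \<comment> \<open>The first n - 1 positions hold the points indexed by \<open>A\<close> in
    increasing order; position n - 1 repeats the last of them and is omitted by the facet whose
    colour is recorded.\<close>
  define f where "f A = (SOME c. c < N \<and> \<sigma> (\<lambda>k. sorted_list_of_set A ! k) (n - 2) \<in> H (X (n - 1) c))" for A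
  have f: "f A < N \<and> \<sigma> (\<lambda>k. sorted_list_of_set A ! k) (n - 2) \<in> H (X (n - 1) (f A))"
    if "finite A" "card A = n - 1" for A
  proof -
    have "inj_on (\<lambda>k. sorted_list_of_set A ! k) {..<n - 1}"
      by (rule inj_on_nth) (use that in auto)
    from someI_ex[OF coloured[OF this, unfolded Bex_def]] show ?thesis unfolding f_def by simp
  qed
  obtain Y c where Y: "infinite Y" "c < N"
    and c: "\<And>A. A \<subseteq> Y \<Longrightarrow> finite A \<Longrightarrow> card A = n - 1 \<Longrightarrow> f A = c"
    using Ramsey[of UNIV "n - 1" f N] f by auto
  obtain B where B: "finite B" "card B = n" "B \<subseteq> Y"
    using infinite_arbitrarily_large[OF Y(1)] by blast
  define y where "y k = sorted_list_of_set B ! k" for k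
  have y_mono: "y i < y j" if "i < j" "j < n" for i j
    unfolding y_def by (rule sorted_wrt_nth_less[OF strict_sorted_list_of_set]) (use that B in auto)
  have yB: "y k \<in> B" if "k < n" for k
    using nth_mem[of k "sorted_list_of_set B"] that B unfolding y_def by simp
  define s where "s = (\<lambda>k\<in>{..<n}. Q (y k) k)"
  have sU: "s \<in> tuples n U" unfolding s_def by (rule tuplesI) (rule QU)
  have key: "s \<in> H (X i c)" if i: "i < n" for i
  proof -
    \<comment> \<open>The n - 1 indices left after removing \<open>y i\<close>, in increasing order.
      For i < n - 1 the tuple \<open>\<sigma> z i\<close> agrees with \<open>s\<close> except at
      position i; for i = n - 1 the tuple \<open>\<sigma> z (n - 2)\<close> does.\<close>
    define z where "z k = y (if k < i then k else Suc k)" for k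
    define zs where "zs = map z [0..<n - 1]"
    have zB: "set zs \<subseteq> B" using yB i by (auto simp: zs_def z_def)
    have "sorted_wrt (<) zs"
      unfolding sorted_wrt_iff_nth_less zs_def using y_mono i by (auto simp: z_def)
    then have srt: "sorted_list_of_set (set zs) = zs" "distinct zs"
      by (auto simp: strict_sorted_iff sorted_list_of_set.idem_if_sorted_distinct)
    have "card (set zs) = n - 1" using distinct_card[OF srt(2)] by (simp add: zs_def)
    then have "\<sigma> (\<lambda>k. zs ! k) (n - 2) \<in> H (X (n - 1) c)"
      using f[of "set zs"] c[of "set zs"] zB B(3) srt(1) by auto
    moreover have "\<sigma> (\<lambda>k. zs ! k) (n - 2) = \<sigma> z (n - 2)"
      using n by (auto simp: \<sigma>_def zs_def fun_eq_iff)
    ultimately have last: "\<sigma> z (n - 2) \<in> H (X (n - 1) c)" by simp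
    show ?thesis
    proof (cases "i = n - 1")
      case True
      show ?thesis unfolding True
        by (rule indep_H[OF Xind _ last sU]) (use n True in \<open>auto simp: \<sigma>_def s_def z_def\<close>)
    next
      case False
      then have "\<sigma> z i \<in> H (X i c)" using slide[of i z c] last i by simp
      then show ?thesis
        by (rule indep_H[OF Xind i _ sU]) (use n False in \<open>auto simp: \<sigma>_def s_def z_def\<close>)
    qed
  qed
  have "s \<in> H (\<Inter>i\<in>{..<n}. X i c)"
    by (rule H_Inter) (use n XS key in auto)
  moreover have "(\<Inter>i\<in>{..<n}. X i c) = {}"
  proof (rule ccontr)
    assume "(\<Inter>i\<in>{..<n}. X i c) \<noteq> {}"
    then obtain a where a: "\<And>i. i < n \<Longrightarrow> a \<in> X i c" by auto
    then have "a \<in> S" using XS n by blast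
    then obtain L and t :: "nat \<Rightarrow> nat" where at: "a = tp n L t" "range L \<subseteq> V" "linked_facets n adj L t"
      by (rule S_cases)
    have nd: "nondeg n t i" "col (L (facet n t i)) = c" if "i < n" for i
      using a[OF that] by (auto simp: at X_def labelled_def tp_def split: if_splits)
    have "inj_on t {..<n}"
    proof (rule inj_onI)
      fix i j assume ij: "i \<in> {..<n}" "j \<in> {..<n}" "t i = t j"
      \<comment> \<open>A third index exists because \<open>2 < n\<close>; nondegeneracy there
        separates entries i and j.\<close>
      obtain k where "k < n" "k \<noteq> i" "k \<noteq> j"
      proof -
        have "card {i, j} \<le> 2" by (cases "i = j") auto
        then have "\<not> {..<n} \<subseteq> {i, j}" using card_mono[of "{i, j}" "{..<n}"] n by auto
        then show thesis using that by blast
      qed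
      then show "i = j" using nd(1)[of k] ij by (auto simp: nondeg_def inj_on_def)
    qed
    then obtain i j where "i < n" "j < n" "adj (L (facet n t i)) (L (facet n t j))"
      using at(3) by (auto simp: linked_facets_def)
    then show False using nd(2) proper at(2) by (metis rangeI subsetD)
  qed
  ultimately show False using H_empty by simp
qed

end

lemma typs_ex:
  assumes n: "2 < n" and xy: "x \<in> V" "y \<in> V" "adj x y"
  shows "\<exists>a\<in>typs n V adj. snd a 0 = Some x"
proof -
  define L where "L F = (if F = facet n id 0 then x else y)" for F :: "nat set"
  have "facet n id i = {..<n} - {i}" for i by (simp add: facet_def)
  moreover have "0 \<in> {..<n} - {1}" using n by simp
  ultimately have "facet n id 1 \<noteq> facet n id 0" by blast
  then have L: "L (facet n id 0) = x" "L (facet n id 1) = y" by (simp_all add: L_def)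
  have "linked_facets n adj L id"
    unfolding linked_facets_def using L xy(3) n by (intro impI exI[of _ 0] exI[of _ 1] conjI) auto
  moreover have "range L \<subseteq> V" using xy by (auto simp: L_def)
  ultimately have "tp n L id \<in> typs n V adj" by (intro tp_typs)
  moreover have "snd (tp n L id) 0 = Some x" using n L by (simp add: tp_def nondeg_def)
  ultimately show ?thesis by blast
qed

text \<open>The set of types with a label on facet 0 is nonempty, so an embedding into a product
  separates it from zero in some coordinate, against \<open>no_finite_colouring\<close>.\<close>

lemma not_representable_eta:
  fixes V :: "'v set" and col :: "'v \<Rightarrow> nat"
  assumes n: "2 < n" and inf: "infinite V" and noiso: "\<And>x. x \<in> V \<Longrightarrow> \<exists>y\<in>V. adj x y"
    and col: "\<And>x. x \<in> V \<Longrightarrow> col x < N"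
    and proper: "\<And>x y. x \<in> V \<Longrightarrow> y \<in> V \<Longrightarrow> adj x y \<Longrightarrow> col x \<noteq> col y"
  shows "\<not> representable T n (Cm (eta n V adj))"
proof
  let ?S = "typs n V adj" and ?A = "Cm (eta n V adj)"
  assume "representable T n ?A"
  then obtain I :: "('v tuple_type set \<times> 'v tuple_type set) set" and
      U :: "'v tuple_type set \<times> 'v tuple_type set \<Rightarrow> nat \<Rightarrow> (nat + 'v tuple_type set) list set" and h
    where emb: "alg_embedding T n ?A (prod_alg I (\<lambda>k. set_alg n (U k))) h"
    unfolding representable_def by blast
  have cl: "\<forall>a\<in>Carr ?A. Compl ?A a \<in> Carr ?A" "\<forall>a\<in>Carr ?A. \<forall>b\<in>Carr ?A. Join ?A a b \<in> Carr ?A \<and> Meet ?A a b \<in> Carr ?A"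
    "\<forall>f\<in>uops T n. \<forall>a\<in>Carr ?A. Oper ?A f a \<in> Carr ?A" "\<forall>(i,j)\<in>diags T n. Diag ?A i j \<in> Carr ?A"
    and zo: "Zero ?A \<in> Carr ?A" "One ?A \<in> Carr ?A"
    using Cm_algebra[of T n "eta n V adj"] by (auto simp: algebra_of_type_def boolean_def)
  have h: "alg_hom T n ?A (prod_alg I (\<lambda>k. set_alg n (U k))) h" "inj_on h (Carr ?A)"
    using emb by (auto simp: alg_embedding_def)
  have hext: "\<forall>a\<in>Carr ?A. h a \<in> extensional I"
    using h(1) by (auto simp: alg_hom_def prod_alg_def PiE_def)
  have hk: "alg_hom T n ?A (set_alg n (U k)) (\<lambda>a. h a k)" if "k \<in> I" for k
    using h(1) that alg_hom_prod_iff[of ?A h I T n "\<lambda>k. set_alg n (U k)", OF hext _ _ cl] hext zo by simp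
  define A0 where "A0 = {a \<in> ?S. \<exists>v\<in>V. snd a 0 = Some v}"
  obtain x where x: "x \<in> V" using infinite_imp_nonempty[OF inf] by blast
  obtain y where y: "y \<in> V" "adj x y" using noiso[OF x] by blast
  have "A0 \<noteq> {}" unfolding A0_def using typs_ex[of n x V y adj] n x y by blast
  moreover have A0: "A0 \<in> Carr ?A" "{} \<in> Carr ?A" by (auto simp: A0_def Cm_def eta_def)
  ultimately have "h A0 \<noteq> h {}" using h(2) by (auto simp: inj_on_def)
  then obtain k where k: "k \<in> I" "h A0 k \<noteq> h {} k"
    using hext A0 by (metis extensionalityI)
  define H where "H = (\<lambda>X. h X k)"
  have hom: "alg_hom T n ?A (set_alg n (U k)) H" using hk[OF k(1)] by (simp add: H_def)
  have C: "X \<in> Carr ?A \<longleftrightarrow> X \<subseteq> ?S" for X by (simp add: Cm_def eta_def)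
  interpret df_hom n V adj "U k" H
  proof
    show "2 < n" by (rule n)
    show "H (X \<union> Y) = H X \<union> H Y" "H (X \<inter> Y) = H X \<inter> H Y" if "X \<subseteq> ?S" "Y \<subseteq> ?S" for X Y
    proof -
      have "H (Join ?A X Y) = Join (set_alg n (U k)) (H X) (H Y) \<and> H (Meet ?A X Y) = Meet (set_alg n (U k)) (H X) (H Y)"
        using hom that[folded C] unfolding alg_hom_def by blast
      then show "H (X \<union> Y) = H X \<union> H Y" "H (X \<inter> Y) = H X \<inter> H Y" by (simp_all add: Cm_def set_alg_def)
    qed
    show "H {} = {}" "H ?S = tuples n (U k)"
      using hom unfolding alg_hom_def by (simp_all add: Cm_def set_alg_def eta_def)
    show "H {a \<in> ?S. \<exists>b\<in>X. face i a = face i b} = set_op n (tuples n (U k)) (Cyl i) (H X)"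
      if i: "i < n" and X: "X \<subseteq> ?S" for i X
    proof -
      have "Cyl i \<in> uops T n" using i by (simp add: uops_def)
      then have "H (Oper ?A (Cyl i) X) = Oper (set_alg n (U k)) (Cyl i) (H X)"
        using hom X[folded C] unfolding alg_hom_def by blast
      then show ?thesis by (simp add: Cm_def set_alg_def eta_def)
    qed
  qed
  have "H A0 = {}"
    using no_finite_colouring[of col N, OF inf noiso col proper] unfolding labelled_def A0_def by simp
  then show False using k(2) H_empty by (simp add: H_def)
qed

section \<open>Graphs of infinite chromatic number\<close>

text \<open>\<open>linked adj F F\<close> says that no set in \<open>F\<close> is
  independent.\<close>

definition linked :: "('v \<Rightarrow> 'v \<Rightarrow> bool) \<Rightarrow> 'v filter \<Rightarrow> 'v filter \<Rightarrow> bool" where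
  "linked adj F G \<longleftrightarrow> (\<forall>P Q. eventually P F \<longrightarrow> eventually Q G \<longrightarrow> (\<exists>x y. P x \<and> Q y \<and> adj x y))"

lemma linked_sym: "(\<And>x y. adj x y \<Longrightarrow> adj y x) \<Longrightarrow> linked adj F G \<Longrightarrow> linked adj G F"
  unfolding linked_def by blast

text \<open>Conditions on different coordinates are independent, and linkage of the distinct
  coordinates \<open>p\<close> and \<open>q\<close> makes them compatible with the edge. Refining to
  an ultrafilter keeps the projections by minimality.\<close>

lemma joint_ultra:
  fixes \<mu> :: "'i \<Rightarrow> 'v filter"
  assumes N: "finite N" "\<And>u. u \<in> N \<Longrightarrow> ultra (\<mu> u)"
    and pq: "p \<in> N" "q \<in> N" "p \<noteq> q" "linked adj (\<mu> p) (\<mu> q)"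
  shows "\<exists>\<rho>. ultra \<rho> \<and> (\<forall>u\<in>N. filtermap (\<lambda>g. g u) \<rho> = \<mu> u) \<and> eventually (\<lambda>g. adj (g p) (g q)) \<rho>"
proof -
  define F where "F = inf (INF u\<in>N. filtercomap (\<lambda>g. g u) (\<mu> u)) (principal {g. adj (g p) (g q)})"
  have "F \<noteq> bot"
  proof
    assume "F = bot"
    then have "eventually (\<lambda>g. \<not> adj (g p) (g q)) (INF u\<in>N. filtercomap (\<lambda>g. g u) (\<mu> u))"
      by (simp add: F_def trivial_limit_def eventually_inf_principal)
    then obtain Q where Q: "\<And>u. u \<in> N \<Longrightarrow> eventually (Q u) (filtercomap (\<lambda>g. g u) (\<mu> u))"
      and bad: "\<And>g. (\<And>u. u \<in> N \<Longrightarrow> Q u g) \<Longrightarrow> \<not> adj (g p) (g q)"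
      unfolding eventually_INF_finite[OF N(1)] by blast
    have "\<forall>u\<in>N. \<exists>R. eventually R (\<mu> u) \<and> (\<forall>g. R (g u) \<longrightarrow> Q u g)"
      using Q unfolding eventually_filtercomap by blast
    then obtain R where R: "\<And>u. u \<in> N \<Longrightarrow> eventually (R u) (\<mu> u)"
      "\<And>u g. u \<in> N \<Longrightarrow> R u (g u) \<Longrightarrow> Q u g" by metis
    obtain x y where xy: "R p x" "R q y" "adj x y"
      using pq(4) R(1) pq(1,2) unfolding linked_def by blast
    have "\<exists>z. R u z" if "u \<in> N" for u
      using eventually_happens[OF R(1)[OF that]] N(2)[OF that] by (auto simp: ultra_def)
    then obtain z where z: "\<And>u. u \<in> N \<Longrightarrow> R u (z u)" by metis
    have "\<not> adj ((z(p := x, q := y)) p) ((z(p := x, q := y)) q)"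
      by (rule bad, rule R(2)) (use z xy in auto)
    then show False using xy pq(3) by simp
  qed
  then obtain \<rho> where \<rho>: "ultra \<rho>" "\<rho> \<le> F" using ultra_ex by blast
  have "filtermap (\<lambda>g. g u) \<rho> = \<mu> u" if "u \<in> N" for u
  proof (rule ultra_minimal[OF N(2)[OF that]])
    show "filtermap (\<lambda>g. g u) \<rho> \<noteq> bot" using \<rho>(1) by (simp add: ultra_def filtermap_bot_iff)
    have "\<rho> \<le> filtercomap (\<lambda>g. g u) (\<mu> u)"
      using \<rho>(2) that unfolding F_def by (meson INF_lower inf.bounded_iff order.trans)
    then show "filtermap (\<lambda>g. g u) \<rho> \<le> \<mu> u" by (simp add: filtermap_le_iff_le_filtercomap)
  qed
  moreover have "eventually (\<lambda>g. adj (g p) (g q)) \<rho>"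
    by (rule filter_leD[OF \<rho>(2)]) (simp add: F_def eventually_inf_principal)
  ultimately show ?thesis using \<rho>(1) by blast
qed

text \<open>\<open>Ext i ss \<mu> B\<close> is a new point extending the facet \<open>{ss ! k | k \<noteq> i}\<close>, whose label is the
  ultrafilter \<open>\<mu>\<close>, to an \<open>n\<close>-set: when the label of that facet is \<open>v\<close>, the label of the facet
  omitting \<open>ss ! k\<close> is \<open>B v k\<close>. The entry \<open>ss ! i\<close> is irrelevant.\<close>

datatype 'v pt = Base nat | Ext nat "'v pt list" "'v filter" "'v \<Rightarrow> nat \<Rightarrow> 'v"

lemma size_Ext: "x \<in> set ss \<Longrightarrow> size x < size (Ext i ss \<mu> B)"
  by (simp add: less_Suc_eq_le size_list_estimation')

section \<open>The latest point of a finite set\<close>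

definition pt_order :: "'v pt rel" where
  "pt_order = (SOME r. Well_order r \<and> Field r = UNIV)"

lemma pt_order: "wo_rel (pt_order :: 'v pt rel)" "Field (pt_order :: 'v pt rel) = UNIV"
proof -
  have "Well_order (pt_order :: 'v pt rel) \<and> Field (pt_order :: 'v pt rel) = UNIV"
    unfolding pt_order_def by (rule someI_ex[OF well_ordering])
  then show "wo_rel (pt_order :: 'v pt rel)" "Field (pt_order :: 'v pt rel) = UNIV"
    unfolding wo_rel_def by blast+
qed

lemma pt_order_total:
  fixes x y :: "'v pt"
  shows "(x, y) \<in> pt_order \<or> (y, x) \<in> pt_order"
  using wo_rel.TOTALS[OF pt_order(1)[where 'v = 'v]] by (simp add: pt_order(2))

lemma pt_order_trans: "(x, y) \<in> pt_order \<Longrightarrow> (y, z) \<in> pt_order \<Longrightarrow> (x, z) \<in> pt_order"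
  by (rule transD[OF wo_rel.TRANS[OF pt_order(1)]])

lemma pt_order_antisym: "(x, y) \<in> pt_order \<Longrightarrow> (y, x) \<in> pt_order \<Longrightarrow> x = y"
  by (rule antisymD[OF wo_rel.ANTISYM[OF pt_order(1)]])

definition leads :: "'v pt set \<Rightarrow> 'v pt \<Rightarrow> bool" where
  "leads H z \<longleftrightarrow> z \<in> H \<and> (\<forall>y\<in>H. size y < size z \<or> size y = size z \<and> (y, z) \<in> pt_order)"

text \<open>The point regarded as added last; its data decide the label of \<open>H\<close>. Entries
  of \<open>Ext\<close> are smaller, hence earlier, than the point itself, and
  \<open>pt_order\<close> breaks ties.\<close>

definition lead :: "'v pt set \<Rightarrow> 'v pt" where
  "lead H = (THE z. leads H z)"

lemma leads_unique:
  assumes "leads H z" "leads H z'"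
  shows "z = z'"
proof -
  have "size z < size z' \<or> size z = size z' \<and> (z, z') \<in> pt_order"
    "size z' < size z \<or> size z' = size z \<and> (z', z) \<in> pt_order"
    using assms unfolding leads_def by blast+
  then show ?thesis using pt_order_antisym[of z z'] by auto
qed

lemma leads_ex: "finite H \<Longrightarrow> H \<noteq> {} \<Longrightarrow> \<exists>z. leads H z"
proof (induction H rule: finite_ne_induct)
  case (singleton x)
  then show ?case unfolding leads_def using pt_order_total by auto
next
  case (insert x H)
  then obtain z where z: "z \<in> H" "\<And>y. y \<in> H \<Longrightarrow> size y < size z \<or> size y = size z \<and> (y, z) \<in> pt_order"
    unfolding leads_def by blast
  show ?case
  proof (cases "size x < size z \<or> size x = size z \<and> (x, z) \<in> pt_order")
    case True
    then have "leads (insert x H) z" using z unfolding leads_def by blast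
    then show ?thesis by blast
  next
    case False
    then have xz: "size z < size x \<or> size z = size x \<and> (z, x) \<in> pt_order"
      using pt_order_total by (metis linorder_neqE_nat)
    have "size y < size x \<or> size y = size x \<and> (y, x) \<in> pt_order" if "y \<in> H" for y
      using z(2)[OF that] xz pt_order_trans[of y z x] by auto
    then have "leads (insert x H) x" using pt_order_total unfolding leads_def by blast
    then show ?thesis by blast
  qed
qed

lemma lead_eq: "leads H z \<Longrightarrow> lead H = z"
  unfolding lead_def using leads_unique by blast

lemma lead_in: "finite H \<Longrightarrow> H \<noteq> {} \<Longrightarrow> lead H \<in> H"
  using leads_ex lead_eq unfolding leads_def by metis

lemma lead_subset:
  assumes "finite H" "H' \<subseteq> H" "lead H \<in> H'"
  shows "lead H' = lead H"
proof -
  have "H \<noteq> {}" using assms by blast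
  then have "leads H (lead H)" using leads_ex[OF assms(1)] lead_eq by metis
  then have "leads H' (lead H)" using assms unfolding leads_def by blast
  then show ?thesis by (rule lead_eq)
qed

lemma lead_insert:
  assumes "\<And>y. y \<in> H \<Longrightarrow> size y < size z"
  shows "lead (insert z H) = z"
proof (rule lead_eq)
  show "leads (insert z H) z" using assms pt_order_total unfolding leads_def by blast
qed

lemma card_facet: "nondeg n t i \<Longrightarrow> card (facet n t i) = n - 1"
  unfolding nondeg_def facet_def by (auto simp: card_image)

lemma facet_sub: "facet n t i \<subseteq> t ` {..<n}"
  unfolding facet_def by blast

lemma facet_inj: "inj_on t {..<n} \<Longrightarrow> i < n \<Longrightarrow> facet n t i = t ` {..<n} - {t i}"
  unfolding facet_def by (auto simp: inj_on_def)

text \<open>The type of a tuple with at most n - 1 distinct entries sees a single label at most,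
  that of the whole range.\<close>

lemma facet_eq_range:
  assumes "nondeg n t i" "card (t ` {..<n}) \<le> n - 1"
  shows "facet n t i = t ` {..<n}"
  using card_facet[OF assms(1)] assms(2) facet_sub[of n t i] by (intro card_seteq) auto

lemma card_not_inj:
  assumes "\<not> inj_on t {..<n}"
  shows "card (t ` {..<n}) \<le> n - 1"
  using assms card_image_le[of "{..<n}" t] eq_card_imp_inj_on[of "{..<n}" t] by force

lemma face_tp: "face i (tp n L t) = ({(j, k) \<in> ker n t. j \<noteq> i \<and> k \<noteq> i},
    if nondeg n t i then Some (L (facet n t i)) else None)"
  by (simp add: face_def tp_def)

text \<open>\<open>far\<close> speaks of fewer than n ultrafilters because a point prescribes at
  most n - 1 labels; \<open>\<delta>\<close> will label the sets that the point leads without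
  prescribing them.\<close>

locale palette =
  fixes n :: nat and adj :: "'v \<Rightarrow> 'v \<Rightarrow> bool"
  assumes n: "2 < n" and sym: "adj x y \<Longrightarrow> adj y x" and noiso: "\<exists>y. adj x y"
    and far: "finite M \<Longrightarrow> card M < n \<Longrightarrow> (\<And>\<mu>. \<mu> \<in> M \<Longrightarrow> ultra \<mu>) \<Longrightarrow>
      \<exists>\<delta>. ultra \<delta> \<and> linked adj \<delta> \<delta> \<and> (\<forall>\<mu>\<in>M. linked adj \<delta> \<mu>)"
begin

section \<open>Labels of (n-1)-sets of points\<close>

fun plabel :: "'v pt \<Rightarrow> nat \<Rightarrow> 'v filter" where
  "plabel (Base m) k = bot"
| "plabel (Ext i ss \<mu> B) k = filtermap (\<lambda>v. B v k) \<mu>"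

fun dims :: "'v pt \<Rightarrow> nat set" where
  "dims (Base m) = {}"
| "dims (Ext i ss \<mu> B) = {..<n} - {i}"

fun entries :: "'v pt \<Rightarrow> nat \<Rightarrow> 'v pt" where
  "entries (Base m) k = Base m"
| "entries (Ext i ss \<mu> B) k = ss ! k"

lemma entries_Ext: "entries (Ext i ss \<mu> B) = nth ss"
  by (simp add: fun_eq_iff)

text \<open>\<open>H\<close> is the facet omitting entry k in the n-set that \<open>z\<close> was
  created to complete.\<close>

definition attached :: "'v pt \<Rightarrow> nat \<Rightarrow> 'v pt set \<Rightarrow> bool" where
  "attached z k H \<longleftrightarrow> k \<in> dims z \<and> H = insert z (entries z ` (dims z - {k}))"

text \<open>One choice per point, shared by all sets that it leads without prescribing them. Two
  such facets of an n-set are linked because the ultrafilter is linked to itself.\<close>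

definition far_label :: "'v pt \<Rightarrow> 'v filter" where
  "far_label z = (SOME \<delta>. ultra \<delta> \<and> linked adj \<delta> \<delta> \<and> (\<forall>k\<in>dims z. linked adj \<delta> (plabel z k)))"

definition label :: "'v pt set \<Rightarrow> 'v filter" where
  "label H = (if \<exists>k. attached (lead H) k H then plabel (lead H) (SOME k. attached (lead H) k H)
     else far_label (lead H))"

text \<open>\<open>Ext\<close> stores its ultrafilter, so \<open>label\<close> is explicit rather
  than recursive; membership demands that the stored ultrafilter is the actual label of the extended
  facet. The update at i inserts \<open>v\<close>, the label of the facet omitting the new point,
  and the last condition makes the new n-set satisfy adjacency almost everywhere.\<close>

inductive_set pts :: "'v pt set" where
  Base: "Base m \<in> pts"
| Ext: "(\<And>x. x \<in> set ss \<Longrightarrow> x \<in> pts) \<Longrightarrow> length ss = n \<Longrightarrow> i < n \<Longrightarrow> inj_on (nth ss) ({..<n} - {i}) \<Longrightarrow>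
     \<forall>\<^sub>F v in label (facet n (nth ss) i). \<exists>j<n. \<exists>k<n. adj (((B v)(i := v)) j) (((B v)(i := v)) k) \<Longrightarrow>
     Ext i ss (label (facet n (nth ss) i)) B \<in> pts"

lemma far_label:
  assumes "\<And>k. k \<in> dims z \<Longrightarrow> ultra (plabel z k)" "card (dims z) < n"
  shows "ultra (far_label z)" "linked adj (far_label z) (far_label z)"
    "k \<in> dims z \<Longrightarrow> linked adj (far_label z) (plabel z k)"
proof -
  have fin: "finite (dims z)" by (cases z) auto
  have "\<exists>\<delta>. ultra \<delta> \<and> linked adj \<delta> \<delta> \<and> (\<forall>\<mu>\<in>plabel z ` dims z. linked adj \<delta> \<mu>)"
    by (rule far) (use assms fin card_image_le[OF fin, of "plabel z"] in auto)
  then have "\<exists>\<delta>. ultra \<delta> \<and> linked adj \<delta> \<delta> \<and> (\<forall>k\<in>dims z. linked adj \<delta> (plabel z k))" by blast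
  from someI_ex[OF this, folded far_label_def]
  show "ultra (far_label z)" "linked adj (far_label z) (far_label z)"
    "k \<in> dims z \<Longrightarrow> linked adj (far_label z) (plabel z k)" by blast+
qed

lemma card_dims: "z \<in> pts \<Longrightarrow> card (dims z) < n"
  by (erule pts.cases) (use n in auto)

lemma facet_pts:
  assumes "set ss \<subseteq> pts" "length ss = n"
  shows "facet n (nth ss) i \<subseteq> set ss" "finite (facet n (nth ss) i)" "facet n (nth ss) i \<noteq> {}"
proof -
  show "facet n (nth ss) i \<subseteq> set ss" "finite (facet n (nth ss) i)"
    using assms unfolding facet_def by auto
  have "(if i = 0 then 1 else 0) \<in> {..<n} - {i}" using n by auto
  then show "facet n (nth ss) i \<noteq> {}" unfolding facet_def by blast
qed

lemma ultra_label_cases: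
  assumes H: "lead H = z" and pl: "\<And>k. k \<in> dims z \<Longrightarrow> ultra (plabel z k)" and fl: "ultra (far_label z)"
  shows "ultra (label H)"
proof (cases "\<exists>k. attached z k H")
  case True
  then have "attached z (SOME k. attached z k H) H" by (rule someI_ex)
  then have "(SOME k. attached z k H) \<in> dims z" unfolding attached_def by blast
  from pl[OF this] show ?thesis unfolding label_def H using True by simp
next
  case False
  then show ?thesis unfolding label_def H using fl by simp
qed

text \<open>Induction on the construction of points: prescribed labels are images of the label of a
  facet led by an earlier point, and there are fewer than n of them, so \<open>far\<close>
  applies.\<close>

lemma ultra_label_lead: "z \<in> pts \<Longrightarrow> lead H = z \<Longrightarrow> ultra (label H)"
  and ultra_plabel: "z \<in> pts \<Longrightarrow> k \<in> dims z \<Longrightarrow> ultra (plabel z k)"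
proof -
  have *: "(\<forall>H. lead H = z \<longrightarrow> ultra (label H)) \<and> (\<forall>k\<in>dims z. ultra (plabel z k))" if "z \<in> pts" for z
    using that
  proof (induction rule: pts.induct)
    case (Base m)
    show ?case using far_label(1)[of "Base m"] n by (simp add: label_def attached_def)
  next
    case (Ext ss i B)
    let ?F = "facet n (nth ss) i"
    let ?z = "Ext i ss (label ?F) B"
    have "set ss \<subseteq> pts" using Ext.hyps(1) by blast
    then have "lead ?F \<in> set ss" using facet_pts[of ss i] Ext.hyps lead_in by blast
    then have "ultra (label ?F)" using Ext.IH by blast
    then have pl: "ultra (plabel ?z k)" if "k \<in> dims ?z" for k by (simp add: ultra_filtermap)
    have "card (dims ?z) < n" using Ext.hyps n by simp
    then have fl: "ultra (far_label ?z)" using far_label(1)[of ?z] pl by blast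
    then show ?case using pl ultra_label_cases[of _ ?z] by blast
  qed
  show "z \<in> pts \<Longrightarrow> lead H = z \<Longrightarrow> ultra (label H)" "z \<in> pts \<Longrightarrow> k \<in> dims z \<Longrightarrow> ultra (plabel z k)"
    using * by blast+
qed

lemma ultra_label: "finite H \<Longrightarrow> H \<noteq> {} \<Longrightarrow> H \<subseteq> pts \<Longrightarrow> ultra (label H)"
  using ultra_label_lead[OF _ refl, of H] lead_in by blast

lemma pts_far_label:
  assumes "z \<in> pts"
  shows "linked adj (far_label z) (far_label z)" "k \<in> dims z \<Longrightarrow> linked adj (far_label z) (plabel z k)"
  using far_label(2,3)[OF ultra_plabel[OF assms] card_dims[OF assms]] by blast+

lemma pts_entries:
  assumes "z \<in> pts"
  shows "entries z ` dims z \<subseteq> pts" "inj_on (entries z) (dims z)"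
    "k \<in> dims z \<Longrightarrow> size (entries z k) < size z" "dims z \<noteq> {} \<Longrightarrow> card (dims z) = n - 1"
proof -
  have "entries z ` dims z \<subseteq> pts \<and> inj_on (entries z) (dims z) \<and> (\<forall>k\<in>dims z. size (entries z k) < size z)
      \<and> (dims z \<noteq> {} \<longrightarrow> card (dims z) = n - 1)"
    using assms
  proof (cases rule: pts.cases)
    case (Ext ss i B)
    have "size (ss ! k) < size z" if "k < n" for k
      unfolding Ext(1) by (rule size_Ext) (use that Ext in simp)
    then show ?thesis using Ext by (auto simp: subset_iff entries_Ext simp del: entries.simps)
  qed simp
  then show "entries z ` dims z \<subseteq> pts" "inj_on (entries z) (dims z)"
    "k \<in> dims z \<Longrightarrow> size (entries z k) < size z" "dims z \<noteq> {} \<Longrightarrow> card (dims z) = n - 1" by blast+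
qed

lemma attached_unique:
  assumes "z \<in> pts" "attached z k H" "attached z k' H"
  shows "k = k'"
proof (rule ccontr)
  assume "k \<noteq> k'"
  then have "entries z k \<in> H" using assms unfolding attached_def by blast
  moreover have "entries z k \<noteq> z" using pts_entries(3)[OF assms(1), of k] assms(2) unfolding attached_def by force
  ultimately have "entries z k \<in> entries z ` (dims z - {k})" using assms(2) unfolding attached_def by blast
  then show False using pts_entries(2)[OF assms(1)] assms(2) unfolding attached_def inj_on_def by blast
qed

lemma attached_lead:
  assumes "z \<in> pts" "attached z k H"
  shows "lead H = z"
  using assms(2) lead_insert[of "entries z ` (dims z - {k})" z] pts_entries(3)[OF assms(1)]
  unfolding attached_def by blast

lemma label_attached:
  assumes "z \<in> pts" "attached z k H"
  shows "label H = plabel z k"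
proof -
  have "(SOME k. attached z k H) = k"
    by (rule some_equality) (use assms attached_unique in blast)+
  then show ?thesis using assms(2) unfolding label_def attached_lead[OF assms] by auto
qed

lemma label_far: "(\<And>k. \<not> attached (lead H) k H) \<Longrightarrow> label H = far_label (lead H)"
  unfolding label_def by simp

section \<open>Ultrafilters on the labellings of n-sets\<close>

definition full :: "'v pt \<Rightarrow> 'v pt set" where
  "full z = insert z (entries z ` dims z)"

lemma attached_full: "attached z k H \<Longrightarrow> H \<subseteq> full z"
  unfolding attached_def full_def by blast

definition good_joint :: "'v pt set \<Rightarrow> ('v pt set \<Rightarrow> 'v) filter \<Rightarrow> bool" where
  "good_joint N \<rho> \<longleftrightarrow> ultra \<rho> \<and> (\<forall>u\<in>N. filtermap (\<lambda>L. L (N - {u})) \<rho> = label (N - {u}))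
     \<and> (\<forall>\<^sub>F L in \<rho>. \<exists>u\<in>N. \<exists>w\<in>N. adj (L (N - {u})) (L (N - {w})))"

text \<open>Two facets containing \<open>lead N\<close> are compared. If both were prescribed, their
  union \<open>N\<close> would equal \<open>full (lead N)\<close> by cardinality. So one of them has
  the far label, which is linked to the other label in every case.\<close>

lemma good_joint_ex:
  assumes N: "N \<subseteq> pts" "card N = n" and nf: "N \<noteq> full (lead N)"
  shows "\<exists>\<rho>. good_joint N \<rho>"
proof -
  have fin: "finite N" and ne: "N \<noteq> {}" using N(2) n card.infinite by force+
  let ?z = "lead N"
  have z: "?z \<in> N" "?z \<in> pts" using lead_in[OF fin ne] N(1) by blast+
  have "\<not> N \<subseteq> {?z}" using card_mono[of "{?z}" N] N(2) n by auto
  then obtain u where u: "u \<in> N" "u \<noteq> ?z" by blast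
  have "card {?z, u} \<le> 2" by (cases "?z = u") auto
  then have "\<not> N \<subseteq> {?z, u}" using card_mono[of "{?z, u}" N] N(2) n by auto
  then obtain w where w: "w \<in> N" "w \<noteq> ?z" "w \<noteq> u" by blast
  have lead: "lead (N - {x}) = ?z" if "x \<noteq> ?z" for x
    by (rule lead_subset[OF fin]) (use z that in auto)
  have lk: "linked adj (label (N - {u})) (label (N - {w}))"
  proof (cases "\<exists>k. attached ?z k (N - {u})")
    case True
    then obtain k where k: "attached ?z k (N - {u})" by blast
    have "\<not> attached ?z k' (N - {w})" for k'
    proof
      assume k': "attached ?z k' (N - {w})"
      have sub: "N \<subseteq> full ?z"
        using attached_full[OF k] attached_full[OF k'] w(3) by blast
      have "dims ?z \<noteq> {}" using k unfolding attached_def by blast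
      then have "card (dims ?z) = n - 1" by (rule pts_entries(4)[OF z(2)])
      moreover have fd: "finite (dims ?z)" by (cases ?z) auto
      ultimately have "card (full ?z) \<le> n"
        using n card_image_le[of "dims ?z" "entries ?z"]
          card_insert_if[of "entries ?z ` dims ?z" ?z] unfolding full_def by auto
      moreover have "finite (full ?z)" unfolding full_def using fd by simp
      ultimately have "N = full ?z" using sub N(2) by (intro card_seteq) auto
      then show False using nf by simp
    qed
    then have "label (N - {w}) = far_label ?z" using label_far[of "N - {w}"] lead[OF w(2)] by simp
    moreover have "label (N - {u}) = plabel ?z k" by (rule label_attached[OF z(2) k])
    ultimately show ?thesis
      using pts_far_label(2)[OF z(2), of k] k linked_sym[OF sym] unfolding attached_def by simp
  next
    case False
    then have 1: "label (N - {u}) = far_label ?z" using label_far[of "N - {u}"] lead[OF u(2)] by simp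
    show ?thesis
    proof (cases "\<exists>k. attached ?z k (N - {w})")
      case True
      then obtain k where k: "attached ?z k (N - {w})" by blast
      then show ?thesis using 1 label_attached[OF z(2) k] pts_far_label(2)[OF z(2), of k]
        unfolding attached_def by simp
    next
      case False
      then have "label (N - {w}) = far_label ?z" using label_far[of "N - {w}"] lead[OF w(2)] by simp
      then show ?thesis using 1 pts_far_label(1)[OF z(2)] by simp
    qed
  qed
  obtain \<rho> where \<rho>: "ultra \<rho>" "\<And>F. F \<in> (\<lambda>u. N - {u}) ` N \<Longrightarrow> filtermap (\<lambda>L. L F) \<rho> = label F"
      "\<forall>\<^sub>F L in \<rho>. adj (L (N - {u})) (L (N - {w}))"
  proof -
    have "\<exists>\<rho>. ultra \<rho> \<and> (\<forall>F\<in>(\<lambda>u. N - {u}) ` N. filtermap (\<lambda>L. L F) \<rho> = label F)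
      \<and> (\<forall>\<^sub>F L in \<rho>. adj (L (N - {u})) (L (N - {w})))"
    proof (rule joint_ultra[of "(\<lambda>u. N - {u}) ` N" label "N - {u}" "N - {w}" adj])
    fix F assume "F \<in> (\<lambda>u. N - {u}) ` N"
    then obtain x where x: "x \<in> N" "F = N - {x}" by blast
    have "F \<noteq> {}" using u w x(2) by blast
    then show "ultra (label F)" using ultra_label[of F] x(2) fin N(1) by blast
    qed (use u w fin lk in auto)
    then show thesis using that by blast
  qed
  have "\<forall>\<^sub>F L in \<rho>. \<exists>u\<in>N. \<exists>w\<in>N. adj (L (N - {u})) (L (N - {w}))"
    using \<rho>(3) by eventually_elim (use u w in blast)
  then show ?thesis unfolding good_joint_def using \<rho>(1,2) by blast
qed

text \<open>The labelling of the facets of \<open>full z\<close> determined by the label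
  \<open>v\<close> of the facet opposite \<open>z\<close>. For \<open>z\<close> in
  \<open>pts\<close> the index chosen is unique.\<close>

definition ext_labelling :: "'v pt \<Rightarrow> 'v \<Rightarrow> 'v pt set \<Rightarrow> 'v" where
  "ext_labelling z v F = (case z of Base m \<Rightarrow> v
     | Ext i ss \<mu> B \<Rightarrow> if z \<in> F then B v (SOME k. attached z k F) else v)"

fun facet_label :: "'v pt \<Rightarrow> 'v filter" where
  "facet_label (Base m) = bot"
| "facet_label (Ext i ss \<mu> B) = \<mu>"

text \<open>An ultrafilter on the labellings of the facets of \<open>N\<close> that projects to the label of each facet.
  Below cardinality \<open>n\<close> there is at most one facet, \<open>N\<close> itself.\<close>

definition joint :: "'v pt set \<Rightarrow> ('v pt set \<Rightarrow> 'v) filter" where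
  "joint N = (if card N < n then filtermap (\<lambda>v _. v) (label N)
     else if N = full (lead N) then filtermap (ext_labelling (lead N)) (facet_label (lead N))
     else SOME \<rho>. good_joint N \<rho>)"

lemma lead_full: "z \<in> pts \<Longrightarrow> lead (full z) = z"
  unfolding full_def by (rule lead_insert) (use pts_entries(3) in blast)

lemma z_notin_entries: "z \<in> pts \<Longrightarrow> z \<notin> entries z ` dims z"
  using pts_entries(3) by fastforce

lemma ext_labelling_attached:
  assumes "z \<in> pts" "attached z k F" "z = Ext i ss \<mu> B"
  shows "ext_labelling z v F = B v k"
proof -
  have "(SOME k. attached z k F) = k"
    by (rule some_equality) (use assms attached_unique in blast)+
  moreover have "z \<in> F" using assms(2) unfolding attached_def by blast
  ultimately show ?thesis using assms(3) unfolding ext_labelling_def by simp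
qed

lemma full_attached:
  assumes "z \<in> pts" "k \<in> dims z"
  shows "attached z k (full z - {entries z k})"
proof -
  have "entries z ` dims z - {entries z k} = entries z ` (dims z - {k})"
    using inj_on_image_set_diff[OF pts_entries(2)[OF assms(1)], of "dims z" "{k}"] assms(2) by simp
  moreover have "z \<noteq> entries z k" using z_notin_entries[OF assms(1)] assms(2) by blast
  ultimately show ?thesis
    unfolding attached_def full_def using assms(2) by auto
qed

lemma pts_ExtD:
  assumes "Ext i ss \<mu> B \<in> pts"
  shows "\<mu> = label (facet n (nth ss) i)" "set ss \<subseteq> pts" "length ss = n" "i < n"
    "\<forall>\<^sub>F v in \<mu>. \<exists>j<n. \<exists>k<n. adj (((B v)(i := v)) j) (((B v)(i := v)) k)"
  using assms by (cases rule: pts.cases; auto simp del: fun_upd_apply)+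

text \<open>All facet labels are functions of the one label \<open>v\<close>, so the image of
  \<open>\<mu>\<close> is an ultrafilter with the prescribed projections; the adjacency condition is
  the one demanded of members of \<open>pts\<close>.\<close>

lemma good_joint_full:
  assumes z: "z \<in> pts" "z = Ext i ss \<mu> B"
  shows "good_joint (full z) (filtermap (ext_labelling z) \<mu>)"
proof -
  have mu: "\<mu> = label (facet n (nth ss) i)" and ss: "set ss \<subseteq> pts" "length ss = n" "i < n"
    and adj: "\<forall>\<^sub>F v in \<mu>. \<exists>j<n. \<exists>k<n. adj (((B v)(i := v)) j) (((B v)(i := v)) k)"
    using pts_ExtD[OF z(1)[unfolded z(2)]] by blast+
  have d: "dims z = {..<n} - {i}" "entries z = nth ss" using z(2) by (auto simp: entries_Ext)
  have um: "ultra \<mu>" unfolding mu using facet_pts[OF ss(1,2), of i] ss(1) by (intro ultra_label) auto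
  define w where "w k = (if k = i then z else ss ! k)" for k
  have wf: "w k \<in> full z" if "k < n" for k using that by (auto simp: w_def full_def d)
  have wl: "ext_labelling z v (full z - {w k}) = ((B v)(i := v)) k" if "k < n" for v k
  proof (cases "k = i")
    case True
    then show ?thesis by (simp add: w_def ext_labelling_def z(2))
  next
    case False
    then have "k \<in> dims z" using that d by simp
    from ext_labelling_attached[OF z(1) full_attached[OF z(1) this] z(2)]
    show ?thesis using False by (simp add: w_def d)
  qed
  have surj: "\<exists>k<n. u = w k" if "u \<in> full z" for u
    using that ss(3) by (auto simp: full_def d w_def image_iff)
  have "filtermap (\<lambda>L. L (full z - {u})) (filtermap (ext_labelling z) \<mu>) = label (full z - {u})"
    if u: "u \<in> full z" for u
  proof -
    obtain k where k: "k < n" "u = w k" using surj[OF u] by blast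
    show ?thesis
    proof (cases "k = i")
      case True
      have "full z - {u} = facet n (nth ss) i"
        using z_notin_entries[OF z(1)] k(2) True by (auto simp: w_def full_def facet_def d)
      then show ?thesis using wl[OF k(1)] k(2) True
        by (simp add: filtermap_filtermap mu[symmetric])
    next
      case False
      then have "k \<in> dims z" using k d by simp
      then have "label (full z - {u}) = plabel z k"
        using label_attached[OF z(1) full_attached[OF z(1)]] k(2) False by (simp add: w_def d)
      then show ?thesis using wl[OF k(1)] k(2) False by (simp add: filtermap_filtermap z(2))
    qed
  qed
  moreover have "\<forall>\<^sub>F L in filtermap (ext_labelling z) \<mu>.
      \<exists>u\<in>full z. \<exists>w\<in>full z. adj (L (full z - {u})) (L (full z - {w}))"
    unfolding eventually_filtermap using adj
  proof eventually_elim
    case (elim v)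
    then obtain j k where jk: "j < n" "k < n" "adj (((B v)(i := v)) j) (((B v)(i := v)) k)" by blast
    then show ?case using wf wl by metis
  qed
  ultimately show ?thesis unfolding good_joint_def using ultra_filtermap[OF um] by blast
qed

lemma good_joint:
  assumes "N \<subseteq> pts" "card N = n"
  shows "good_joint N (joint N)"
proof (cases "N = full (lead N)")
  case True
  have "finite N" "N \<noteq> {}" using assms(2) n card.infinite by force+
  then have z: "lead N \<in> pts" using lead_in assms(1) by blast
  show ?thesis
  proof (cases "lead N")
    case (Base m)
    then have "full (lead N) = {lead N}" by (simp add: full_def)
    then have "N = {lead N}" by (rule trans[OF True])
    then obtain x where "N = {x}" by blast
    then have "card N = 1" by simp
    then show ?thesis using assms(2) n by simp
  next
    case (Ext i ss \<mu> B)
    have "good_joint (full (lead N)) (filtermap (ext_labelling (lead N)) \<mu>)"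
      by (rule good_joint_full[OF z Ext])
    then have "good_joint N (filtermap (ext_labelling (lead N)) \<mu>)" using True by simp
    then show ?thesis unfolding joint_def using True assms(2) Ext by simp
  qed
next
  case False
  from someI_ex[OF good_joint_ex[OF assms False]] show ?thesis
    unfolding joint_def using False assms(2) by simp
qed

text \<open>Coherence: any two n-sets that share an (n-1)-set induce the same ultrafilter on its
  label.\<close>

lemma
  assumes N: "N \<subseteq> pts" "finite N" "N \<noteq> {}" "card N \<le> n"
  shows ultra_joint: "ultra (joint N)"
    and joint_project: "F \<subseteq> N \<Longrightarrow> card F = n - 1 \<Longrightarrow> filtermap (\<lambda>L. L F) (joint N) = label F"
proof -
  have "ultra (joint N) \<and> (F \<subseteq> N \<longrightarrow> card F = n - 1 \<longrightarrow> filtermap (\<lambda>L. L F) (joint N) = label F)" for F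
  proof (cases "card N = n")
    case True
    note g = good_joint[OF N(1) True, unfolded good_joint_def]
    have "filtermap (\<lambda>L. L F) (joint N) = label F" if F: "F \<subseteq> N" "card F = n - 1"
    proof -
      have "card (N - F) = 1" using F True n card_Diff_subset[OF finite_subset[OF F(1) N(2)] F(1)] by simp
      then obtain u where "N - F = {u}" by (auto simp: card_1_singleton_iff)
      then have "u \<in> N" "F = N - {u}" using F(1) by blast+
      then show ?thesis using g by blast
    qed
    then show ?thesis using g by blast
  next
    case False
    then have c: "card N < n" using N(4) by simp
    then have j: "joint N = filtermap (\<lambda>v _. v) (label N)" by (simp add: joint_def)
    have "F = N" if "F \<subseteq> N" "card F = n - 1"
      using card_seteq[OF N(2) that(1)] that(2) c by simp
    then show ?thesis using ultra_filtermap[OF ultra_label[OF N(2,3,1)]]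
      unfolding j by (auto simp: filtermap_filtermap)
  qed
  then show "ultra (joint N)" "F \<subseteq> N \<Longrightarrow> card F = n - 1 \<Longrightarrow> filtermap (\<lambda>L. L F) (joint N) = label F"
    by blast+
qed

section \<open>Types of tuples of points, almost everywhere\<close>

abbreviation "tuples_pts \<equiv> tuples n (\<lambda>_. pts)"

abbreviation ev :: "(nat \<Rightarrow> 'v pt) \<Rightarrow> (('v pt set \<Rightarrow> 'v) \<Rightarrow> bool) \<Rightarrow> bool" where
  "ev s P \<equiv> eventually P (joint (s ` {..<n}))"

lemma range_tuple:
  assumes "s ` {..<n} \<subseteq> pts"
  shows "finite (s ` {..<n})" "s ` {..<n} \<noteq> {}" "card (s ` {..<n}) \<le> n"
  using n card_image_le[of "{..<n}" s] by auto

lemma ultra_ev: "s ` {..<n} \<subseteq> pts \<Longrightarrow> ultra (joint (s ` {..<n}))"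
  by (rule ultra_joint) (use range_tuple[of s] in auto)

lemma eventually_const_ultra: "ultra F \<Longrightarrow> eventually (\<lambda>_. P) F \<longleftrightarrow> P"
  by (simp add: ultra_def eventually_const_iff)

lemma ev_typs:
  assumes s: "s ` {..<n} \<subseteq> pts"
  shows "ev s (\<lambda>L. tp n L s \<in> typs n UNIV adj)"
proof (cases "inj_on s {..<n}")
  case True
  then have "card (s ` {..<n}) = n" by (simp add: card_image)
  from good_joint[OF s this, unfolded good_joint_def]
  have "ev s (\<lambda>L. \<exists>u\<in>s ` {..<n}. \<exists>w\<in>s ` {..<n}. adj (L (s ` {..<n} - {u})) (L (s ` {..<n} - {w})))" by blast
  then show ?thesis
  proof eventually_elim
    case (elim L)
    then obtain i j where "i < n" "j < n" "adj (L (s ` {..<n} - {s i})) (L (s ` {..<n} - {s j}))" by blast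
    then have "adj (L (facet n s i)) (L (facet n s j))" by (simp add: facet_inj[OF True])
    with \<open>i < n\<close> \<open>j < n\<close> have "linked_facets n adj L s" unfolding linked_facets_def by blast
    then show ?case by (intro tp_typs) auto
  qed
next
  case False
  then have "tp n L s \<in> typs n UNIV adj" for L by (intro tp_typs) (auto simp: linked_facets_def)
  then show ?thesis by simp
qed

text \<open>The type of a tuple with fewer than n distinct points depends on one label at most, and
  both ultrafilters project to that label.\<close>

lemma ev_small:
  assumes N: "N \<subseteq> pts" "finite N" "card N \<le> n" and t: "t ` {..<n} \<subset> N"
  shows "eventually (\<lambda>L. P (tp n L t)) (joint N) \<longleftrightarrow> ev t (\<lambda>L. P (tp n L t))"
proof -
  let ?N' = "t ` {..<n}"
  define G where "G v = tp n (\<lambda>_. v) t" for v :: 'v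
  have c: "card ?N' \<le> n - 1" using psubset_card_mono[OF N(2) t] N(3) by simp
  have tL: "tp n L t = G (L ?N')" for L :: "'v pt set \<Rightarrow> 'v"
    unfolding G_def tp_eq_iff using facet_eq_range[OF _ c] by simp
  have tp: "?N' \<subseteq> pts" using t N(1) by blast
  have uN: "ultra (joint N)" using ultra_joint[OF N(1,2) _ N(3)] t by blast
  show ?thesis
  proof (cases "card ?N' = n - 1")
    case True
    have 1: "filtermap (\<lambda>L. L ?N') (joint N) = label ?N'"
      by (rule joint_project[OF N(1,2) _ N(3)]) (use t True in auto)
    have 2: "filtermap (\<lambda>L. L ?N') (joint ?N') = label ?N'"
      by (rule joint_project[OF tp range_tuple[OF tp] order_refl True])
    have "eventually (\<lambda>L. P (G (L ?N'))) F \<longleftrightarrow> eventually (\<lambda>v. P (G v)) (filtermap (\<lambda>L. L ?N') F)" for F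
      by (simp add: eventually_filtermap)
    then show ?thesis unfolding tL using 1 2 by simp
  next
    case False
    then have "\<not> nondeg n t i" for i
      using card_facet[of n t i] facet_eq_range[OF _ c, of i] by auto
    then have "tp n L t = G undefined" for L :: "'v pt set \<Rightarrow> 'v" unfolding G_def tp_eq_iff by simp
    then show ?thesis using eventually_const_ultra[OF uN] eventually_const_ultra[OF ultra_ev[OF tp]] by simp
  qed
qed

text \<open>Either the range stays the same, and so does the ultrafilter, or it shrinks, and
  \<open>ev_small\<close> applies.\<close>

lemma ev_comp:
  assumes s: "s ` {..<n} \<subseteq> pts" and p: "p ` {..<n} \<subseteq> {..<n}"
  shows "ev s (\<lambda>L. P (tp n L (s \<circ> p))) \<longleftrightarrow> ev (s \<circ> p) (\<lambda>L. P (tp n L (s \<circ> p)))"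
proof (cases "(s \<circ> p) ` {..<n} = s ` {..<n}")
  case False
  then have "(s \<circ> p) ` {..<n} \<subset> s ` {..<n}" using p by (force simp: image_comp[symmetric])
  then show ?thesis using ev_small[OF s] range_tuple[OF s] by blast
qed simp

text \<open>Apart from equalities a face sees at most the label of facet i, which both tuples
  share.\<close>

lemma ev_face:
  assumes s: "s ` {..<n} \<subseteq> pts" "t ` {..<n} \<subseteq> pts" and i: "i < n"
    and eq: "\<And>j. j < n \<Longrightarrow> j \<noteq> i \<Longrightarrow> s j = t j"
  shows "ev s (\<lambda>L. P (face i (tp n L s))) \<longleftrightarrow> ev t (\<lambda>L. P (face i (tp n L t)))"
proof -
  define K where "K s = {(j, k) \<in> ker n s. j \<noteq> i \<and> k \<noteq> i}" for s :: "nat \<Rightarrow> 'v pt"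
  have K: "K s = K t" using eq by (auto simp: K_def ker_def)
  have nd: "nondeg n s i \<longleftrightarrow> nondeg n t i" by (rule nondeg_cong[OF eq])
  have fc: "facet n s i = facet n t i" by (rule facet_cong[OF eq])
  have *: "ev r (\<lambda>L. P (face i (tp n L r))) \<longleftrightarrow>
      (if nondeg n r i then eventually (\<lambda>v. P (K r, Some v)) (label (facet n r i)) else P (K r, None))"
    if r: "r ` {..<n} \<subseteq> pts" for r
  proof (cases "nondeg n r i")
    case True
    have 1: "label (facet n r i) = filtermap (\<lambda>L. L (facet n r i)) (joint (r ` {..<n}))"
      by (rule joint_project[OF r range_tuple[OF r] facet_sub card_facet[OF True], symmetric])
    have "eventually (\<lambda>v. P (K r, Some v)) (label (facet n r i)) \<longleftrightarrow> ev r (\<lambda>L. P (K r, Some (L (facet n r i))))"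
      unfolding 1 eventually_filtermap ..
    then show ?thesis using True by (simp add: face_tp K_def)
  next
    case False
    then show ?thesis using eventually_const_ultra[OF ultra_ev[OF r]] by (simp add: face_tp K_def)
  qed
  show ?thesis unfolding *[OF s(1)] *[OF s(2)] K nd fc ..
qed

lemma joint_small: "card (s ` {..<n}) < n \<Longrightarrow> ev s (\<lambda>L. P (tp n L s)) \<longleftrightarrow> eventually (\<lambda>v. P (tp n (\<lambda>_. v) s)) (label (s ` {..<n}))"
  by (simp add: joint_def eventually_filtermap)

section \<open>Saturation: realising types by new points\<close>

lemma infinite_pts: "infinite pts"
proof -
  have "inj Base" by (rule injI) simp
  then have "infinite (range Base)" using range_inj_infinite by blast
  moreover have "range Base \<subseteq> pts" using Base by blast
  ultimately show ?thesis using infinite_super by blast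
qed

text \<open>An (n-1)-set containing \<open>F\<close> has to get the constant label \<open>v\<close>,
  but \<open>Ext\<close> only builds on (n-1)-sets. An auxiliary point \<open>w\<close> completes
  \<open>F\<close>, and the new point prescribes \<open>v\<close> for the facet omitting
  \<open>w\<close>.\<close>

lemma fresh_point:
  assumes F: "F \<subseteq> pts" "finite F" "card F \<le> n - 2"
  shows "\<exists>u\<in>pts. u \<notin> F \<and> (card F = n - 2 \<longrightarrow> (\<forall>\<^sub>F v' in label (insert u F). v' = v))"
proof (cases "card F = n - 2")
  case False
  obtain u where "u \<in> pts" "u \<notin> F" using infinite_pts F(2) finite_subset[of pts F] by blast
  then show ?thesis using False by blast
next
  case True
  obtain w where w: "w \<in> pts" "w \<notin> F" using infinite_pts F(2) finite_subset[of pts F] by blast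
  obtain fs where fs: "set fs = F" "distinct fs" using finite_distinct_list[OF F(2)] by blast
  then have len: "length fs = n - 2" using True distinct_card by metis
  obtain y where y: "adj v y" using noiso by blast
  \<comment> \<open>Index 0 is the placeholder, hence the repetition of \<open>w\<close>. The facet
    of index 1 omits \<open>w\<close> and gets \<open>v\<close>, the others a neighbour of
    \<open>v\<close>, so indices 1 and 2 provide the required edge.\<close>
  define ss where "ss = w # w # fs"
  define B where "B x k = (if k = 1 then v else y)" for x :: 'v and k :: nat
  define u where "u = Ext 0 ss (label (facet n (nth ss) 0)) B"
  have img: "(\<lambda>k. ss ! Suc k) ` {..<n - 1} = insert w F"
  proof -
    have "(\<lambda>k. ss ! Suc k) ` {..<n - 1} = set (w # fs)"
      using len n unfolding set_conv_nth ss_def by (auto simp: image_iff)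
    then show ?thesis using fs by simp
  qed
  have inj: "inj_on (nth ss) ({..<n} - {0})"
  proof (rule inj_onI)
    fix i j assume ij: "i \<in> {..<n} - {0}" "j \<in> {..<n} - {0}" "ss ! i = ss ! j"
    have "distinct (w # fs)" using w(2) fs by simp
    moreover have "(w # fs) ! (i - 1) = (w # fs) ! (j - 1)" "i - 1 < length (w # fs)" "j - 1 < length (w # fs)"
      using ij len n by (auto simp: ss_def)
    ultimately have "i - 1 = j - 1" using nth_eq_iff_index_eq by blast
    then show "i = j" using ij by auto
  qed
  have "adj (((B x)(0 := x)) 1) (((B x)(0 := x)) 2)" for x using y by (simp add: B_def)
  then have good: "\<forall>\<^sub>F x in label (facet n (nth ss) 0). \<exists>j<n. \<exists>k<n. adj (((B x)(0 := x)) j) (((B x)(0 := x)) k)"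
    using n by (intro always_eventually allI exI[of _ 1] exI[of _ 2] conjI) auto
  have ss: "set ss \<subseteq> pts" "length ss = n" using w fs F(1) len n by (auto simp: ss_def)
  have u: "u \<in> pts" unfolding u_def by (rule Ext) (use ss n inj good in auto)
  have "(nth ss) ` ({..<n} - {0} - {1}) = F"
  proof -
    have "(nth ss) ` ({..<n} - {0}) = insert w F"
    proof -
      have "x \<in> {..<n} - {0} \<longleftrightarrow> x \<in> Suc ` {..<n - 1}" for x by (cases x) auto
      then have "{..<n} - {0} = Suc ` {..<n - 1}" by blast
      then show ?thesis using img by (simp add: image_image)
    qed
    moreover have "(nth ss) ` ({..<n} - {0} - {1}) = (nth ss) ` ({..<n} - {0}) - {ss ! 1}"
      using inj_on_image_set_diff[OF inj, of "{..<n} - {0}" "{1}"] n by simp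
    ultimately show ?thesis using w(2) by (auto simp: ss_def)
  qed
  then have "attached u 1 (insert u F)"
    unfolding attached_def u_def using n by (simp add: entries_Ext del: entries.simps)
  then have "label (insert u F) = plabel u 1" by (rule label_attached[OF u])
  then have "\<forall>\<^sub>F v' in label (insert u F). v' = v"
    by (simp add: u_def eventually_filtermap B_def)
  moreover have "u \<notin> F"
  proof
    assume "u \<in> F"
    then have "u \<in> set ss" using fs by (auto simp: ss_def)
    from size_Ext[OF this, of 0 "label (facet n (nth ss) 0)" B] show False by (simp add: u_def)
  qed
  ultimately show ?thesis using u by blast
qed

lemma typs_cases:
  assumes "b \<in> typs n UNIV adj"
  obtains L and t :: "nat \<Rightarrow> nat" where "b = tp n L t" "linked_facets n adj L t"
  using assms unfolding typs_def by blast

lemma ker_upd: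
  fixes s :: "nat \<Rightarrow> 'u" and t :: "nat \<Rightarrow> 'w"
  assumes "{(j, k) \<in> ker n s. j \<noteq> i \<and> k \<noteq> i} = {(j, k) \<in> ker n t. j \<noteq> i \<and> k \<noteq> i}" "i < n"
    "\<And>j. j < n \<Longrightarrow> j \<noteq> i \<Longrightarrow> s j = u \<longleftrightarrow> t j = t i"
  shows "ker n (s(i := u)) = ker n t"
proof -
  have 1: "s j = s k \<longleftrightarrow> t j = t k" if "j < n" "k < n" "j \<noteq> i" "k \<noteq> i" for j k
  proof -
    have "(j, k) \<in> {(j, k) \<in> ker n s. j \<noteq> i \<and> k \<noteq> i} \<longleftrightarrow> (j, k) \<in> {(j, k) \<in> ker n t. j \<noteq> i \<and> k \<noteq> i}"
      using assms(1) by simp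
    then show ?thesis using that by (simp add: ker_def)
  qed
  show ?thesis unfolding ker_eq_iff
  proof (intro allI impI)
    fix j k assume "j < n" "k < n"
    then show "(s(i := u)) j = (s(i := u)) k \<longleftrightarrow> t j = t k"
      using 1[of j k] assms(3)[of j] assms(3)[of k] by (cases "j = i"; cases "k = i") auto
  qed
qed

lemma tp_not_inj:
  assumes "\<not> inj_on t {..<n}"
  shows "tp n L t = tp n (\<lambda>_. L (t ` {..<n})) t"
  unfolding tp_eq_iff using facet_eq_range[OF _ card_not_inj[OF assms]] by simp

lemma upd_pts: "s ` {..<n} \<subseteq> pts \<Longrightarrow> u \<in> pts \<Longrightarrow> s(i := u) ` {..<n} \<subseteq> pts"
  by auto

text \<open>Without a label on face i the wanted type is not injective, so at most the label of its
  range matters. Entry i either repeats an older entry or is a fresh point, whose label is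
  prescribed when n - 1 distinct points arise.\<close>

lemma saturated_degenerate:
  assumes s: "s ` {..<n} \<subseteq> pts" and i: "i < n" and nd: "\<not> nondeg n s i"
    and b: "b \<in> typs n UNIV adj" "face i (tp n L s) = face i b"
  shows "\<exists>u\<in>pts. ev (s(i := u)) (\<lambda>L. tp n L (s(i := u)) = b)"
proof -
  obtain L' and t :: "nat \<Rightarrow> nat" where bt: "b = tp n L' t" using b(1) by (rule typs_cases)
  have K: "{(j, k) \<in> ker n s. j \<noteq> i \<and> k \<noteq> i} = {(j, k) \<in> ker n t. j \<noteq> i \<and> k \<noteq> i}"
    using b(2) by (simp add: bt face_tp)
  have ndt: "\<not> nondeg n t i" using b(2) nd by (simp add: bt face_tp split: if_splits)
  then obtain j k where jk: "j < n" "k < n" "j \<noteq> i" "k \<noteq> i" "j \<noteq> k" "t j = t k"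
    using i unfolding nondeg_def inj_on_def by blast
  have ninj: "\<not> inj_on t {..<n}" using jk by (auto simp: inj_on_def)
  have fin: "finite (facet n s i)" by (simp add: facet_def)
  have fp: "facet n s i \<subseteq> pts" by (rule order_trans[OF facet_sub s])
  have cF: "card (facet n s i) \<le> n - 2"
  proof -
    have "\<not> inj_on s ({..<n} - {i})" using nd i by (simp add: nondeg_def)
    then have "card (facet n s i) \<noteq> card ({..<n} - {i})" unfolding facet_def
      using eq_card_imp_inj_on[of "{..<n} - {i}" s] by auto
    moreover have "card (facet n s i) \<le> card ({..<n} - {i})" unfolding facet_def by (rule card_image_le) simp
    ultimately show ?thesis using i by simp
  qed
  show ?thesis
  proof (cases "\<exists>m<n. m \<noteq> i \<and> t m = t i")
    case True
    then obtain m where m: "m < n" "m \<noteq> i" "t m = t i" by blast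
    define s' where "s' = s(i := s m)"
    have ker: "ker n s' = ker n t" unfolding s'_def
    proof (rule ker_upd[OF K i])
      fix l assume "l < n" "l \<noteq> i"
      moreover have "(l, m) \<in> {(j, k) \<in> ker n s. j \<noteq> i \<and> k \<noteq> i} \<longleftrightarrow> (l, m) \<in> {(j, k) \<in> ker n t. j \<noteq> i \<and> k \<noteq> i}"
        using K by simp
      ultimately show "s l = s m \<longleftrightarrow> t l = t i" using m by (simp add: ker_def)
    qed
    have "facet n s i = s' ` {..<n}" using m i unfolding facet_def s'_def by (auto simp: image_iff)
    then have c: "card (s' ` {..<n}) \<le> n - 2" using cF by simp
    have "\<not> nondeg n s' l" for l
      using card_facet[of n s' l] card_mono[OF _ facet_sub[of n s' l]] c n by auto
    then have "tp n L s' = b" for L unfolding bt tp_eq_iff using ker by simp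
    then have "ev s' (\<lambda>L. tp n L s' = b)" by simp
    moreover have "s m \<in> pts" using s m(1) by blast
    ultimately show ?thesis unfolding s'_def by blast
  next
    case False
    obtain u where u: "u \<in> pts" "u \<notin> facet n s i"
      "card (facet n s i) = n - 2 \<Longrightarrow> \<forall>\<^sub>F v' in label (insert u (facet n s i)). v' = L' (t ` {..<n})"
      using fresh_point[OF fp fin cF, of "L' (t ` {..<n})"] by blast
    define s' where "s' = s(i := u)"
    have ker: "ker n s' = ker n t" unfolding s'_def
    proof (rule ker_upd[OF K i])
      fix l assume "l < n" "l \<noteq> i"
      then show "s l = u \<longleftrightarrow> t l = t i" using False u(2) unfolding facet_def by auto
    qed
    have img: "s' ` {..<n} = insert u (facet n s i)"
      using i unfolding facet_def s'_def by (auto simp: image_iff)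
    have c: "card (s' ` {..<n}) = Suc (card (facet n s i))" unfolding img using fin u(2) by simp
    have bt': "b = tp n (\<lambda>_. L' (t ` {..<n})) s'"
      unfolding bt tp_not_inj[OF ninj, of L'] tp_eq_iff using ker by simp
    have "ev s' (\<lambda>L. tp n L s' = b)"
    proof (cases "card (facet n s i) = n - 2")
      case True
      have "\<forall>\<^sub>F v in label (s' ` {..<n}). tp n (\<lambda>_. v) s' = b"
        using u(3)[OF True] unfolding img by eventually_elim (simp add: bt')
      then show ?thesis using joint_small[of s' "\<lambda>a. a = b"] c True n by simp
    next
      case False
      then have c': "card (s' ` {..<n}) < n - 1" using c cF by simp
      have "\<not> nondeg n s' l" for l
        using card_facet[of n s' l] card_mono[OF _ facet_sub[of n s' l]] c' by auto
      then have "tp n L s' = b" for L unfolding bt' tp_eq_iff by simp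
      then show ?thesis by simp
    qed
    then show ?thesis using u(1) unfolding s'_def by blast
  qed
qed

text \<open>The type found in \<open>X\<close> may vary with the label \<open>v\<close> of facet i,
  and no single type need occur almost everywhere; this is why \<open>B\<close> is a function of
  \<open>v\<close>. The ultrafilter decides between repeating one of finitely many old entries and
  adding a new point.\<close>

lemma saturated_nondegenerate:
  assumes s: "s ` {..<n} \<subseteq> pts" and nd: "nondeg n s i" and X: "X \<subseteq> typs n UNIV adj"
    and ex: "ev s (\<lambda>L. \<exists>b\<in>X. face i (tp n L s) = face i b)"
  shows "\<exists>u\<in>pts. ev (s(i := u)) (\<lambda>L. tp n L (s(i := u)) \<in> X)"
proof -
  have i: "i < n" and inj: "inj_on s ({..<n} - {i})" using nd by (auto simp: nondeg_def)
  let ?F = "facet n s i"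
  define K where "K = {(j, k) \<in> ker n s. j \<noteq> i \<and> k \<noteq> i}"
  have lab: "label ?F = filtermap (\<lambda>L. L ?F) (joint (s ` {..<n}))"
    by (rule joint_project[OF s range_tuple[OF s] facet_sub card_facet[OF nd], symmetric])
  have ulab: "ultra (label ?F)" unfolding lab by (rule ultra_filtermap[OF ultra_ev[OF s]])
  have exl: "\<forall>\<^sub>F v in label ?F. \<exists>b\<in>X. (K, Some v) = face i b"
    using ex nd unfolding lab eventually_filtermap face_tp K_def by simp
  define P where "P v L t \<longleftrightarrow> tp n L t \<in> X \<and> linked_facets n adj L t \<and> inj_on t {..<n} \<and> L (facet n t i) = v"
    for v L and t :: "nat \<Rightarrow> nat"
  have "\<forall>\<^sub>F v in label ?F. (\<exists>m\<in>{..<n} - {i}. tp n (\<lambda>_. v) (s(i := s m)) \<in> X) \<or> (\<exists>L t. P v L t)"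
    using exl
  proof eventually_elim
    case (elim v)
    then obtain b where b: "b \<in> X" "(K, Some v) = face i b" by blast
    then obtain L and t :: "nat \<Rightarrow> nat" where bt: "b = tp n L t" "linked_facets n adj L t"
      using X typs_cases by blast
    have K: "{(j, k) \<in> ker n s. j \<noteq> i \<and> k \<noteq> i} = {(j, k) \<in> ker n t. j \<noteq> i \<and> k \<noteq> i}"
      and ndt: "nondeg n t i" and v: "L (facet n t i) = v"
      using b(2) by (auto simp: bt face_tp K_def split: if_splits)
    show ?case
    proof (cases "inj_on t {..<n}")
      case True
      then show ?thesis using bt b(1) v unfolding P_def by blast
    next
      case False
      obtain m where m: "m < n" "m \<noteq> i" "t m = t i"
      proof -
        obtain j k where jk: "j < n" "k < n" "j \<noteq> k" "t j = t k" using False unfolding inj_on_def by blast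
        then have "j = i \<or> k = i" using ndt unfolding nondeg_def inj_on_def by blast
        then show thesis using jk that by metis
      qed
      have ker: "ker n (s(i := s m)) = ker n t"
      proof (rule ker_upd[OF K i])
        fix l assume "l < n" "l \<noteq> i"
        moreover have "(l, m) \<in> {(j, k) \<in> ker n s. j \<noteq> i \<and> k \<noteq> i} \<longleftrightarrow> (l, m) \<in> {(j, k) \<in> ker n t. j \<noteq> i \<and> k \<noteq> i}"
          using K by simp
        ultimately show "s l = s m \<longleftrightarrow> t l = t i" using m by (simp add: ker_def)
      qed
      have "L (t ` {..<n}) = v" using v facet_eq_range[OF ndt card_not_inj[OF False]] by simp
      then have "b = tp n (\<lambda>_. v) (s(i := s m))"
        unfolding bt tp_not_inj[OF False, of L] tp_eq_iff using ker by simp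
      then show ?thesis using b(1) m by blast
    qed
  qed
  then consider m where "m < n" "m \<noteq> i" "\<forall>\<^sub>F v in label ?F. tp n (\<lambda>_. v) (s(i := s m)) \<in> X"
    | "\<forall>\<^sub>F v in label ?F. \<exists>L t. P v L t"
    unfolding ultra_disj_iff[OF ulab] by (subst (asm) ultra_bex_iff[OF ulab]) auto
  then show ?thesis
  proof cases
    case 1
    have img: "s(i := s m) ` {..<n} = ?F" using 1(1,2) i unfolding facet_def by (auto simp: image_iff)
    have "card (s(i := s m) ` {..<n}) < n" unfolding img card_facet[OF nd] using n by simp
    then have "ev (s(i := s m)) (\<lambda>L. tp n L (s(i := s m)) \<in> X)"
      using joint_small[of "s(i := s m)" "\<lambda>a. a \<in> X"] 1(3) img by simp
    moreover have "s m \<in> pts" using s 1(1) by blast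
    ultimately show ?thesis by blast
  next
    case 2
    define LL where "LL v = (SOME L. \<exists>t. P v L t)" for v
    define tt where "tt v = (SOME t. P v (LL v) t)" for v
    have P: "P v (LL v) (tt v)" if "\<exists>L t. P v L t" for v
    proof -
      have "\<exists>t. P v (LL v) t" unfolding LL_def by (rule someI_ex[OF that])
      then show ?thesis unfolding tt_def by (rule someI_ex)
    qed
    define ss where "ss = map s [0..<n]"
    define B where "B v k = LL v (facet n (tt v) k)" for v k
    have nth: "ss ! k = s k" if "k < n" for k using that by (simp add: ss_def)
    have Fss: "facet n (nth ss) i = ?F" by (rule facet_cong) (simp add: nth)
    have ss: "set ss \<subseteq> pts" "length ss = n" using s by (auto simp: ss_def)
    have injs: "inj_on (nth ss) ({..<n} - {i})" using inj nth by (auto simp: inj_on_def)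
    have Bi: "((B v)(i := v)) k = B v k" if "P v (LL v) (tt v)" for v k
      using that by (simp add: P_def B_def)
    have good: "\<forall>\<^sub>F v in label (facet n (nth ss) i). \<exists>j<n. \<exists>k<n. adj (((B v)(i := v)) j) (((B v)(i := v)) k)"
      unfolding Fss using 2
    proof eventually_elim
      case (elim v)
      note Pv = P[OF elim]
      then show ?case unfolding Bi[OF Pv] unfolding B_def P_def linked_facets_def by blast
    qed
    define u where "u = Ext i ss (label (facet n (nth ss) i)) B"
    have u: "u \<in> pts" unfolding u_def by (rule Ext) (use ss i injs good in auto)
    have d: "dims u = {..<n} - {i}" "entries u = nth ss" by (auto simp: u_def entries_Ext)
    define s' where "s' = s(i := u)"
    have ent: "entries u ` dims u = ?F" using Fss by (simp add: d facet_def)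
    have full: "s' ` {..<n} = full u"
      unfolding full_def ent using i unfolding facet_def s'_def by (auto simp: image_iff)
    have uF: "u \<notin> ?F" using z_notin_entries[OF u] ent by simp
    have inj': "inj_on s' {..<n}"
      using inj uF unfolding inj_on_def s'_def facet_def by auto
    have card: "card (s' ` {..<n}) = n" using inj' by (simp add: card_image)
    \<comment> \<open>The new n-set is \<open>full u\<close>, so its ultrafilter follows the types
      chosen for the various \<open>v\<close>.\<close>
    have j: "joint (s' ` {..<n}) = filtermap (ext_labelling u) (label ?F)"
      unfolding joint_def card full lead_full[OF u] using card full by (simp add: u_def Fss)
    have fl: "ext_labelling u v (facet n s' k) = ((B v)(i := v)) k" if "k < n" for v k
    proof -
      have fk: "facet n s' k = full u - {s' k}" using facet_inj[OF inj' that] full by simp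
      show ?thesis
      proof (cases "k = i")
        case True
        then show ?thesis unfolding fk by (simp add: s'_def ext_labelling_def u_def)
      next
        case False
        then have kd: "k \<in> dims u" using that d by simp
        have "s' k = entries u k" using False that by (simp add: s'_def d nth)
        then have "attached u k (facet n s' k)" unfolding fk using full_attached[OF u kd] by simp
        from ext_labelling_attached[OF u this u_def] show ?thesis using False by simp
      qed
    qed
    have "\<forall>\<^sub>F v in label ?F. tp n (ext_labelling u v) s' \<in> X"
      using 2
    proof eventually_elim
      case (elim v)
      note Pv = P[OF elim]
      have "tp n (ext_labelling u v) s' = tp n (LL v) (tt v)"
      proof -
        have "ker n s' = ker n (tt v)"
          using inj' Pv unfolding ker_eq_iff P_def inj_on_def by (metis lessThan_iff)
        then show ?thesis unfolding tp_eq_iff using fl Bi[OF Pv] by (simp add: B_def)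
      qed
      then show ?case using Pv by (simp add: P_def)
    qed
    then have "ev s' (\<lambda>L. tp n L s' \<in> X)" unfolding j eventually_filtermap .
    then show ?thesis using u unfolding s'_def by blast
  qed
qed

lemma saturated:
  assumes s: "s ` {..<n} \<subseteq> pts" and i: "i < n" and X: "X \<subseteq> typs n UNIV adj"
    and ex: "ev s (\<lambda>L. \<exists>b\<in>X. face i (tp n L s) = face i b)"
  shows "\<exists>u\<in>pts. ev (s(i := u)) (\<lambda>L. tp n L (s(i := u)) \<in> X)"
proof (cases "nondeg n s i")
  case True
  then show ?thesis using saturated_nondegenerate[OF s _ X ex] by blast
next
  case False
  \<comment> \<open>A degenerate face carries no label, so a single labelling determines it.\<close>
  obtain L b where b: "b \<in> X" "face i (tp n L s) = face i b"
    using eventually_happens[OF ex] ultra_ev[OF s] by (auto simp: ultra_def)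
  then obtain u where u: "u \<in> pts" "ev (s(i := u)) (\<lambda>L. tp n L (s(i := u)) = b)"
    using saturated_degenerate[OF s i False] X by blast
  have "ev (s(i := u)) (\<lambda>L. tp n L (s(i := u)) \<in> X)"
    using u(2) by eventually_elim (use b in simp)
  then show ?thesis using u(1) by blast
qed

text \<open>Saturation is applied to one coordinate at a time, starting from a constant tuple.
  Before the last step \<open>r m\<close> repeats \<open>t 0\<close> at position n - 1, so it
  satisfies the adjacency condition vacuously.\<close>

lemma realized:
  assumes b: "b \<in> typs n UNIV adj"
  shows "\<exists>s. s ` {..<n} \<subseteq> pts \<and> ev s (\<lambda>L. tp n L s = b)"
proof -
  obtain L and t :: "nat \<Rightarrow> nat" where bt: "b = tp n L t" "linked_facets n adj L t"
    using b by (rule typs_cases)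
  define r where "r m k = (if k < m then t k else t 0)" for m k
  have rS: "tp n L (r m) \<in> typs n UNIV adj" if "m \<le> n" for m
  proof (cases "m = n")
    case True
    have "tp n L (r n) = tp n L t"
      unfolding tp_eq_iff using facet_cong[of n _ "r n" t] by (auto simp: ker_eq_iff r_def)
    then show ?thesis using b bt True by simp
  next
    case False
    have "r m 0 = r m (n - 1)" using False that by (simp add: r_def)
    then have "\<not> inj_on (r m) {..<n}" using inj_onD[of "r m" "{..<n}" 0 "n - 1"] n by auto
    then show ?thesis by (intro tp_typs) (auto simp: linked_facets_def)
  qed
  have "\<exists>s. s ` {..<n} \<subseteq> pts \<and> ev s (\<lambda>L'. tp n L' s = tp n L (r m))" if "m \<le> n" for m
    using that
  proof (induction m)
    case 0
    define s where "s = (\<lambda>k :: nat. Base 0 :: 'v pt)"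
    have "\<not> nondeg n s i" for i
      unfolding nondeg_def inj_on_def s_def
    proof
      assume A: "i < n \<and> (\<forall>x\<in>{..<n} - {i}. \<forall>y\<in>{..<n} - {i}. (Base 0 :: 'v pt) = Base 0 \<longrightarrow> x = y)"
      define x where "x = (if i = 0 then 1 else 0 :: nat)"
      define y where "y = (if i = 2 then 1 else 2 :: nat)"
      have "x \<in> {..<n} - {i}" "y \<in> {..<n} - {i}" "x \<noteq> y"
        using n by (auto simp: x_def y_def)
      then show False using A by blast
    qed
    then have "tp n L' s = tp n L (r 0)" for L' :: "'v pt set \<Rightarrow> 'v"
      unfolding tp_eq_iff by (auto simp: ker_eq_iff s_def r_def)
    moreover have "s ` {..<n} \<subseteq> pts" by (auto simp: s_def Base)
    ultimately show ?case by (intro exI[of _ s]) simp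
  next
    case (Suc m)
    then obtain s where s: "s ` {..<n} \<subseteq> pts" "ev s (\<lambda>L'. tp n L' s = tp n L (r m))" by auto
    have "face m (tp n L (r m)) = face m (tp n L (r (Suc m)))"
      using Suc.prems facet_cong[of n m "r m" "r (Suc m)"] by (subst face_tp_eq_iff) (auto simp: r_def)
    then have "ev s (\<lambda>L'. \<exists>b\<in>{tp n L (r (Suc m))}. face m (tp n L' s) = face m b)"
      using s(2) by (auto elim: eventually_mono)
    from saturated[OF s(1) _ _ this] obtain u
      where u: "u \<in> pts" "ev (s(m := u)) (\<lambda>L'. tp n L' (s(m := u)) \<in> {tp n L (r (Suc m))})"
      using rS[OF Suc.prems] Suc.prems by auto
    then show ?case using upd_pts[OF s(1) u(1)] unfolding singleton_iff by blast
  qed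
  moreover have "tp n L (r n) = b"
    unfolding bt tp_eq_iff using facet_cong[of n _ "r n" t] by (auto simp: ker_eq_iff r_def)
  ultimately show ?thesis by force
qed

section \<open>The representation\<close>

definition rep :: "'v tuple_type set \<Rightarrow> (nat \<Rightarrow> 'v pt) set" where
  "rep X = {s \<in> tuples_pts. ev s (\<lambda>L. tp n L s \<in> X)}"

lemma tuples_image: "s \<in> tuples_pts \<Longrightarrow> s ` {..<n} \<subseteq> pts"
  unfolding tuples_def by auto

text \<open>Saturation gives the inclusion into the cylinder, invariance of faces the
  converse.\<close>

lemma rep_cyl:
  assumes i: "i < n" and X: "X \<subseteq> typs n UNIV adj"
  shows "rep {a \<in> typs n UNIV adj. \<exists>b\<in>X. face i a = face i b} = set_op n tuples_pts (Cyl i) (rep X)"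
proof (intro subset_antisym subsetI)
  fix s assume "s \<in> rep {a \<in> typs n UNIV adj. \<exists>b\<in>X. face i a = face i b}"
  then have s: "s \<in> tuples_pts" and ex: "ev s (\<lambda>L. \<exists>b\<in>X. face i (tp n L s) = face i b)"
    unfolding rep_def by (auto elim: eventually_mono)
  obtain u where u: "u \<in> pts" "ev (s(i := u)) (\<lambda>L. tp n L (s(i := u)) \<in> X)"
    using saturated[OF tuples_image[OF s] i X ex] by blast
  have "s(i := u) \<in> tuples_pts"
    using s u(1) i by (auto simp: tuples_def PiE_def Pi_def extensional_def)
  then have "s(i := u) \<in> rep X" using u(2) by (simp add: rep_def)
  then show "s \<in> set_op n tuples_pts (Cyl i) (rep X)" using s by (auto intro!: bexI[of _ "s(i := u)"])
next
  fix s assume "s \<in> set_op n tuples_pts (Cyl i) (rep X)"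
  then obtain t where s: "s \<in> tuples_pts" and t: "t \<in> rep X" "\<forall>j<n. j \<noteq> i \<longrightarrow> t j = s j" by auto
  have tt: "t \<in> tuples_pts" "ev t (\<lambda>L. tp n L t \<in> X)" using t(1) by (auto simp: rep_def)
  have "ev t (\<lambda>L. \<exists>b\<in>X. face i (tp n L t) = face i b)"
    using tt(2) by eventually_elim blast
  then have "ev s (\<lambda>L. \<exists>b\<in>X. face i (tp n L s) = face i b)"
    using ev_face[OF tuples_image[OF s] tuples_image[OF tt(1)] i, of "\<lambda>f. \<exists>b\<in>X. f = face i b"] t(2) by simp
  with ev_typs[OF tuples_image[OF s]]
  have "ev s (\<lambda>L. tp n L s \<in> {a \<in> typs n UNIV adj. \<exists>b\<in>X. face i a = face i b})"
    by eventually_elim simp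
  then show "s \<in> rep {a \<in> typs n UNIV adj. \<exists>b\<in>X. face i a = face i b}" using s by (simp add: rep_def)
qed

lemma rep_subst:
  assumes p: "p ` {..<n} \<subseteq> {..<n}" "\<And>i. i \<ge> n \<Longrightarrow> p i = i"
  shows "rep {a \<in> typs n UNIV adj. \<exists>b\<in>X. subst n p a b} = {s \<in> tuples_pts. s \<circ> p \<in> rep X}"
proof -
  have "s \<in> rep {a \<in> typs n UNIV adj. \<exists>b\<in>X. subst n p a b} \<longleftrightarrow> s \<circ> p \<in> rep X"
    if s: "s \<in> tuples_pts" for s
  proof -
    note si = tuples_image[OF s]
    have sp: "s \<circ> p \<in> tuples_pts"
      using s p unfolding tuples_def by (auto simp: PiE_def Pi_def extensional_def)
    have "ev s (\<lambda>L. tp n L s \<in> {a \<in> typs n UNIV adj. \<exists>b\<in>X. subst n p a b}) \<longleftrightarrow> ev s (\<lambda>L. tp n L (s \<circ> p) \<in> X)"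
      using ev_typs[OF si] by (simp add: subst_tp_iff[OF p(1)] eventually_conj_iff)
    also have "\<dots> \<longleftrightarrow> ev (s \<circ> p) (\<lambda>L. tp n L (s \<circ> p) \<in> X)" by (rule ev_comp[OF si p(1)])
    finally show ?thesis using s sp by (simp add: rep_def)
  qed
  moreover have "rep Y \<subseteq> tuples_pts" for Y by (auto simp: rep_def)
  ultimately show ?thesis by blast
qed

lemma rep_hom: "alg_hom T n (Cm (eta n UNIV adj)) (set_alg n (\<lambda>_. pts)) rep"
proof -
  let ?S = "typs n UNIV adj"
  have u: "ultra (joint (s ` {..<n}))" if "s \<in> tuples_pts" for s by (rule ultra_ev[OF tuples_image[OF that]])
  have un: "rep (X \<union> Y) = rep X \<union> rep Y" for X Y
    unfolding rep_def using ultra_disj_iff[OF u] by auto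
  have int: "rep (X \<inter> Y) = rep X \<inter> rep Y" for X Y
    unfolding rep_def by (auto simp: eventually_conj_iff)
  have compl: "rep (?S - X) = tuples_pts - rep X" for X
    unfolding rep_def using ultra_not_iff[OF u] ev_typs[OF tuples_image] by (auto simp: eventually_conj_iff)
  have e: "rep {} = {}"
    unfolding rep_def using u by (auto simp: ultra_def trivial_limit_def)
  have a: "rep ?S = tuples_pts"
    unfolding rep_def using ev_typs[OF tuples_image] by auto
  have ops: "rep {a \<in> ?S. \<exists>b\<in>X. Rel (eta n UNIV adj) f a b} = set_op n tuples_pts f (rep X)"
    if f: "f \<in> uops T n" and X: "X \<subseteq> ?S" for f X
  proof (cases f)
    case (Cyl i)
    then show ?thesis using rep_cyl[OF _ X, of i] f by (auto simp: eta_def uops_def split: if_splits)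
  next
    case (Repl i j)
    then have ij: "i < n" "j < n" using f by (auto simp: uops_def split: if_splits)
    show ?thesis using rep_subst[OF uops_maps(1)[OF ij], of X] ij by (simp add: Repl eta_def)
  next
    case (Transp i j)
    then have ij: "i < n" "j < n" using f by (auto simp: uops_def split: if_splits)
    show ?thesis using rep_subst[OF uops_maps(2)[OF ij], of X] ij by (simp add: Transp eta_def transpose_def)
  qed
  have diag: "rep {a \<in> ?S. (i, j) \<in> fst a} = {s \<in> tuples_pts. s i = s j}" if ij: "(i, j) \<in> diags T n" for i j
  proof -
    have "i < n" "j < n" using ij by (auto simp: diags_def split: if_splits)
    then have "(i, j) \<in> fst (tp n L s) \<longleftrightarrow> s i = s j" for L :: "'v pt set \<Rightarrow> 'v" and s
      by (simp add: tp_def ker_def)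
    then show ?thesis
      unfolding rep_def using ev_typs[OF tuples_image] eventually_const_ultra[OF u] by (auto simp: eventually_conj_iff)
  qed
  have diag': "rep {a \<in> ?S. x \<in> fst a} = {s \<in> tuples_pts. s (fst x) = s (snd x)}" if "x \<in> diags T n" for x
    using diag[of "fst x" "snd x"] that by simp
  have sub: "rep X \<subseteq> tuples_pts" for X unfolding rep_def by blast
  have Uni: "Uni (eta n UNIV adj) = ?S" "DRel (eta n UNIV adj) i j a \<longleftrightarrow> (i, j) \<in> fst a" for i j a
    by (simp_all add: eta_def)
  show ?thesis
    unfolding alg_hom_def using un int compl e a ops diag' sub
    by (simp add: Cm_def set_alg_def Uni split_beta)
qed

text \<open>A single set algebra is enough: each type \<open>b\<close> is realised by a tuple whose
  ultrafilter concentrates on \<open>b\<close>, and this tuple lies in \<open>rep Z\<close> exactly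
  when \<open>b\<close> is in \<open>Z\<close>.\<close>

theorem representable_eta: "representable T n (Cm (eta n UNIV adj))"
proof (rule representableI[where I = "{()}" and U = "\<lambda>_ _. pts" and h = "\<lambda>X. \<lambda>k\<in>{()}. rep X"])
  let ?A = "Cm (eta n UNIV adj)"
  show A: "algebra_of_type T n ?A" by (rule Cm_algebra)
  show "admissible_bases T n (\<lambda>_. pts)" by (simp add: admissible_bases_def)
  have cl: "\<forall>a\<in>Carr ?A. Compl ?A a \<in> Carr ?A" "\<forall>a\<in>Carr ?A. \<forall>b\<in>Carr ?A. Join ?A a b \<in> Carr ?A \<and> Meet ?A a b \<in> Carr ?A"
    "\<forall>f\<in>uops T n. \<forall>a\<in>Carr ?A. Oper ?A f a \<in> Carr ?A" "\<forall>(i,j)\<in>diags T n. Diag ?A i j \<in> Carr ?A"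
    using A by (auto simp: algebra_of_type_def boolean_def)
  have "alg_hom T n ?A (prod_alg {()} (\<lambda>k. set_alg n (\<lambda>_. pts))) (\<lambda>X. \<lambda>k\<in>{()}. rep X)"
    by (subst alg_hom_prod_iff[OF _ _ _ cl]) (auto simp: rep_hom)
  moreover have "inj_on (\<lambda>X. \<lambda>k\<in>{()}. rep X) (Carr ?A)"
  proof (rule inj_onI)
    fix X Y assume XY: "X \<in> Carr ?A" "Y \<in> Carr ?A" "(\<lambda>k\<in>{()}. rep X) = (\<lambda>k\<in>{()}. rep Y)"
    then have eq: "rep X = rep Y" by (metis restrict_apply' singletonI)
    have "X \<subseteq> typs n UNIV adj" "Y \<subseteq> typs n UNIV adj" using XY(1,2) by (auto simp: Cm_def eta_def)
    moreover have "b \<in> X \<longleftrightarrow> b \<in> Y" if b: "b \<in> typs n UNIV adj" for b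
    proof -
      obtain s where s: "s ` {..<n} \<subseteq> pts" "ev s (\<lambda>L. tp n L s = b)" using realized[OF b] by blast
      define s' where "s' = restrict s {..<n}"
      have s': "s' \<in> tuples_pts" using s(1) by (auto simp: s'_def tuples_def)
      have "tp n L s' = tp n L s" for L :: "'v pt set \<Rightarrow> 'v"
        unfolding tp_eq_iff using facet_cong[of n _ s' s] by (auto simp: ker_eq_iff s'_def)
      moreover have "s' ` {..<n} = s ` {..<n}" by (simp add: s'_def)
      ultimately have "ev s' (\<lambda>L. tp n L s' = b)" using s(2) by simp
      then have "ev s' (\<lambda>L. tp n L s' \<in> Z \<longleftrightarrow> b \<in> Z)" for Z by eventually_elim simp
      from eventually_subst[OF this] have "ev s' (\<lambda>L. tp n L s' \<in> Z) \<longleftrightarrow> b \<in> Z" for Z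
        using eventually_const_ultra[OF ultra_ev[OF tuples_image[OF s']], of "b \<in> Z"] by simp
      then have "s' \<in> rep Z \<longleftrightarrow> b \<in> Z" for Z using s' by (simp add: rep_def)
      then show ?thesis using eq by metis
    qed
    ultimately show "X = Y" by blast
  qed
  ultimately show "alg_embedding T n ?A (prod_alg {()} (\<lambda>k. set_alg n (\<lambda>_. pts))) (\<lambda>X. \<lambda>k\<in>{()}. rep X)"
    by (simp add: alg_embedding_def)
qed

end

section \<open>Shift graphs\<close>

text \<open>\<open>y\<close> continues \<open>x\<close> moved by one place. For \<open>k = 0\<close>
  the overlaps are empty, so all one-term sequences are adjacent, loops included.\<close>

definition shift :: "nat \<Rightarrow> nat list \<Rightarrow> nat list \<Rightarrow> bool" where
  "shift k x y \<longleftrightarrow> length x = Suc k \<and> length y = Suc k \<and> sorted_wrt (<) x \<and> sorted_wrt (<) y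
     \<and> tl x = butlast y"

definition shift_adj :: "nat \<Rightarrow> nat list \<Rightarrow> nat list \<Rightarrow> bool" where
  "shift_adj k x y \<longleftrightarrow> shift k x y \<or> shift k y x"

text \<open>The copy of a vertex is its second component mod n, since a HOL type cannot depend on
  the variable \<open>n\<close>.\<close>

definition join_adj :: "nat \<Rightarrow> ('x \<Rightarrow> 'x \<Rightarrow> bool) \<Rightarrow> 'x \<times> nat \<Rightarrow> 'x \<times> nat \<Rightarrow> bool" where
  "join_adj n E p q \<longleftrightarrow> snd p mod n \<noteq> snd q mod n \<or> E (fst p) (fst q)"

definition fin_colourable :: "('x \<Rightarrow> 'x \<Rightarrow> bool) \<Rightarrow> 'x set \<Rightarrow> bool" where
  "fin_colourable E X \<longleftrightarrow>
     (\<exists>(f :: 'x \<Rightarrow> nat) N. (\<forall>x\<in>X. f x < N) \<and> (\<forall>x\<in>X. \<forall>y\<in>X. E x y \<longrightarrow> f x \<noteq> f y))"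

text \<open>In a homogeneous set take k + 2 elements in increasing order; dropping the last or the
  first gives adjacent vertices of one colour.\<close>

lemma shift_not_fin_colourable: "\<not> fin_colourable (shift_adj k) UNIV"
proof
  assume "fin_colourable (shift_adj k) UNIV"
  then obtain f :: "nat list \<Rightarrow> nat" and N where f: "\<And>x. f x < N" "\<And>x y. shift_adj k x y \<Longrightarrow> f x \<noteq> f y"
    unfolding fin_colourable_def by auto
  obtain Y c where Y: "infinite Y"
    and c: "\<And>A. A \<subseteq> Y \<Longrightarrow> finite A \<Longrightarrow> card A = Suc k \<Longrightarrow> f (sorted_list_of_set A) = c"
    using Ramsey[of "UNIV :: nat set" "Suc k" "\<lambda>A. f (sorted_list_of_set A)" N] f(1) by auto
  obtain B where B: "finite B" "card B = Suc (Suc k)" "B \<subseteq> Y"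
    using infinite_arbitrarily_large[OF Y] by blast
  define z where "z = sorted_list_of_set B"
  have z: "sorted_wrt (<) z" "length z = Suc (Suc k)" "set z \<subseteq> Y" using B by (auto simp: z_def)
  have col: "f x = c" if "sorted_wrt (<) x" "length x = Suc k" "set x \<subseteq> Y" for x
  proof -
    have "sorted_list_of_set (set x) = x"
      using that(1) by (simp add: strict_sorted_iff sorted_list_of_set.idem_if_sorted_distinct)
    moreover have "card (set x) = Suc k" using that(1,2) by (simp add: strict_sorted_iff distinct_card)
    ultimately show ?thesis using c[of "set x"] that(3) by simp
  qed
  obtain a w b where zab: "z = a # w @ [b]"
    using z(2) by (metis append_butlast_last_id length_Suc_conv list.size(3) nat.distinct(1) butlast.simps(2))
  have "shift k (butlast z) (tl z)"
    unfolding shift_def using z by (auto simp: zab sorted_wrt_append)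
  then have "f (butlast z) \<noteq> f (tl z)" using f(2) by (simp add: shift_adj_def)
  moreover have "f (butlast z) = c" "f (tl z) = c"
    by (rule col; use z in \<open>auto simp: zab sorted_wrt_append\<close>)+
  ultimately show False by simp
qed

lemma fin_colourable_mono:
  assumes "fin_colourable E Y" "X \<subseteq> Y"
  shows "fin_colourable E X"
proof -
  obtain f N where "\<forall>x\<in>Y. f x < (N :: nat)" "\<forall>x\<in>Y. \<forall>y\<in>Y. E x y \<longrightarrow> f x \<noteq> f y"
    using assms(1) unfolding fin_colourable_def by blast
  then show ?thesis unfolding fin_colourable_def
    by (intro exI[of _ f] exI[of _ N]) (use assms(2) in blast)
qed

lemma fin_colourable_Un:
  assumes "fin_colourable E X" "fin_colourable E Y"
  shows "fin_colourable E (X \<union> Y)"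
proof -
  obtain f N where f: "\<forall>x\<in>X. f x < (N :: nat)" "\<forall>x\<in>X. \<forall>y\<in>X. E x y \<longrightarrow> f x \<noteq> f y"
    using assms(1) unfolding fin_colourable_def by blast
  obtain g M where g: "\<forall>x\<in>Y. g x < (M :: nat)" "\<forall>x\<in>Y. \<forall>y\<in>Y. E x y \<longrightarrow> g x \<noteq> g y"
    using assms(2) unfolding fin_colourable_def by blast
  define c where "c x = (if x \<in> X then f x else N + g x)" for x
  have "c x < N + M" if "x \<in> X \<union> Y" for x
    using that f(1) g(1) by (auto simp: c_def trans_less_add1)
  moreover have "c x \<noteq> c y" if "x \<in> X \<union> Y" "y \<in> X \<union> Y" "E x y" for x y
    using that f g by (cases "x \<in> X"; cases "y \<in> X") (auto simp: c_def)
  ultimately show ?thesis unfolding fin_colourable_def by blast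
qed

text \<open>Finitely colourable sets form a proper ideal. An ultrafilter extending the dual filter
  contains no independent set, as one colour would do for it.\<close>

lemma self_linked_ultra:
  assumes "\<not> fin_colourable E UNIV"
  shows "\<exists>F. ultra F \<and> linked E F F"
proof -
  define G where "G = Abs_filter (\<lambda>P. fin_colourable E {x. \<not> P x})"
  have "is_filter (\<lambda>P. fin_colourable E {x. \<not> P x})"
  proof
    show "fin_colourable E {x. \<not> True}" by (simp add: fin_colourable_def)
    show "fin_colourable E {x. \<not> (P x \<and> Q x)}"
      if "fin_colourable E {x. \<not> P x}" "fin_colourable E {x. \<not> Q x}" for P Q
      by (rule fin_colourable_mono[OF fin_colourable_Un[OF that]]) blast
    show "fin_colourable E {x. \<not> Q x}" if "\<forall>x. P x \<longrightarrow> Q x" "fin_colourable E {x. \<not> P x}" for P Q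
      by (rule fin_colourable_mono[OF that(2)]) (use that(1) in blast)
  qed
  then have G: "eventually P G \<longleftrightarrow> fin_colourable E {x. \<not> P x}" for P
    unfolding G_def by (rule eventually_Abs_filter)
  have "G \<noteq> bot" using assms by (simp add: trivial_limit_def G)
  then obtain F where F: "ultra F" "F \<le> G" using ultra_ex by blast
  have "\<exists>x y. P x \<and> Q y \<and> E x y" if PQ: "eventually P F" "eventually Q F" for P Q
  proof (rule ccontr)
    assume no: "\<not> ?thesis"
    have "fin_colourable E {x. \<not> \<not> (P x \<and> Q x)}"
      unfolding fin_colourable_def by (rule exI[of _ "\<lambda>_. 0"], rule exI[of _ 1]) (use no in auto)
    then have "eventually (\<lambda>x. \<not> (P x \<and> Q x)) F" using filter_leD[OF F(2)] G by blast
    moreover have "eventually (\<lambda>x. P x \<and> Q x) F" using PQ by (rule eventually_conj)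
    ultimately show False using ultra_not_iff[OF F(1)] by blast
  qed
  then show ?thesis using F(1) unfolding linked_def by blast
qed

text \<open>Each given ultrafilter concentrates on one copy, and fewer than n of them miss some copy
  m. A self-linked ultrafilter placed on copy m is linked to all of them by the edges between
  copies.\<close>

lemma palette_join:
  assumes n: "2 < n" and sym: "\<And>x y. E x y \<Longrightarrow> E y x" and E: "\<not> fin_colourable E UNIV"
  shows "palette n (join_adj n E)"
proof
  show "2 < n" by (rule n)
  show "join_adj n E x y \<Longrightarrow> join_adj n E y x" for x y
    unfolding join_adj_def using sym by auto
  show "\<exists>y. join_adj n E x y" for x
  proof (rule exI[of _ "(fst x, Suc (snd x))"])
    have "snd x mod n \<noteq> Suc (snd x) mod n" using n by (simp add: mod_Suc)
    then show "join_adj n E x (fst x, Suc (snd x))" by (simp add: join_adj_def)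
  qed
  fix M :: "('a \<times> nat) filter set"
  assume M: "finite M" "card M < n" "\<And>\<mu>. \<mu> \<in> M \<Longrightarrow> ultra \<mu>"
  have "\<exists>c<n. \<forall>\<^sub>F p in \<mu>. snd p mod n = c" if "\<mu> \<in> M" for \<mu>
  proof -
    have "\<forall>\<^sub>F p in \<mu>. \<exists>c\<in>{..<n}. snd p mod n = c" using n by (intro always_eventually) auto
    then show ?thesis unfolding ultra_bex_iff[OF M(3)[OF that] finite_lessThan] by auto
  qed
  then obtain c where c: "\<And>\<mu>. \<mu> \<in> M \<Longrightarrow> c \<mu> < n" "\<And>\<mu>. \<mu> \<in> M \<Longrightarrow> \<forall>\<^sub>F p in \<mu>. snd p mod n = c \<mu>"
    by metis
  have "card (c ` M) < card {..<n}" using card_image_le[OF M(1), of c] M(2) by simp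
  then have "\<not> {..<n} \<subseteq> c ` M" using card_mono[of "c ` M" "{..<n}"] M(1) by auto
  then obtain m where m: "m < n" "m \<notin> c ` M" by blast
  obtain F where F: "ultra F" "linked E F F" using self_linked_ultra[OF E] by blast
  let ?\<delta> = "filtermap (\<lambda>x. (x, m)) F"
  have "linked (join_adj n E) ?\<delta> ?\<delta>"
    unfolding linked_def eventually_filtermap
  proof (intro allI impI)
    fix P Q assume "\<forall>\<^sub>F x in F. P (x, m)" "\<forall>\<^sub>F x in F. Q (x, m)"
    then obtain x y where "P (x, m)" "Q (y, m)" "E x y" using F(2) unfolding linked_def by blast
    then show "\<exists>x y. P x \<and> Q y \<and> join_adj n E x y" unfolding join_adj_def by fastforce
  qed
  moreover have "linked (join_adj n E) ?\<delta> \<mu>" if \<mu>: "\<mu> \<in> M" for \<mu>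
    unfolding linked_def eventually_filtermap
  proof (intro allI impI)
    fix P Q assume PQ: "\<forall>\<^sub>F x in F. P (x, m)" "\<forall>\<^sub>F x in \<mu>. Q x"
    obtain x where x: "P (x, m)"
      using eventually_happens[OF PQ(1)] F(1) by (auto simp: ultra_def)
    obtain q where q: "Q q" "snd q mod n = c \<mu>"
      using eventually_happens[OF eventually_conj[OF PQ(2) c(2)[OF \<mu>]]] M(3)[OF \<mu>] by (auto simp: ultra_def)
    have "join_adj n E (x, m) q" using q(2) m \<mu> by (auto simp: join_adj_def)
    then show "\<exists>x y. P x \<and> Q y \<and> join_adj n E x y" using x q(1) by blast
  qed
  ultimately show "\<exists>\<delta>. ultra \<delta> \<and> linked (join_adj n E) \<delta> \<delta> \<and> (\<forall>\<mu>\<in>M. linked (join_adj n E) \<delta> \<mu>)"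
    using ultra_filtermap[OF F(1)] by blast
qed

section \<open>Bipartite limits of shift graphs\<close>

text \<open>For almost all \<open>k\<close>, away from its ends \<open>y k\<close> is \<open>x k\<close> moved by \<open>h\<close> places; an edge of the shift graph
  has offset \<open>1\<close> or \<open>-1\<close>, so the parity of the offset from a base point is a proper colouring.\<close>

definition offset :: "nat filter \<Rightarrow> (nat \<Rightarrow> nat list) \<Rightarrow> (nat \<Rightarrow> nat list) \<Rightarrow> int \<Rightarrow> bool" where
  "offset U x y h \<longleftrightarrow> (\<exists>t. \<bar>h\<bar> \<le> t \<and>
     (\<forall>\<^sub>F k in U. \<forall>i. t \<le> i \<longrightarrow> i + t \<le> int k \<longrightarrow> y k ! nat i = x k ! nat (i + h)))"

lemma offset_sym:
  assumes "offset U x y h"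
  shows "offset U y x (- h)"
proof -
  obtain t where t: "\<bar>h\<bar> \<le> t"
    and e: "\<forall>\<^sub>F k in U. \<forall>i. t \<le> i \<longrightarrow> i + t \<le> int k \<longrightarrow> y k ! nat i = x k ! nat (i + h)"
    using assms unfolding offset_def by blast
  show ?thesis unfolding offset_def
  proof (intro exI[of _ "t + \<bar>h\<bar>"] conjI)
    show "\<bar>- h\<bar> \<le> t + \<bar>h\<bar>" using t by simp
    show "\<forall>\<^sub>F k in U. \<forall>i. t + \<bar>h\<bar> \<le> i \<longrightarrow> i + (t + \<bar>h\<bar>) \<le> int k \<longrightarrow> x k ! nat i = y k ! nat (i + - h)"
      using e
    proof eventually_elim
      case (elim k)
      show ?case
      proof (intro allI impI)
        fix i assume "t + \<bar>h\<bar> \<le> i" "i + (t + \<bar>h\<bar>) \<le> int k"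
        then have "t \<le> i - h" "i - h + t \<le> int k" by linarith+
        then have "y k ! nat (i - h) = x k ! nat (i - h + h)" using elim by blast
        then show "x k ! nat i = y k ! nat (i + - h)" by simp
      qed
    qed
  qed
qed

lemma offset_trans:
  assumes "offset U x y h" "offset U y z h'"
  shows "offset U x z (h + h')"
proof -
  obtain t where t: "\<bar>h\<bar> \<le> t"
    and e: "\<forall>\<^sub>F k in U. \<forall>i. t \<le> i \<longrightarrow> i + t \<le> int k \<longrightarrow> y k ! nat i = x k ! nat (i + h)"
    using assms(1) unfolding offset_def by blast
  obtain t' where t': "\<bar>h'\<bar> \<le> t'"
    and e': "\<forall>\<^sub>F k in U. \<forall>i. t' \<le> i \<longrightarrow> i + t' \<le> int k \<longrightarrow> z k ! nat i = y k ! nat (i + h')"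
    using assms(2) unfolding offset_def by blast
  show ?thesis unfolding offset_def
  proof (intro exI[of _ "t + t'"] conjI)
    show "\<bar>h + h'\<bar> \<le> t + t'" using t t' by linarith
    show "\<forall>\<^sub>F k in U. \<forall>i. t + t' \<le> i \<longrightarrow> i + (t + t') \<le> int k \<longrightarrow> z k ! nat i = x k ! nat (i + (h + h'))"
      using e e'
    proof eventually_elim
      case (elim k)
      show ?case
      proof (intro allI impI)
        fix i assume i: "t + t' \<le> i" "i + (t + t') \<le> int k"
        have "z k ! nat i = y k ! nat (i + h')" using elim(2) i t by auto
        moreover have "y k ! nat (i + h') = x k ! nat (i + h' + h)"
          using elim(1)[rule_format, of "i + h'"] i t' by linarith
        ultimately show "z k ! nat i = x k ! nat (i + (h + h'))" by (simp add: algebra_simps)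
      qed
    qed
  qed
qed

text \<open>Increasing sequences have no repetitions. This makes the offset between two given
  sequences of the graph unique.\<close>

lemma offset_self:
  assumes U: "ultra U" "U \<le> at_top" and x: "\<forall>\<^sub>F k in U. length (x k) = Suc k \<and> sorted_wrt (<) (x k)"
    and o: "offset U x x h"
  shows "h = 0"
proof -
  obtain t where t: "\<bar>h\<bar> \<le> t"
    and e: "\<forall>\<^sub>F k in U. \<forall>i. t \<le> i \<longrightarrow> i + t \<le> int k \<longrightarrow> x k ! nat i = x k ! nat (i + h)"
    using o unfolding offset_def by blast
  \<comment> \<open>From this bound on, index \<open>t\<close> is far enough from both ends.\<close>
  have "\<forall>\<^sub>F k in U. nat (2 * t) \<le> k" by (rule filter_leD[OF U(2) eventually_ge_at_top])
  with e x have "\<forall>\<^sub>F k in U. h = 0"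
  proof eventually_elim
    case (elim k)
    have "x k ! nat t = x k ! nat (t + h)" using elim(1,3) by auto
    moreover have "nat t < length (x k)" "nat (t + h) < length (x k)" using elim(2,3) t by auto
    moreover have "distinct (x k)" using elim(2) by (simp add: strict_sorted_iff)
    ultimately have "nat t = nat (t + h)" using nth_eq_iff_index_eq by metis
    then show ?case using t by linarith
  qed
  then show ?thesis using U(1) by (simp add: ultra_def eventually_const_iff)
qed

lemma offset_shift:
  assumes "\<forall>\<^sub>F k in U. shift k (x k) (y k)"
  shows "offset U x y 1"
  unfolding offset_def
proof (intro exI[of _ 1] conjI)
  show "\<forall>\<^sub>F k in U. \<forall>i. 1 \<le> i \<longrightarrow> i + 1 \<le> int k \<longrightarrow> y k ! nat i = x k ! nat (i + 1)"
    using assms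
  proof eventually_elim
    case (elim k)
    show ?case
    proof (intro allI impI)
      fix i :: int assume i: "1 \<le> i" "i + 1 \<le> int k"
      have "y k ! nat i = butlast (y k) ! nat i" using i elim by (simp add: nth_butlast shift_def)
      also have "\<dots> = tl (x k) ! nat i" using elim by (simp add: shift_def)
      also have "\<dots> = x k ! Suc (nat i)" using i elim by (subst nth_tl) (auto simp: shift_def)
      finally show "y k ! nat i = x k ! nat (i + 1)" using i by (simp add: nat_add_distrib)
    qed
  qed
qed simp

text \<open>\<open>r x\<close> depends only on which sequences have an offset to \<open>x\<close>,
  so adjacent sequences share it. Composing offsets along an edge and back through the base point
  gives an offset of a sequence to itself, which must be 0.\<close>

lemma shift_limit_colouring:
  assumes U: "ultra U" "U \<le> at_top"
  shows "\<exists>col :: (nat \<Rightarrow> nat list) \<Rightarrow> bool.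
    \<forall>x y. (\<forall>\<^sub>F k in U. shift_adj k (x k) (y k)) \<longrightarrow> col x \<noteq> col y"
proof -
  define r where "r x = (SOME z. \<exists>h. offset U z x h)" for x
  define g where "g x = (SOME h. offset U (r x) x h)" for x
  have refl: "offset U x x 0" for x unfolding offset_def by (intro exI[of _ 0]) simp
  have g: "offset U (r x) x (g x)" for x
    unfolding g_def r_def by (rule someI_ex, rule someI[of "\<lambda>z. \<exists>h. offset U z x h" x]) (use refl in blast)
  have main: "odd (g x + g y)" if e: "\<forall>\<^sub>F k in U. shift k (x k) (y k)" for x y
  proof -
    have o: "offset U x y 1" by (rule offset_shift[OF e])
    have "(\<exists>h. offset U z x h) \<longleftrightarrow> (\<exists>h. offset U z y h)" for z
      using offset_trans[OF _ o] offset_trans[OF _ offset_sym[OF o]] by blast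
    then have r: "r x = r y" by (simp add: r_def)
    have "offset U y y (- (g x + 1) + g y)"
      using offset_trans[OF offset_sym[OF offset_trans[OF g[of x] o]]] g[of y] r by metis
    moreover have "\<forall>\<^sub>F k in U. length (y k) = Suc k \<and> sorted_wrt (<) (y k)"
      using e by eventually_elim (simp add: shift_def)
    ultimately have "- (g x + 1) + g y = 0" by (intro offset_self[OF U])
    then have "g y = g x + 1" by simp
    then show ?thesis by simp
  qed
  show ?thesis
  proof (intro exI[of _ "\<lambda>x. even (g x)"] allI impI)
    fix x y assume "\<forall>\<^sub>F k in U. shift_adj k (x k) (y k)"
    then have "odd (g x + g y) \<or> odd (g y + g x)"
      unfolding shift_adj_def ultra_disj_iff[OF U(1)] using main by blast
    then show "even (g x) \<noteq> even (g y)" by auto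
  qed
qed

section \<open>Ultraproducts\<close>

lemma typs_UNIV_iff: "tp n L t \<in> typs n UNIV adj \<longleftrightarrow> linked_facets n adj L t"
proof
  assume "tp n L t \<in> typs n UNIV adj"
  then obtain L' and t' :: "nat \<Rightarrow> nat" where eq: "tp n L t = tp n L' t'" and l: "linked_facets n adj L' t'"
    unfolding typs_def by blast
  have inj: "inj_on t {..<n} \<longleftrightarrow> inj_on t' {..<n}" using eq inj_on_ker unfolding tp_eq_iff by blast
  have "L (facet n t i) = L' (facet n t' i)" if "inj_on t {..<n}" "i < n" for i
    using eq that unfolding tp_eq_iff nondeg_def by (meson Diff_subset inj_on_subset)
  note L = this
  show "linked_facets n adj L t"
    unfolding linked_facets_def
  proof
    assume "inj_on t {..<n}"
    moreover from this obtain i j where "i < n" "j < n" "adj (L' (facet n t' i)) (L' (facet n t' j))"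
      using l inj unfolding linked_facets_def by blast
    ultimately show "\<exists>i<n. \<exists>j<n. adj (L (facet n t i)) (L (facet n t j))"
      using L[of i] L[of j] by metis
  qed
qed (intro tp_typs, auto)

text \<open>The label of a set of values of \<open>t\<close> is read off at the positions that carry
  them, so tuples with equal kernels can replace each other.\<close>

lemma tp_retarget:
  assumes "ker n t = ker n t'"
  obtains L' where "tp n L' t = tp n L t'"
proof -
  define L' where "L' F = L (t' ` {j \<in> {..<n}. t j \<in> F})" for F
  have "t' ` {j \<in> {..<n}. t j \<in> facet n t i} = facet n t' i" for i
    using assms unfolding facet_def ker_eq_iff by (auto simp: image_iff)
  then have "tp n L' t = tp n L t'" unfolding tp_eq_iff using assms by (simp add: L'_def)
  then show thesis by (rule that)
qed

locale ultraproduct =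
  fixes n :: nat and adj :: "nat \<Rightarrow> 'w \<Rightarrow> 'w \<Rightarrow> bool" and U :: "nat filter"
  assumes n: "2 < n" and U: "ultra U" and edges: "\<exists>x y. adj k x y"
begin

text \<open>A canonical representative of the class modulo \<open>U\<close>; the ultraproduct of the
  vertex sets is \<open>range r\<close>, without a quotient type.\<close>

definition r :: "(nat \<Rightarrow> 'w) \<Rightarrow> nat \<Rightarrow> 'w" where
  "r x = (SOME y. \<forall>\<^sub>F k in U. x k = y k)"

lemma r_eventually: "\<forall>\<^sub>F k in U. x k = r x k"
  unfolding r_def by (rule someI[of "\<lambda>y. \<forall>\<^sub>F k in U. x k = y k" x]) simp

lemma r_eq_iff: "r x = r y \<longleftrightarrow> (\<forall>\<^sub>F k in U. x k = y k)"
proof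
  assume "r x = r y"
  then show "\<forall>\<^sub>F k in U. x k = y k" using r_eventually[of x] r_eventually[of y]
    by (auto elim: eventually_elim2)
next
  assume e: "\<forall>\<^sub>F k in U. x k = y k"
  have "(\<forall>\<^sub>F k in U. x k = z k) \<longleftrightarrow> (\<forall>\<^sub>F k in U. y k = z k)" for z
    by (rule eventually_subst) (use e in \<open>eventually_elim, simp\<close>)
  then show "r x = r y" by (simp add: r_def)
qed

lemma r_r: "r (r x) = r x"
  unfolding r_eq_iff using r_eventually[of x] by eventually_elim simp

definition ladj :: "(nat \<Rightarrow> 'w) \<Rightarrow> (nat \<Rightarrow> 'w) \<Rightarrow> bool" where
  "ladj x y \<longleftrightarrow> (\<forall>\<^sub>F k in U. adj k (x k) (y k))"

lemma ladj_r: "ladj (r x) (r y) \<longleftrightarrow> ladj x y"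
  unfolding ladj_def
proof (rule eventually_subst)
  show "\<forall>\<^sub>F k in U. adj k (r x k) (r y k) = adj k (x k) (y k)"
    using r_eventually[of x] r_eventually[of y] by eventually_elim simp
qed

lemma typs_nonempty: "\<exists>a. a \<in> typs n UNIV (adj k)"
proof -
  obtain x y where "adj k x y" using edges by blast
  then show ?thesis using typs_ex[OF n UNIV_I UNIV_I, of "adj k" x y] by blast
qed

definition limL :: "(nat \<Rightarrow> 'u set \<Rightarrow> 'w) \<Rightarrow> 'u set \<Rightarrow> nat \<Rightarrow> 'w" where
  "limL L F = r (\<lambda>k. L k F)"

text \<open>The passage from a sequence of types to a type of the limit: one tuple \<open>t\<close>
  serves almost all k, and labels go to their classes.\<close>

definition Lim :: "(nat \<Rightarrow> 'w tuple_type) \<Rightarrow> (nat \<Rightarrow> 'w) tuple_type \<Rightarrow> bool" where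
  "Lim a b \<longleftrightarrow> (\<exists>L (t :: nat \<Rightarrow> nat). (\<forall>\<^sub>F k in U. a k = tp n (L k) t) \<and> b = tp n (limL L) t)"

lemma ev_all_less: "(\<forall>\<^sub>F k in U. \<forall>i<n. P i k) \<longleftrightarrow> (\<forall>i<n. \<forall>\<^sub>F k in U. P i k)"
  using eventually_ball_finite_distrib[of "{..<n}" "\<lambda>k i. P i k" U] unfolding Ball_def lessThan_iff by simp

lemma ev_ex_less: "(\<forall>\<^sub>F k in U. \<exists>i<n. P i k) \<longleftrightarrow> (\<exists>i<n. \<forall>\<^sub>F k in U. P i k)"
  using ultra_bex_iff[OF U, of "{..<n}" P] unfolding Bex_def lessThan_iff by simp

lemma ev_const: "(\<forall>\<^sub>F k in U. P) \<longleftrightarrow> P"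
  using U by (simp add: ultra_def eventually_const_iff)

lemma ev_imp_const: "(\<forall>\<^sub>F k in U. P \<longrightarrow> Q k) \<longleftrightarrow> (P \<longrightarrow> (\<forall>\<^sub>F k in U. Q k))"
  by (cases P) auto

lemma lim_tp_eq_iff: "tp n (limL L) t = tp n (limL L') t' \<longleftrightarrow> (\<forall>\<^sub>F k in U. tp n (L k) t = tp n (L' k) t')"
  unfolding tp_eq_iff limL_def r_eq_iff eventually_conj_iff ev_const ev_all_less ev_imp_const ..

lemma lim_face_eq_iff:
  assumes "i < n"
  shows "face i (tp n (limL L) t) = face i (tp n (limL L') t')
    \<longleftrightarrow> (\<forall>\<^sub>F k in U. face i (tp n (L k) t) = face i (tp n (L' k) t'))"
  unfolding face_tp_eq_iff[OF assms] limL_def r_eq_iff eventually_conj_iff ev_const ev_imp_const ..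

lemma Lim_eq_iff:
  assumes "Lim a b" "Lim a' b'"
  shows "b = b' \<longleftrightarrow> (\<forall>\<^sub>F k in U. a k = a' k)"
proof -
  obtain L L' and t t' :: "nat \<Rightarrow> nat" where b: "b = tp n (limL L) t" "b' = tp n (limL L') t'"
    and e: "\<forall>\<^sub>F k in U. a k = tp n (L k) t" "\<forall>\<^sub>F k in U. a' k = tp n (L' k) t'"
    using assms unfolding Lim_def by blast
  have "(\<forall>\<^sub>F k in U. a k = a' k) \<longleftrightarrow> (\<forall>\<^sub>F k in U. tp n (L k) t = tp n (L' k) t')"
    by (rule eventually_subst) (use e in \<open>eventually_elim, simp\<close>)
  then show ?thesis unfolding b lim_tp_eq_iff by simp
qed

lemma Lim_Rel:
  assumes "Lim a b" "Lim a' b'" and f: "f \<in> uops T n"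
  shows "Rel (eta n V ladj) f b b' \<longleftrightarrow> (\<forall>\<^sub>F k in U. Rel (eta n V' (adj k)) f (a k) (a' k))"
proof -
  obtain L L' and t t' :: "nat \<Rightarrow> nat" where b: "b = tp n (limL L) t" "b' = tp n (limL L') t'"
    and e: "\<forall>\<^sub>F k in U. a k = tp n (L k) t" "\<forall>\<^sub>F k in U. a' k = tp n (L' k) t'"
    using assms unfolding Lim_def by blast
  have *: "(\<forall>\<^sub>F k in U. Rel (eta n V' (adj k)) f (a k) (a' k)) \<longleftrightarrow>
      (\<forall>\<^sub>F k in U. Rel (eta n V' (adj k)) f (tp n (L k) t) (tp n (L' k) t'))"
    by (rule eventually_subst) (use e in \<open>eventually_elim, simp\<close>)
  show ?thesis unfolding * b
  proof (cases f)
    case (Cyl i)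
    then have "i < n" using f by (auto simp: uops_def split: if_splits)
    then show "Rel (eta n V ladj) f (tp n (limL L) t) (tp n (limL L') t') \<longleftrightarrow>
      (\<forall>\<^sub>F k in U. Rel (eta n V' (adj k)) f (tp n (L k) t) (tp n (L' k) t'))"
      by (simp add: Cyl eta_def lim_face_eq_iff)
  next
    case (Repl i j)
    then have "i < n" "j < n" using f by (auto simp: uops_def split: if_splits)
    then show "Rel (eta n V ladj) f (tp n (limL L) t) (tp n (limL L') t') \<longleftrightarrow>
      (\<forall>\<^sub>F k in U. Rel (eta n V' (adj k)) f (tp n (L k) t) (tp n (L' k) t'))"
      by (simp add: Repl eta_def subst_tp_iff[OF uops_maps(1)] lim_tp_eq_iff)
  next
    case (Transp i j)
    then have "i < n" "j < n" using f by (auto simp: uops_def split: if_splits)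
    then show "Rel (eta n V ladj) f (tp n (limL L) t) (tp n (limL L') t') \<longleftrightarrow>
      (\<forall>\<^sub>F k in U. Rel (eta n V' (adj k)) f (tp n (L k) t) (tp n (L' k) t'))"
      by (simp add: Transp eta_def subst_tp_iff[OF uops_maps(2)] lim_tp_eq_iff)
  qed
qed

lemma Lim_DRel:
  assumes "Lim a b"
  shows "DRel (eta n V ladj) i j b \<longleftrightarrow> (\<forall>\<^sub>F k in U. DRel (eta n V' (adj k)) i j (a k))"
proof -
  obtain L and t :: "nat \<Rightarrow> nat" where b: "b = tp n (limL L) t" and e: "\<forall>\<^sub>F k in U. a k = tp n (L k) t"
    using assms unfolding Lim_def by blast
  have *: "(\<forall>\<^sub>F k in U. DRel (eta n V' (adj k)) i j (a k)) \<longleftrightarrow> (\<forall>\<^sub>F k in U. (i, j) \<in> ker n t)"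
    by (rule eventually_subst) (use e in \<open>eventually_elim, simp add: eta_def tp_def\<close>)
  show ?thesis unfolding * ev_const b by (simp add: eta_def tp_def)
qed

lemma linked_limL:
  fixes t :: "nat \<Rightarrow> nat"
  shows "linked_facets n ladj (limL L) t \<longleftrightarrow> (\<forall>\<^sub>F k in U. linked_facets n (adj k) (L k) t)"
  unfolding linked_facets_def ev_imp_const ev_ex_less limL_def ladj_r by (simp add: ladj_def ev_ex_less)

definition "LV = range r"

text \<open>There are finitely many kernels, so one occurs almost everywhere, and the types with
  that kernel can be rewritten over one tuple.\<close>

lemma Lim_left_total:
  assumes a: "\<And>k. a k \<in> typs n UNIV (adj k)"
  shows "\<exists>b\<in>typs n LV ladj. Lim a b"
proof -
  have "\<exists>L (t :: nat \<Rightarrow> nat). a k = tp n L t" for k using a[of k] unfolding typs_def by blast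
  then obtain L and t :: "nat \<Rightarrow> nat \<Rightarrow> nat" where at: "\<And>k. a k = tp n (L k) (t k)" by metis
  have "\<forall>\<^sub>F k in U. \<exists>K\<in>Pow ({..<n} \<times> {..<n}). ker n (t k) = K"
    by (intro always_eventually) (auto simp: ker_def)
  then obtain K where K: "\<forall>\<^sub>F k in U. ker n (t k) = K"
    by (subst (asm) ultra_bex_iff[OF U]) auto
  then obtain k0 where k0: "ker n (t k0) = K"
    using eventually_happens[OF K] U by (auto simp: ultra_def)
  have "\<exists>L'. ker n (t k) = K \<longrightarrow> tp n L' (t k0) = a k" for k
    using tp_retarget[of n "t k0" "t k" "L k"] k0 at by metis
  then obtain L' where L': "\<And>k. ker n (t k) = K \<Longrightarrow> tp n (L' k) (t k0) = a k" by metis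
  have e: "\<forall>\<^sub>F k in U. a k = tp n (L' k) (t k0)"
    using K by eventually_elim (use L' in simp)
  then have "\<forall>\<^sub>F k in U. linked_facets n (adj k) (L' k) (t k0)"
  proof eventually_elim
    case (elim k)
    then show ?case using a[of k] by (simp add: typs_UNIV_iff)
  qed
  then have "tp n (limL L') (t k0) \<in> typs n LV ladj"
    by (intro tp_typs) (auto simp: linked_limL LV_def limL_def)
  then show ?thesis using e unfolding Lim_def by blast
qed

lemma Lim_right_total:
  assumes b: "b \<in> typs n LV ladj"
  shows "\<exists>a. (\<forall>k. a k \<in> typs n UNIV (adj k)) \<and> Lim a b"
proof -
  obtain L and t :: "nat \<Rightarrow> nat" where bt: "b = tp n L t" "range L \<subseteq> LV" "linked_facets n ladj L t"
    using b unfolding typs_def by blast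
  define L' where "L' k F = L F k" for k F
  have "limL L' = L"
  proof
    fix F
    have "L F \<in> range r" using bt(2) unfolding LV_def by blast
    then have "r (L F) = L F" using r_r by auto
    then show "limL L' F = L F" by (simp add: limL_def L'_def)
  qed
  then have b': "b = tp n (limL L') t" and l: "\<forall>\<^sub>F k in U. linked_facets n (adj k) (L' k) t"
    using bt linked_limL[of L' t] by simp_all
  obtain c where c: "\<And>k. c k \<in> typs n UNIV (adj k)" using typs_nonempty by metis
  \<comment> \<open>The labelling is legal only for almost all k; \<open>c\<close> fills the other
    indices.\<close>
  define a where "a k = (if linked_facets n (adj k) (L' k) t then tp n (L' k) t else c k)" for k
  have "a k \<in> typs n UNIV (adj k)" for k using c by (simp add: a_def typs_UNIV_iff)
  moreover have "\<forall>\<^sub>F k in U. a k = tp n (L' k) t" using l by eventually_elim (simp add: a_def)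
  ultimately show ?thesis using b' unfolding Lim_def by blast
qed

text \<open>\<open>Lim\<close> plays the part of the map from sequences to classes: it respects
  atomic formulas, and its totality on both sides carries the quantifier.\<close>

lemma Los:
  assumes "in_language T n p" "\<And>x. Lim (v x) (w x)"
  shows "sat (eta n LV ladj) w p \<longleftrightarrow> (\<forall>\<^sub>F k in U. sat (eta n UNIV (adj k)) (\<lambda>x. v x k) p)"
  using assms
proof (induction p arbitrary: v w)
  case (Eq x y)
  then show ?case by (simp add: Lim_eq_iff)
next
  case (RelF f x y)
  have "Rel (eta n LV ladj) f (w x) (w y) \<longleftrightarrow> (\<forall>\<^sub>F k in U. Rel (eta n UNIV (adj k)) f (v x k) (v y k))"
    by (rule Lim_Rel[of _ _ _ _ _ T]) (use RelF in auto)
  then show ?case by simp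
next
  case (DiagF i j x)
  show ?case using Lim_DRel[OF DiagF.prems(2)] by simp
next
  case (Neg p)
  have "sat (eta n LV ladj) w p \<longleftrightarrow> (\<forall>\<^sub>F k in U. sat (eta n UNIV (adj k)) (\<lambda>x. v x k) p)"
    by (rule Neg.IH) (use Neg.prems in auto)
  then show ?case using ultra_not_iff[OF U] by simp
next
  case (Conj p q)
  have "sat (eta n LV ladj) w p \<longleftrightarrow> (\<forall>\<^sub>F k in U. sat (eta n UNIV (adj k)) (\<lambda>x. v x k) p)"
    by (rule Conj.IH(1)) (use Conj.prems in auto)
  moreover have "sat (eta n LV ladj) w q \<longleftrightarrow> (\<forall>\<^sub>F k in U. sat (eta n UNIV (adj k)) (\<lambda>x. v x k) q)"
    by (rule Conj.IH(2)) (use Conj.prems in auto)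
  ultimately show ?case by (simp add: eventually_conj_iff)
next
  case (All x p)
  have IH: "sat (eta n LV ladj) (w(x := b)) p \<longleftrightarrow> (\<forall>\<^sub>F k in U. sat (eta n UNIV (adj k)) ((\<lambda>x. v x k)(x := a k)) p)"
    if "Lim a b" for a b
  proof -
    have "sat (eta n LV ladj) (w(x := b)) p \<longleftrightarrow> (\<forall>\<^sub>F k in U. sat (eta n UNIV (adj k)) (\<lambda>y. (v(x := a)) y k) p)"
      by (rule All.IH) (use All.prems that in auto)
    moreover have "(\<lambda>y. (v(x := a)) y k) = (\<lambda>x. v x k)(x := a k)" for k by auto
    ultimately show ?thesis by simp
  qed
  have Uni: "Uni (eta n V E) = typs n V E" for V E by (simp add: eta_def)
  show ?case
  proof
    assume l: "sat (eta n LV ladj) w (All x p)"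
    \<comment> \<open>A counterexample is picked at each k that has one; the limit of the picked
      elements tests the universal formula.\<close>
    define bad where "bad k a \<longleftrightarrow> a \<in> typs n UNIV (adj k) \<and> \<not> sat (eta n UNIV (adj k)) ((\<lambda>x. v x k)(x := a)) p" for k a
    have "\<exists>a. a \<in> typs n UNIV (adj k) \<and> ((\<exists>a. bad k a) \<longrightarrow> bad k a)" for k
      using typs_nonempty[of k] unfolding bad_def by blast
    then obtain a where a: "\<And>k. a k \<in> typs n UNIV (adj k)" "\<And>k. (\<exists>a. bad k a) \<Longrightarrow> bad k (a k)" by metis
    obtain b where b: "b \<in> typs n LV ladj" "Lim a b" using Lim_left_total[OF a(1)] by blast
    then have "\<forall>\<^sub>F k in U. sat (eta n UNIV (adj k)) ((\<lambda>x. v x k)(x := a k)) p"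
      using l IH[OF b(2)] by (simp add: Uni)
    then show "\<forall>\<^sub>F k in U. sat (eta n UNIV (adj k)) (\<lambda>x. v x k) (All x p)"
    proof eventually_elim
      case (elim k)
      then have "\<not> bad k (a k)" by (simp add: bad_def)
      then have "\<not> (\<exists>a. bad k a)" using a(2) by blast
      then show ?case unfolding sat.simps Uni bad_def by blast
    qed
  next
    assume e: "\<forall>\<^sub>F k in U. sat (eta n UNIV (adj k)) (\<lambda>x. v x k) (All x p)"
    show "sat (eta n LV ladj) w (All x p)"
      unfolding sat.simps Uni
    proof
      fix b assume "b \<in> typs n LV ladj"
      then obtain a where a: "\<And>k. a k \<in> typs n UNIV (adj k)" "Lim a b" using Lim_right_total by blast
      have "\<forall>\<^sub>F k in U. sat (eta n UNIV (adj k)) ((\<lambda>x. v x k)(x := a k)) p"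
        using e by eventually_elim (use a(1) in \<open>simp add: Uni\<close>)
      then show "sat (eta n LV ladj) (w(x := b)) p" using IH[OF a(2)] by simp
    qed
  qed
qed

end

section \<open>Isomorphic atom structures\<close>

lemma atstr_copy:
  fixes S :: "'b atstr" and g :: "'b \<Rightarrow> 'a"
  assumes "inj g"
  obtains S' where "atstr_iso T n S S' g"
proof
  show "atstr_iso T n S \<lparr>Uni = g ` Uni S, Rel = (\<lambda>f x y. Rel S f (inv g x) (inv g y)),
      DRel = (\<lambda>i j x. DRel S i j (inv g x))\<rparr> g"
    using assms by (simp add: atstr_iso_def bij_betw_def inj_on_subset[of g UNIV] split_beta)
qed

lemma sat_iso:
  assumes iso: "atstr_iso T n S S' g" and "in_language T n p" "range v \<subseteq> Uni S"
  shows "sat S v p \<longleftrightarrow> sat S' (g \<circ> v) p"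
  using assms(2,3)
proof (induction p arbitrary: v)
  case (Eq x y)
  have "inj_on g (Uni S)" using iso by (simp add: atstr_iso_def bij_betw_def)
  moreover have "v x \<in> Uni S" "v y \<in> Uni S" using Eq.prems by auto
  ultimately show ?case by (auto simp: inj_on_def)
next
  case (All x p)
  have g: "g ` Uni S = Uni S'" using iso by (simp add: atstr_iso_def bij_betw_def)
  have "sat S (v(x := a)) p \<longleftrightarrow> sat S' ((g \<circ> v)(x := g a)) p" if "a \<in> Uni S" for a
  proof -
    have "sat S (v(x := a)) p \<longleftrightarrow> sat S' (g \<circ> v(x := a)) p"
      by (rule All.IH) (use All.prems that in auto)
    then show ?thesis by (simp add: fun_upd_comp)
  qed
  then show ?case unfolding sat.simps g[symmetric] by simp
qed (use iso in \<open>auto simp: atstr_iso_def image_subset_iff\<close>)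

lemma sat_cong: "(\<And>x. x \<in> fv p \<Longrightarrow> v x = w x) \<Longrightarrow> sat S v p \<longleftrightarrow> sat S w p"
proof (induction p arbitrary: v w)
  case (All x p)
  have "sat S (v(x := a)) p \<longleftrightarrow> sat S (w(x := a)) p" for a
    by (rule All.IH) (use All.prems in auto)
  then show ?case by simp
next
  case (Neg p)
  have "sat S v p \<longleftrightarrow> sat S w p" by (rule Neg.IH) (use Neg.prems in auto)
  then show ?case by simp
next
  case (Conj p q)
  have "sat S v p \<longleftrightarrow> sat S w p" by (rule Conj.IH(1)) (use Conj.prems in auto)
  moreover have "sat S v q \<longleftrightarrow> sat S w q" by (rule Conj.IH(2)) (use Conj.prems in auto)
  ultimately show ?case by simp
qed simp_all

lemma models_iff:
  assumes "\<And>p. p \<in> \<Sigma> \<Longrightarrow> sentence T n p"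
  shows "models S \<Sigma> \<longleftrightarrow> (\<forall>p\<in>\<Sigma>. sat S v p)"
  unfolding models_def using sat_cong[of _ v _ S] assms unfolding sentence_def by blast

lemma models_iso:
  assumes iso: "atstr_iso T n S S' g" and ne: "Uni S \<noteq> {}" and \<Sigma>: "\<And>p. p \<in> \<Sigma> \<Longrightarrow> sentence T n p"
  shows "models S \<Sigma> \<longleftrightarrow> models S' \<Sigma>"
proof -
  obtain a where a: "a \<in> Uni S" using ne by blast
  have "sat S (\<lambda>_. a) p \<longleftrightarrow> sat S' (g \<circ> (\<lambda>_. a)) p" if "p \<in> \<Sigma>" for p
    by (rule sat_iso[OF iso]) (use \<Sigma>[OF that] a in \<open>auto simp: sentence_def\<close>)
  then show ?thesis 
    using models_iff[OF \<Sigma>, where S = S and v = "\<lambda>_. a"]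
      models_iff[OF \<Sigma>, where S = S' and v = "g \<circ> (\<lambda>_. a)"] by blast
qed

lemma atstr_iso_sym:
  assumes iso: "atstr_iso T n S S' g"
  shows "atstr_iso T n S' S (inv_into (Uni S) g)"
proof -
  let ?g = "inv_into (Uni S) g"
  have bij: "bij_betw g (Uni S) (Uni S')" using iso by (simp add: atstr_iso_def)
  have g: "?g y \<in> Uni S" "g (?g y) = y" if "y \<in> Uni S'" for y
    using bij_betw_inv_into[OF bij] that bij_betw_inv_into_right[OF bij] by (auto simp: bij_betw_def)
  show ?thesis unfolding atstr_iso_def
  proof (intro conjI ballI)
    show "bij_betw ?g (Uni S') (Uni S)" by (rule bij_betw_inv_into[OF bij])
    fix f x y assume f: "f \<in> uops T n" and xy: "x \<in> Uni S'" "y \<in> Uni S'"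
    then have "Rel S f (?g x) (?g y) \<longleftrightarrow> Rel S' f (g (?g x)) (g (?g y))"
      using iso g(1)[OF xy(1)] g(1)[OF xy(2)] unfolding atstr_iso_def by blast
    then show "Rel S' f x y \<longleftrightarrow> Rel S f (?g x) (?g y)" using g(2) xy by simp
  next
    fix ij assume "ij \<in> diags T n"
    then show "case ij of (i, j) \<Rightarrow> \<forall>x\<in>Uni S'. DRel S' i j x \<longleftrightarrow> DRel S i j (?g x)"
      using iso g unfolding atstr_iso_def by fastforce
  qed
qed

text \<open>The atoms of \<open>Cm S'\<close> form a copy of \<open>S\<close>, so
  \<open>Cm S'\<close> embeds into \<open>Cm S\<close>; \<open>representableI\<close> absorbs the
  change of types.\<close>

lemma representable_iso:
  assumes iso: "atstr_iso T n S S' g" and rep: "representable T n (Cm S)"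
  shows "representable T n (Cm S')"
proof -
  have "atstr_iso T n S (At (Cm S')) (\<lambda>x. {g x})"
  proof -
    have a: "atstr_iso T n S' (At (Cm S')) (\<lambda>x. {x})" by (rule At_Cm)
    have g: "g x \<in> Uni S'" if "x \<in> Uni S" for x using iso that by (auto simp: atstr_iso_def bij_betw_def)
    have "bij_betw ((\<lambda>x. {x}) \<circ> g) (Uni S) (Uni (At (Cm S')))"
      using iso a unfolding atstr_iso_def by (meson bij_betw_trans)
    then show ?thesis using iso a g unfolding atstr_iso_def by (auto simp: comp_def split_beta)
  qed
  note e = alg_embedding_Cm[OF Cm_algebra Cm_atomic this]
  obtain I :: "('a set \<times> 'a set) set" and U :: "'a set \<times> 'a set \<Rightarrow> nat \<Rightarrow> (nat + 'a set) list set" and h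
    where adm: "\<forall>k\<in>I. admissible_bases T n (U k)"
      and h: "alg_embedding T n (Cm S) (prod_alg I (\<lambda>k. set_alg n (U k))) h"
    using rep unfolding representable_def by (elim exE conjE)
  show ?thesis
    by (rule representableI[OF Cm_algebra _ alg_embedding_comp[OF e h]]) (use adm in blast)
qed

section \<open>The theorem\<close>

lemma Inl_Inr_image_eq:
  assumes "Inl ` X \<union> Inr ` Y = Inl ` X' \<union> Inr ` Y'"
  shows "X = X'" "Y = Y'"
proof -
  have "Inl -` (Inl ` X \<union> Inr ` Y) = X" "Inr -` (Inl ` X \<union> Inr ` Y) = Y" for X :: "'x set" and Y :: "'y set"
    by auto
  then show "X = X'" "Y = Y'" using assms by metis+
qed

lemma inj_code_countable:
  "\<exists>c :: ('w :: countable) tuple_type \<Rightarrow> nat set. inj c"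
proof
  let ?c = "\<lambda>a :: 'w tuple_type. to_nat ` (Inl ` fst a \<union> Inr ` {(i, y). snd a i = Some y})"
  show "inj ?c"
  proof (rule injI)
    fix a b :: "'w tuple_type" assume "?c a = ?c b"
    then have "Inl ` fst a \<union> Inr ` {(i, y). snd a i = Some y} = Inl ` fst b \<union> Inr ` {(i, y). snd b i = Some y}"
      by (simp only: inj_image_eq_iff[OF inj_to_nat])
    from Inl_Inr_image_eq[OF this]
    have 1: "fst a = fst b" "{(i, y). snd a i = Some y} = {(i, y). snd b i = Some y}" .
    have "snd a i = Some y \<longleftrightarrow> snd b i = Some y" for i y using 1(2) unfolding set_eq_iff by auto
    then have "snd a i = snd b i" for i by (metis option.exhaust)
    then show "a = b" using 1(1) by (auto simp: prod_eq_iff)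
  qed
qed

text \<open>A label in the limit is a sequence and is coded by its graph, which keeps the
  ultraproduct within the continuum. \<open>None\<close> gives an empty graph, a sequence never
  does.\<close>

lemma inj_code_sequences:
  "\<exists>c :: (nat \<Rightarrow> 'w :: countable) tuple_type \<Rightarrow> nat set. inj c"
proof
  let ?s = "\<lambda>K :: nat \<Rightarrow> (nat \<Rightarrow> 'w) option. {(i, k, y). \<exists>x. K i = Some x \<and> x k = y}"
  let ?c = "\<lambda>a :: (nat \<Rightarrow> 'w) tuple_type. to_nat ` (Inl ` fst a \<union> Inr ` ?s (snd a))"
  show "inj ?c"
  proof (rule injI)
    fix a b :: "(nat \<Rightarrow> 'w) tuple_type" assume "?c a = ?c b"
    then have "Inl ` fst a \<union> Inr ` ?s (snd a) = Inl ` fst b \<union> Inr ` ?s (snd b)"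
      by (simp only: inj_image_eq_iff[OF inj_to_nat])
    from Inl_Inr_image_eq[OF this] have eq: "fst a = fst b" "?s (snd a) = ?s (snd b)" .
    have 1: "(i, k, y) \<in> ?s (snd a) \<longleftrightarrow> (i, k, y) \<in> ?s (snd b)" for i k y
      unfolding eq(2) ..
    have "snd a i = snd b i" for i
    proof (cases "snd a i")
      case None
      then have "snd b i \<noteq> Some x" for x using 1[of i 0 "x 0"] by auto
      then show ?thesis using None by (metis option.exhaust)
    next
      case (Some x)
      then obtain z where z: "snd b i = Some z" using 1[of i 0 "x 0"] by auto
      have "x k = z k" for k using 1[of i k "x k"] Some z by auto
      then show ?thesis using Some z by auto
    qed
    then show "a = b" using eq(1) by (auto simp: prod_eq_iff)
  qed
qed

theorem theorem6p12:
  fixes T :: signature and n :: nat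
  assumes "2 < n"
    and "\<exists>f :: nat set \<Rightarrow> 'a. inj f"
  shows "\<not> elementary T n (strongly_representable T n :: 'a atstr \<Rightarrow> bool)"
proof
  note n = assms(1)
  assume "elementary T n (strongly_representable T n :: 'a atstr \<Rightarrow> bool)"
  then obtain \<Sigma> where \<Sigma>: "\<And>p. p \<in> \<Sigma> \<Longrightarrow> sentence T n p"
    and K: "\<And>S :: 'a atstr. Uni S \<noteq> {} \<Longrightarrow> strongly_representable T n S \<longleftrightarrow> models S \<Sigma>"
    unfolding elementary_def by blast
  \<comment> \<open>Both codings pass through sets of naturals, so \<open>f\<close> carries every
    structure used into \<open>'a\<close>.\<close>
  obtain f :: "nat set \<Rightarrow> 'a" where f: "inj f" using assms(2) by blast
  obtain c1 :: "(nat list \<times> nat) tuple_type \<Rightarrow> nat set" where c1: "inj c1"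
    using inj_code_countable by blast
  obtain c2 :: "(nat \<Rightarrow> nat list \<times> nat) tuple_type \<Rightarrow> nat set" where c2: "inj c2"
    using inj_code_sequences by blast
  obtain U :: "nat filter" where ult: "ultra U" "U \<le> at_top" using ultra_ex[of "at_top :: nat filter"] by auto
  define adj where "adj k = join_adj n (shift_adj k)" for k
  have pal: "palette n (adj k)" for k
    unfolding adj_def by (rule palette_join[OF n _ shift_not_fin_colourable]) (auto simp: shift_adj_def)
  interpret ultraproduct n adj U
    by unfold_locales (use n ult(1) palette.noiso[OF pal] in blast)+
  have Uni: "Uni (eta n V E) = typs n V E" for V and E :: "'w \<Rightarrow> 'w \<Rightarrow> bool" by (simp add: eta_def)
  have ne: "typs n UNIV (adj k) \<noteq> {}" for k using typs_nonempty[of k] by blast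
  have m: "models (eta n UNIV (adj k)) \<Sigma>" for k
  proof -
    have inj: "inj (f \<circ> c1)" using f c1 by (rule inj_compose)
    obtain S' :: "'a atstr" where S': "atstr_iso T n (eta n UNIV (adj k)) S' (f \<circ> c1)"
      by (rule atstr_copy[OF inj])
    have "Uni S' \<noteq> {}" using S' ne[of k] by (auto simp: atstr_iso_def bij_betw_def Uni)
    moreover have "strongly_representable T n S'"
      unfolding strongly_representable_iff_Cm
      by (rule representable_iso[OF S' palette.representable_eta[OF pal]])
    ultimately have "models S' \<Sigma>" using K by blast
    then show ?thesis using models_iso[OF S' _ \<Sigma>] ne Uni by metis
  qed
  obtain a where a: "\<And>k. a k \<in> typs n UNIV (adj k)" using typs_nonempty by metis
  obtain b where b: "b \<in> typs n LV ladj" "Lim a b" using Lim_left_total[OF a] by blast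
  have "models (eta n LV ladj) \<Sigma>"
  proof (subst models_iff[OF \<Sigma>, where v = "\<lambda>_. b"], assumption, rule ballI)
    fix p assume p: "p \<in> \<Sigma>"
    have "sat (eta n UNIV (adj k)) (\<lambda>x. a k) p" for k using m[of k] p unfolding models_def by blast
    then show "sat (eta n LV ladj) (\<lambda>_. b) p"
      using Los[of T p "\<lambda>_. a" "\<lambda>_. b"] \<Sigma>[OF p] b(2) by (simp add: sentence_def)
  qed
  note m_lim = this
  have inj: "inj (f \<circ> c2)" using f c2 by (rule inj_compose)
  obtain S' :: "'a atstr" where S': "atstr_iso T n (eta n LV ladj) S' (f \<circ> c2)"
    by (rule atstr_copy[OF inj])
  have "Uni S' \<noteq> {}" using S' b(1) by (auto simp: atstr_iso_def bij_betw_def Uni)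
  moreover have "models S' \<Sigma>" using m_lim models_iso[OF S' _ \<Sigma>] b(1) Uni by (metis empty_iff)
  ultimately have "strongly_representable T n S'" using K by blast
  then have "representable T n (Cm (eta n LV ladj))"
    unfolding strongly_representable_iff_Cm by (rule representable_iso[OF atstr_iso_sym[OF S']])
  moreover have "\<not> representable T n (Cm (eta n LV ladj))"
  proof -
    obtain par :: "(nat \<Rightarrow> nat list) \<Rightarrow> bool" where par: "\<And>x y. \<forall>\<^sub>F k in U. shift_adj k (x k) (y k) \<Longrightarrow> par x \<noteq> par y"
      using shift_limit_colouring[OF ult] by blast
    define cp where "cp x = (SOME c. c < n \<and> (\<forall>\<^sub>F k in U. snd (x k) mod n = c))" for x :: "nat \<Rightarrow> nat list \<times> nat"
    have cp: "cp x < n \<and> (\<forall>\<^sub>F k in U. snd (x k) mod n = cp x)" for x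
    proof -
      have "\<forall>\<^sub>F k in U. \<exists>c\<in>{..<n}. snd (x k) mod n = c" using n by (intro always_eventually) auto
      then have "\<exists>c. c < n \<and> (\<forall>\<^sub>F k in U. snd (x k) mod n = c)"
        unfolding ultra_bex_iff[OF ult(1) finite_lessThan] by blast
      then show ?thesis unfolding cp_def by (rule someI_ex)
    qed
    \<comment> \<open>The copy holding almost all terms and a parity within it: \<open>2 * n\<close>
      colours.\<close>
    define col where "col x = 2 * cp x + of_bool (par (\<lambda>k. fst (x k)))" for x
    show ?thesis
    proof (rule not_representable_eta[OF n, of LV ladj col "2 * n"])
      \<comment> \<open>Constant sequences with different terms have different classes.\<close>
      have "inj (\<lambda>j. r (\<lambda>_. ([j], 0)))"
        by (rule injI) (simp add: r_eq_iff ev_const)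
      then have "infinite (range (\<lambda>j. r (\<lambda>_. ([j], 0))))" by (rule range_inj_infinite)
      then show "infinite LV" unfolding LV_def by (rule contrapos_nn) (auto elim: finite_subset[rotated])
      show "\<exists>y\<in>LV. ladj x y" if "x \<in> LV" for x
      proof -
        have "\<exists>y. adj k (x k) y" for k by (rule palette.noiso[OF pal])
        then obtain y where y: "\<And>k. adj k (x k) (y k)" by metis
        then have "ladj x y" by (simp add: ladj_def)
        then have "ladj (r x) (r y)" by (simp add: ladj_r)
        moreover have "r x = x" using that r_r unfolding LV_def by auto
        ultimately show ?thesis unfolding LV_def by auto
      qed
      show "col x < 2 * n" for x using cp[of x] by (simp add: col_def of_bool_def)
      show "col x \<noteq> col y" if "ladj x y" for x y
      proof
        assume eq: "col x = col y"
        then have c: "cp x = cp y" and p: "par (\<lambda>k. fst (x k)) = par (\<lambda>k. fst (y k))"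
          unfolding col_def by (auto simp: of_bool_def split: if_splits) presburger+
        \<comment> \<open>Within a common copy adjacency can only come from the shift graph.\<close>
        have "\<forall>\<^sub>F k in U. shift_adj k (fst (x k)) (fst (y k))"
          using that[unfolded ladj_def] cp[of x, THEN conjunct2] cp[of y, THEN conjunct2]
          by eventually_elim (use c in \<open>simp add: adj_def join_adj_def\<close>)
        from par[OF this] p show False by blast
      qed
    qed
  qed
  ultimately show False by blast
qed

end
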